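(* There is an embedding from $\mathfrak D_q(\mathfrak{sl}_2)/\langle\mathbf C=0\rangle$ to the symmetric folding $\mathcal X_q^0$. Furthermore, the Chevalley generators $\{\mathbf e,\mathbf f,\mathbf K,\mathbf K'\}$ are realized as universally Laurent polynomials in $\mathcal O_q(\mathcal X^0)$.
   Context: $\mathfrak D_q(\mathfrak{sl}_2)$ is the algebra generated by $\mathbf e,\mathbf f,\mathbf K^{\pm1},\mathbf K'^{\pm1}$ with $\mathbf K\mathbf K'=\mathbf K'\mathbf K$, $\mathbf K\mathbf e=q^2\mathbf e\mathbf K$, $\mathbf K\mathbf f=q^{-2}\mathbf f\mathbf K$, $\mathbf K'\mathbf e=q^{-2}\mathbf e\mathbf K'$, $\mathbf K'\mathbf f=q^2\mathbf f\mathbf K'$, $[\mathbf e,\mathbf f]=(q-q^{-1})(\mathbf K'-\mathbf K)$. Its Casimir element is $\mathbf C=\mathbf f\mathbf e-q\mathbf K-q^{-1}\mathbf K'$. A cluster seed has a finite vertex set $Q$, frozen subset $Q_0$, exchange matrix $(\varepsilon_{ij})$ and multipliers $d_i>0$ such that $w_{ij}=d_i\varepsilon_{ij}$ is skew-symmetric; its quantum torus algebra is generated by $X_i^{\pm1}$ with $X_iX_j=q^{-2w_{ij}}X_jX_i$. Mutation at $k\in Q\setminus Q_0$: same $Q,Q_0$ and multipliers; $\varepsilon'_{ij}=-\varepsilon_{ij}$ if $k\in\{i,j\}$, else $\varepsilon_{ij}+\frac12(\varepsilon_{ik}|\varepsilon_{kj}|+|\varepsilon_{ik}|\varepsilon_{kj})$;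 on fraction fields (with $q_k=q^{d_k}$) $X'_k\mapsto X_k^{-1}$, $X_i'\mapsto X_i\prod_{r=1}^{|\varepsilon_{ki}|}(1+q_k^{2r-1}X_k)$ if $\varepsilon_{ki}\le0$, $X_i'\mapsto X_i\prod_{r=1}^{\varepsilon_{ki}}(1+q_k^{2r-1}X_k^{-1})^{-1}$ if $\varepsilon_{ki}\ge 0$ ($i\neq k$). Universally Laurent polynomials are the elements of the quantum torus algebra that remain Laurent polynomials under all sequences of mutations. The symmetric folding $\mathcal X_q^0$ is the quantum torus algebra of the seed with $Q=\{1,2,3\}$, $Q_0=\{1,3\}$ and multipliers $(d_1,d_2,d_3)=(1,2,1)$, generated by $X_1^0,X_2^0,X_3^0$ and inverses with $$X_1^0X_2^0=q^4X_2^0X_1^0,\quad X_2^0X_3^0=q^4X_3^0X_2^0,\quad X_3^0X_1^0=q^2X_1^0X_3^0,$$ i.e. $w_{21}=w_{32}=2$, $w_{13}=1$. $\mathcal O_q(\mathcal X^0)$ is the algebra of universally Laurent polynomials for this seed. *)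

theory Defs
  imports "HOL-Algebra.QuotRing" "HOL-Algebra.Module" "HOL-Library.Poly_Mapping"
begin

section \<open>Associative unital algebras over a field\<close>

text \<open>
  An algebra over the field \<open>'k\<close> is a \<^typ>\<open>('k, 'a) module\<close> record (a ring with a scalar
  multiplication). The locale \<^locale>\<open>algebra\<close> of the library is restricted to commutative
  algebras and is therefore not used.
\<close>

definition alg_hom :: "('k, 'a) module \<Rightarrow> ('k, 'b) module \<Rightarrow> ('a \<Rightarrow> 'b) set" where
  "alg_hom A B =
     {h \<in> ring_hom A B. \<forall>c. \<forall>x\<in>carrier A. h (c \<odot>\<^bsub>A\<^esub> x) = c \<odot>\<^bsub>B\<^esub> h x}"

text \<open>The union in the scalar multiplication is a single coset: all members agree.\<close>

definition alg_quot :: "('k, 'a) module \<Rightarrow> 'a set \<Rightarrow> ('k, 'a set) module" where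
  "alg_quot A I =
     ring.extend (A Quot I) \<lparr>smult = (\<lambda>c P. \<Union>x\<in>P. I +>\<^bsub>A\<^esub> (c \<odot>\<^bsub>A\<^esub> x))\<rparr>"

subsection \<open>Free algebras and presentations\<close>

datatype 'g free_monoid = Word (letters: "'g list")

instantiation free_monoid :: (type) monoid_add
begin

definition zero_free_monoid :: "'a free_monoid" where
  "0 = Word []"

definition plus_free_monoid :: "'a free_monoid \<Rightarrow> 'a free_monoid \<Rightarrow> 'a free_monoid" where
  "u + v = Word (letters u @ letters v)"

instance
  by standard (auto simp: zero_free_monoid_def plus_free_monoid_def)

end

text \<open>
  Noncommutative polynomials are finitely supported functions on words; their product in
  \<^theory>\<open>HOL-Library.Poly_Mapping\<close> is convolution with respect to concatenation.
\<close>

type_synonym ('g, 'k) ncpoly = "'g free_monoid \<Rightarrow>\<^sub>0 'k"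

definition scalar :: "'k \<Rightarrow> ('g, 'k::field) ncpoly" where
  "scalar c = Poly_Mapping.single 0 c"

definition gen :: "'g \<Rightarrow> ('g, 'k::field) ncpoly" where
  "gen g = Poly_Mapping.single (Word [g]) 1"

definition free_algebra :: "'g set \<Rightarrow> ('k::field, ('g, 'k) ncpoly) module" where
  "free_algebra G =
     \<lparr>carrier = {p. \<forall>w \<in> Poly_Mapping.keys p. set (letters w) \<subseteq> G},
      mult = (*), one = 1, zero = 0, add = (+), smult = (\<lambda>c p. scalar c * p)\<rparr>"

text \<open>
  Generators \<open>G\<close>, and each member of \<open>R\<close> set to zero. Ideals in \<^theory>\<open>HOL-Algebra.Ideal\<close>
  are two-sided.
\<close>

definition presented_algebra ::
    "'g set \<Rightarrow> ('g, 'k::field) ncpoly set \<Rightarrow> ('k, ('g, 'k) ncpoly set) module" where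
  "presented_algebra G R = alg_quot (free_algebra G) (Idl\<^bsub>free_algebra G\<^esub> R)"

definition presented_elem ::
    "'g set \<Rightarrow> ('g, 'k::field) ncpoly set \<Rightarrow> ('g, 'k) ncpoly \<Rightarrow> ('g, 'k) ncpoly set" where
  "presented_elem G R p = (Idl\<^bsub>free_algebra G\<^esub> R) +>\<^bsub>free_algebra G\<^esub> p"

subsection \<open>The skew field of fractions of an Ore domain\<close>

text \<open>
  The pair \<open>(a, b)\<close> with \<open>b \<noteq> 0\<close> stands for the right fraction \<open>a b\<^sup>-\<^sup>1\<close>. Two fractions are
  identified if they agree after expansion to a common denominator. The operations collect
  all admissible choices of a common denominator (for sums) and of
  \<open>b\<^sup>-\<^sup>1 c = u v\<^sup>-\<^sup>1\<close> (for products \<open>a b\<^sup>-\<^sup>1 c d\<^sup>-\<^sup>1\<close>); for an Ore domain the resulting union is a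
  single equivalence class. Quantum torus algebras are Ore domains.
\<close>

definition fractions :: "('k, 'a) module \<Rightarrow> ('a \<times> 'a) set" where
  "fractions R = carrier R \<times> (carrier R - {\<zero>\<^bsub>R\<^esub>})"

definition frac_rel :: "('k, 'a) module \<Rightarrow> (('a \<times> 'a) \<times> ('a \<times> 'a)) set" where
  "frac_rel R =
     {((a, b), (c, d)). (a, b) \<in> fractions R \<and> (c, d) \<in> fractions R \<and>
        (\<exists>u\<in>carrier R. \<exists>v\<in>carrier R.
           b \<otimes>\<^bsub>R\<^esub> u = d \<otimes>\<^bsub>R\<^esub> v \<and> b \<otimes>\<^bsub>R\<^esub> u \<noteq> \<zero>\<^bsub>R\<^esub> \<and> a \<otimes>\<^bsub>R\<^esub> u = c \<otimes>\<^bsub>R\<^esub> v)}"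

definition frac_class :: "('k, 'a) module \<Rightarrow> 'a \<Rightarrow> 'a \<Rightarrow> ('a \<times> 'a) set" where
  "frac_class R a b = frac_rel R `` {(a, b)}"

definition frac_mult ::
    "('k, 'a) module \<Rightarrow> ('a \<times> 'a) set \<Rightarrow> ('a \<times> 'a) set \<Rightarrow> ('a \<times> 'a) set" where
  "frac_mult R P P' =
     \<Union>{frac_class R (a \<otimes>\<^bsub>R\<^esub> u) (d \<otimes>\<^bsub>R\<^esub> v) | a b c d u v.
         (a, b) \<in> P \<and> (c, d) \<in> P' \<and> u \<in> carrier R \<and> v \<in> carrier R \<and>
         b \<otimes>\<^bsub>R\<^esub> u = c \<otimes>\<^bsub>R\<^esub> v \<and> v \<noteq> \<zero>\<^bsub>R\<^esub>}"

definition frac_add ::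
    "('k, 'a) module \<Rightarrow> ('a \<times> 'a) set \<Rightarrow> ('a \<times> 'a) set \<Rightarrow> ('a \<times> 'a) set" where
  "frac_add R P P' =
     \<Union>{frac_class R (a \<otimes>\<^bsub>R\<^esub> u \<oplus>\<^bsub>R\<^esub> c \<otimes>\<^bsub>R\<^esub> v) (b \<otimes>\<^bsub>R\<^esub> u) | a b c d u v.
         (a, b) \<in> P \<and> (c, d) \<in> P' \<and> u \<in> carrier R \<and> v \<in> carrier R \<and>
         b \<otimes>\<^bsub>R\<^esub> u = d \<otimes>\<^bsub>R\<^esub> v \<and> b \<otimes>\<^bsub>R\<^esub> u \<noteq> \<zero>\<^bsub>R\<^esub>}"

definition frac_smult :: "('k, 'a) module \<Rightarrow> 'k \<Rightarrow> ('a \<times> 'a) set \<Rightarrow> ('a \<times> 'a) set" where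
  "frac_smult R c P = (\<Union>(a, b)\<in>P. frac_class R (c \<odot>\<^bsub>R\<^esub> a) b)"

definition frac_field :: "('k, 'a) module \<Rightarrow> ('k, ('a \<times> 'a) set) module" where
  "frac_field R =
     \<lparr>carrier = fractions R // frac_rel R, mult = frac_mult R,
      one = frac_class R \<one>\<^bsub>R\<^esub> \<one>\<^bsub>R\<^esub>, zero = frac_class R \<zero>\<^bsub>R\<^esub> \<one>\<^bsub>R\<^esub>,
      add = frac_add R, smult = frac_smult R\<rparr>"

definition frac_embed :: "('k, 'a) module \<Rightarrow> 'a \<Rightarrow> ('a \<times> 'a) set" where
  "frac_embed R a = frac_class R a \<one>\<^bsub>R\<^esub>"


section \<open>Quantum cluster seeds\<close>

text \<open>
  The exchange matrix and the multipliers are taken integral, which covers the seeds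
  considered here and is preserved by mutation. Entries of the exchange matrix outside
  \<open>vertices\<close> are irrelevant.
\<close>

record 'v seed =
  vertices :: "'v set"
  frozen :: "'v set"
  exch :: "'v \<Rightarrow> 'v \<Rightarrow> int"
  multiplier :: "'v \<Rightarrow> nat"

definition weight :: "'v seed \<Rightarrow> 'v \<Rightarrow> 'v \<Rightarrow> int" where
  "weight s i j = int (multiplier s i) * exch s i j"

definition is_seed :: "'v seed \<Rightarrow> bool" where
  "is_seed s \<longleftrightarrow> finite (vertices s) \<and> frozen s \<subseteq> vertices s \<and>
     (\<forall>i\<in>vertices s. multiplier s i > 0) \<and>
     (\<forall>i\<in>vertices s. \<forall>j\<in>vertices s. weight s i j = - weight s j i)"

text \<open>The division by 2 is exact: \<open>x * \<bar>y\<bar> + \<bar>x\<bar> * y\<close> is \<open>0\<close> or \<open>\<plusminus>2 * x * y\<close>.\<close>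

definition mutate :: "'v \<Rightarrow> 'v seed \<Rightarrow> 'v seed" where
  "mutate k s = s\<lparr>exch := (\<lambda>i j.
     if i = k \<or> j = k then - exch s i j
     else exch s i j + (exch s i k * \<bar>exch s k j\<bar> + \<bar>exch s i k\<bar> * exch s k j) div 2)\<rparr>"

subsection \<open>Quantum torus algebras\<close>

datatype 'v torus_gen = X 'v | Xinv 'v

definition torus_gens :: "'v seed \<Rightarrow> 'v torus_gen set" where
  "torus_gens s = X ` vertices s \<union> Xinv ` vertices s"

definition torus_rels :: "'k::field \<Rightarrow> 'v seed \<Rightarrow> ('v torus_gen, 'k) ncpoly set" where
  "torus_rels q s =
     {gen (X i) * gen (Xinv i) - 1 | i. i \<in> vertices s} \<union>
     {gen (Xinv i) * gen (X i) - 1 | i. i \<in> vertices s} \<union>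
     {gen (X i) * gen (X j) - scalar (q powi (- 2 * weight s i j)) * (gen (X j) * gen (X i))
       | i j. i \<in> vertices s \<and> j \<in> vertices s}"

definition torus ::
    "'k::field \<Rightarrow> 'v seed \<Rightarrow> ('k, ('v torus_gen, 'k) ncpoly set) module" where
  "torus q s = presented_algebra (torus_gens s) (torus_rels q s)"

type_synonym ('v, 'k) torus_frac =
  "(('v torus_gen, 'k) ncpoly set \<times> ('v torus_gen, 'k) ncpoly set) set"

definition torus_field ::
    "'k::field \<Rightarrow> 'v seed \<Rightarrow> ('k, ('v, 'k) torus_frac) module" where
  "torus_field q s = frac_field (torus q s)"

definition cluster_var :: "'k::field \<Rightarrow> 'v seed \<Rightarrow> 'v \<Rightarrow> ('v, 'k) torus_frac" where
  "cluster_var q s i =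
     frac_embed (torus q s) (presented_elem (torus_gens s) (torus_rels q s) (gen (X i)))"

subsection \<open>Quantum mutation and universally Laurent polynomials\<close>

text \<open>
  \<open>binomial_prod A p x n\<close> is the product of \<open>1 + p\<^sup>2\<^sup>r\<^sup>-\<^sup>1 x\<close> for \<open>r = 1, \<dots>, n\<close>. The factors
  commute, so their order is immaterial.
\<close>

fun binomial_prod :: "('k::field, 'a) module \<Rightarrow> 'k \<Rightarrow> 'a \<Rightarrow> nat \<Rightarrow> 'a" where
  "binomial_prod A p x 0 = \<one>\<^bsub>A\<^esub>"
| "binomial_prod A p x (Suc n) =
     binomial_prod A p x n \<otimes>\<^bsub>A\<^esub> (\<one>\<^bsub>A\<^esub> \<oplus>\<^bsub>A\<^esub> p ^ (2 * Suc n - 1) \<odot>\<^bsub>A\<^esub> x)"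

definition mutated_var :: "'k::field \<Rightarrow> 'v \<Rightarrow> 'v seed \<Rightarrow> 'v \<Rightarrow> ('v, 'k) torus_frac" where
  "mutated_var q k s i =
     (let F = torus_field q s; x = cluster_var q s; qk = q ^ multiplier s k; e = exch s k i in
      if i = k then inv\<^bsub>F\<^esub> (x k)
      else if e \<le> 0 then x i \<otimes>\<^bsub>F\<^esub> binomial_prod F qk (x k) (nat \<bar>e\<bar>)
      else x i \<otimes>\<^bsub>F\<^esub> inv\<^bsub>F\<^esub> (binomial_prod F qk (inv\<^bsub>F\<^esub> (x k)) (nat e)))"

definition is_mutation_map ::
    "'k::field \<Rightarrow> 'v \<Rightarrow> 'v seed \<Rightarrow> (('v, 'k) torus_frac \<Rightarrow> ('v, 'k) torus_frac) \<Rightarrow> bool" where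
  "is_mutation_map q k s \<mu> \<longleftrightarrow>
     \<mu> \<in> alg_hom (torus_field q (mutate k s)) (torus_field q s) \<and>
     (\<forall>i\<in>vertices s. \<mu> (cluster_var q (mutate k s) i) = mutated_var q k s i)"

text \<open>
  The values on the cluster variables determine a homomorphism of skew fields on its whole
  carrier; the choice below only concerns arguments outside the carrier.
\<close>

definition mutation_map ::
    "'k::field \<Rightarrow> 'v \<Rightarrow> 'v seed \<Rightarrow> ('v, 'k) torus_frac \<Rightarrow> ('v, 'k) torus_frac" where
  "mutation_map q k s = (SOME \<mu>. is_mutation_map q k s \<mu>)"

text \<open>
  \<open>laurent_after q [k\<^sub>1, \<dots>, k\<^sub>n] s\<close>: the elements of the fraction field of \<open>s\<close> that are Laurent
  polynomials in the cluster variables obtained by mutating first at \<open>k\<^sub>1\<close>, \<dots>, last at \<open>k\<^sub>n\<close>.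
\<close>

fun laurent_after :: "'k::field \<Rightarrow> 'v list \<Rightarrow> 'v seed \<Rightarrow> ('v, 'k) torus_frac set" where
  "laurent_after q [] s = frac_embed (torus q s) ` carrier (torus q s)"
| "laurent_after q (k # ks) s = mutation_map q k s ` laurent_after q ks (mutate k s)"

definition universally_laurent ::
    "'k::field \<Rightarrow> 'v seed \<Rightarrow> ('v torus_gen, 'k) ncpoly set set" where
  "universally_laurent q s =
     {u \<in> carrier (torus q s).
        \<forall>ks. set ks \<subseteq> vertices s - frozen s \<longrightarrow>
          frac_embed (torus q s) u \<in> laurent_after q ks s}"

subsection \<open>The symmetric folding\<close>

definition folding_seed :: "nat seed" where
  "folding_seed =
     \<lparr>vertices = {1, 2, 3}, frozen = {1, 3},
      exch = (\<lambda>_ _. 0)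
        (1 := (\<lambda>_. 0)(2 := - 2, 3 := 1),
         2 := (\<lambda>_. 0)(1 := 1, 3 := - 1),
         3 := (\<lambda>_. 0)(1 := - 1, 2 := 2)),
      multiplier = (\<lambda>_. 1)(2 := 2)\<rparr>"

lemma is_seed_folding_seed: "is_seed folding_seed"
  by (simp add: is_seed_def weight_def folding_seed_def)

lemma weight_folding_seed:
  "weight folding_seed 2 1 = 2" "weight folding_seed 3 2 = 2" "weight folding_seed 1 3 = 1"
  by (simp_all add: weight_def folding_seed_def)


section \<open>The Drinfeld double of \<open>sl\<^sub>2\<close> and its Casimir element\<close>

datatype dq_gen = E | F | K | Kinv | K' | K'inv

definition dq_rels :: "'k::field \<Rightarrow> (dq_gen, 'k) ncpoly set" where
  "dq_rels q =
     {gen K * gen Kinv - 1, gen Kinv * gen K - 1,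
      gen K' * gen K'inv - 1, gen K'inv * gen K' - 1,
      gen K * gen K' - gen K' * gen K,
      gen K * gen E - scalar (q powi 2) * (gen E * gen K),
      gen K * gen F - scalar (q powi (- 2)) * (gen F * gen K),
      gen K' * gen E - scalar (q powi (- 2)) * (gen E * gen K'),
      gen K' * gen F - scalar (q powi 2) * (gen F * gen K'),
      (gen E * gen F - gen F * gen E) - scalar (q - inverse q) * (gen K' - gen K)}"

definition Dq :: "'k::field \<Rightarrow> ('k, (dq_gen, 'k) ncpoly set) module" where
  "Dq q = presented_algebra UNIV (dq_rels q)"

definition Dq_elem :: "'k::field \<Rightarrow> (dq_gen, 'k) ncpoly \<Rightarrow> (dq_gen, 'k) ncpoly set" where
  "Dq_elem q p = presented_elem UNIV (dq_rels q) p"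

definition casimir :: "'k::field \<Rightarrow> (dq_gen, 'k) ncpoly set" where
  "casimir q = Dq_elem q (gen F * gen E - scalar q * gen K - scalar (inverse q) * gen K')"

definition Dq_mod_casimir :: "'k::field \<Rightarrow> ('k, (dq_gen, 'k) ncpoly set set) module" where
  "Dq_mod_casimir q = alg_quot (Dq q) (Idl\<^bsub>Dq q\<^esub> {casimir q})"

definition chevalley :: "'k::field \<Rightarrow> dq_gen \<Rightarrow> (dq_gen, 'k) ncpoly set set" where
  "chevalley q g = (Idl\<^bsub>Dq q\<^esub> {casimir q}) +>\<^bsub>Dq q\<^esub> Dq_elem q (gen g)"

end

theory Submission
  imports Defs "HOL.Vector_Spaces" "HOL-Library.Product_Lexorder" "HOL-Library.Product_Plus"
begin

text \<open>
  The embedding is \<open>e \<mapsto> X\<^sub>1\<close>, \<open>f \<mapsto> X\<^sub>3 (1 + q\<^sup>2 X\<^sub>2)\<close>, \<open>K \<mapsto> q X\<^sub>1 X\<^sub>3\<close>, \<open>K' \<mapsto> q X\<^sub>1 X\<^sub>3 X\<^sub>2\<close>.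

  Injectivity. The relation \<open>C = 0\<close> says \<open>f e = q K + q\<^sup>-\<^sup>1 K'\<close>, and with the commutator relation
  \<open>e f = q\<^sup>-\<^sup>1 K + q K'\<close>. Hence the quotient is spanned by the elements \<open>e\<^sup>n K\<^sup>b K'\<^sup>m\<close> and
  \<open>f\<^sup>n K\<^sup>b K'\<^sup>m\<close> (\<open>dq_monomials_span\<close>). Grade the torus by the exponent of \<open>X\<^sub>1\<close> minus that of
  \<open>X\<^sub>3\<close>. The images of \<open>e\<^sup>n\<close> and \<open>f\<^sup>n\<close> are homogeneous of degree \<open>n\<close> and \<open>-n\<close>, those of
  \<open>K\<^sup>b K'\<^sup>m\<close> are multiples of distinct Laurent monomials of degree \<open>0\<close>, and the torus has no
  zero divisors; so the images of the spanning elements are linearly independent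
  (\<open>quotient_hom_inj\<close>, by \<open>graded_independent\<close>).

  Universal Laurentness. Only vertex 2 can be mutated, and mutation at 2 turns the seed into the
  same seed with the vertices 1 and 3 exchanged. In the new variables the four elements are given
  by the same formulas with \<open>e, f\<close> and \<open>K, K'\<close> exchanged (\<open>mutation_chev\<close>). So they stay Laurent
  polynomials under any number of mutations (\<open>chev_laurent_after\<close>).

  For this to have a meaning the mutation has to exist as a homomorphism between skew fields of
  fractions, and most of the work goes into that. Three ingredients are needed.

  \<^item> The quantum torus is isomorphic to a twisted group algebra of \<open>\<int>\<^sup>3\<close> (\<open>torus_model_iso\<close>).
    There, leading terms show that there are no zero divisors (\<open>twisted_mult_nonzero\<close>), and
    counting dimensions in large boxes gives the right Ore condition (\<open>right_ore\<close>,
    \<open>folner_boxes\<close>).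

  \<^item> The fractions of an Ore domain form a skew field (\<open>ring_frac_field\<close>,
    \<open>frac_nonzero_unit\<close>). The proof reads a fraction \<open>a b\<^sup>-\<^sup>1\<close> as the partial map that sends
    \<open>b u\<close> to \<open>a u\<close>: addition and multiplication become pointwise addition and composition. An
    injective homomorphism into a skew field extends to fractions (\<open>extend_to_fractions\<close>).

  \<^item> The mutated variables satisfy the relations of the mutated torus, and the resulting
    homomorphism from that torus is injective (\<open>model_hom_injective\<close>): after multiplication by
    units only powers of elements with Laurent images occur, and then the grading by the exponents
    of \<open>X\<^sub>1\<close> and \<open>X\<^sub>3\<close> separates the terms.
\<close>

section \<open>Algebras over a field\<close>

abbreviation "single \<equiv> Poly_Mapping.single"
abbreviation "lookup \<equiv> Poly_Mapping.lookup"
abbreviation "keys \<equiv> Poly_Mapping.keys"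

abbreviation scale :: "'k::field \<Rightarrow> ('a \<Rightarrow>\<^sub>0 'k) \<Rightarrow> 'a \<Rightarrow>\<^sub>0 'k" where
  "scale c \<equiv> Poly_Mapping.map ((*) c)"

text \<open>
  For properties that refer to the support: one monomial outside the support is added at a time,
  and the support of the sum is known.
\<close>

lemma poly_mapping_keys_induct [case_names zero single_add]:
  fixes p :: "'a \<Rightarrow>\<^sub>0 'b::monoid_add"
  assumes "P 0"
    and "\<And>k v p. \<lbrakk>k \<notin> keys p; v \<noteq> 0;
            keys (single k v + p) = insert k (keys p); P p\<rbrakk>
          \<Longrightarrow> P (single k v + p)"
  shows "P p"
proof (induction p rule: update_induct)
  case const
  show ?case by fact
next
  case (update f a b)
  have eq: "Poly_Mapping.update a b f = single a b + f"
    using update(1) by (intro poly_mapping_eqI)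
      (auto simp: lookup_add lookup_update lookup_single when_def in_keys_iff)
  have "keys (single a b + f) = insert a (keys f)"
    using update(1,2) by (auto simp: in_keys_iff lookup_add lookup_single when_def split: if_splits)
  then show ?case using assms(2)[of a f b] update unfolding eq by blast
qed

lemma poly_mapping_linear_induct [case_names zero single add]:
  fixes p :: "'a \<Rightarrow>\<^sub>0 'b::monoid_add"
  assumes "P 0" "\<And>k v. P (single k v)" "\<And>p r. P p \<Longrightarrow> P r \<Longrightarrow> P (p + r)"
  shows "P p"
  by (induction p rule: poly_mapping_keys_induct) (auto intro: assms)


locale field_algebra = ring A for A :: "('k::field, 'a) module" (structure) +
  assumes smult_closed [simp]: "x \<in> carrier A \<Longrightarrow> c \<odot> x \<in> carrier A"
    and smult_l_distr: "x \<in> carrier A \<Longrightarrow> (c + d) \<odot> x = c \<odot> x \<oplus> d \<odot> x"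
    and smult_r_distr: "\<lbrakk>x \<in> carrier A; y \<in> carrier A\<rbrakk> \<Longrightarrow> c \<odot> (x \<oplus> y) = c \<odot> x \<oplus> c \<odot> y"
    and smult_smult: "x \<in> carrier A \<Longrightarrow> c \<odot> (d \<odot> x) = (c * d) \<odot> x"
    and smult_one: "x \<in> carrier A \<Longrightarrow> 1 \<odot> x = x"
    and smult_mult_left: "\<lbrakk>x \<in> carrier A; y \<in> carrier A\<rbrakk> \<Longrightarrow> (c \<odot> x) \<otimes> y = c \<odot> (x \<otimes> y)"
    and smult_mult_right: "\<lbrakk>x \<in> carrier A; y \<in> carrier A\<rbrakk> \<Longrightarrow> x \<otimes> (c \<odot> y) = c \<odot> (x \<otimes> y)"
begin

lemma smult_zero_scalar [simp]: "x \<in> carrier A \<Longrightarrow> 0 \<odot> x = \<zero>"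
  using smult_l_distr[of x 0 0] by (simp add: add.r_cancel_one')

lemma smult_zero [simp]: "c \<odot> \<zero> = \<zero>"
  using smult_r_distr[of \<zero> \<zero> c] by (simp add: add.r_cancel_one')

lemma smult_a_inv: "x \<in> carrier A \<Longrightarrow> c \<odot> (\<ominus> x) = \<ominus> (c \<odot> x)"
  by (rule minus_equality[symmetric]) (simp_all add: smult_r_distr [symmetric] l_neg)

lemma smult_smult_inverse:
  "\<lbrakk>x \<in> carrier A; y \<in> carrier A; c \<noteq> 0; x = c \<odot> y\<rbrakk> \<Longrightarrow> y = inverse c \<odot> x"
  by (simp add: smult_smult smult_one)

lemma smult_uminus: "x \<in> carrier A \<Longrightarrow> (- c) \<odot> x = \<ominus> (c \<odot> x)"
  using smult_l_distr[of x "- c" c] by (intro minus_equality [symmetric]) simp_all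

lemma smult_add_pairs:
  "\<lbrakk>x \<in> carrier A; y \<in> carrier A\<rbrakk>
    \<Longrightarrow> (a \<odot> x \<oplus> b \<odot> y) \<oplus> (c \<odot> x \<oplus> d \<odot> y) = (a + c) \<odot> x \<oplus> (b + d) \<odot> y"
  by (simp add: smult_l_distr a_ac)

lemma eq_of_minus_zero: "\<lbrakk>x \<ominus> y = \<zero>; x \<in> carrier A; y \<in> carrier A\<rbrakk> \<Longrightarrow> x = y"
  unfolding minus_eq using minus_equality[of x "\<ominus> y"] by simp

lemmas smult_simps = smult_smult smult_one smult_mult_left smult_mult_right

end

lemma alg_homI:
  assumes "\<And>x. x \<in> carrier A \<Longrightarrow> h x \<in> carrier B"
    and "\<And>x y. \<lbrakk>x \<in> carrier A; y \<in> carrier A\<rbrakk> \<Longrightarrow> h (x \<otimes>\<^bsub>A\<^esub> y) = h x \<otimes>\<^bsub>B\<^esub> h y"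
    and "\<And>x y. \<lbrakk>x \<in> carrier A; y \<in> carrier A\<rbrakk> \<Longrightarrow> h (x \<oplus>\<^bsub>A\<^esub> y) = h x \<oplus>\<^bsub>B\<^esub> h y"
    and "h \<one>\<^bsub>A\<^esub> = \<one>\<^bsub>B\<^esub>"
    and "\<And>c x. x \<in> carrier A \<Longrightarrow> h (c \<odot>\<^bsub>A\<^esub> x) = c \<odot>\<^bsub>B\<^esub> h x"
  shows "h \<in> alg_hom A B"
  unfolding alg_hom_def by (auto intro!: ring_hom_memI assms)

lemma alg_hom_trans: "\<lbrakk>h \<in> alg_hom A B; h' \<in> alg_hom B C\<rbrakk> \<Longrightarrow> h' \<circ> h \<in> alg_hom A C"
  by (auto simp: alg_hom_def ring_hom_trans ring_hom_closed)

locale field_algebra_hom = A: field_algebra A + B: field_algebra B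
  for A :: "('k::field, 'a) module" and B :: "('k, 'b) module" +
  fixes h assumes hom: "h \<in> alg_hom A B"
begin

lemma ring_hom: "h \<in> ring_hom A B"
  using hom by (simp add: alg_hom_def)

lemma ring_hom_ring: "ring_hom_ring A B h"
  by (intro ring_hom_ringI2 A.ring_axioms B.ring_axioms ring_hom)

lemma hom_closed [simp]: "x \<in> carrier A \<Longrightarrow> h x \<in> carrier B"
  and hom_mult [simp]: "\<lbrakk>x \<in> carrier A; y \<in> carrier A\<rbrakk> \<Longrightarrow> h (x \<otimes>\<^bsub>A\<^esub> y) = h x \<otimes>\<^bsub>B\<^esub> h y"
  and hom_add [simp]: "\<lbrakk>x \<in> carrier A; y \<in> carrier A\<rbrakk> \<Longrightarrow> h (x \<oplus>\<^bsub>A\<^esub> y) = h x \<oplus>\<^bsub>B\<^esub> h y"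
  and hom_one [simp]: "h \<one>\<^bsub>A\<^esub> = \<one>\<^bsub>B\<^esub>"
  using ring_hom by (simp_all add: ring_hom_closed ring_hom_mult ring_hom_add ring_hom_one)

lemma hom_zero [simp]: "h \<zero>\<^bsub>A\<^esub> = \<zero>\<^bsub>B\<^esub>"
  using ring_hom A.ring_axioms B.ring_axioms by (rule ring_hom_zero)

lemma hom_a_inv [simp]: "x \<in> carrier A \<Longrightarrow> h (\<ominus>\<^bsub>A\<^esub> x) = \<ominus>\<^bsub>B\<^esub> h x"
  by (rule B.minus_equality [symmetric]) (simp_all flip: hom_add add: A.l_neg)

lemma hom_smult [simp]: "x \<in> carrier A \<Longrightarrow> h (c \<odot>\<^bsub>A\<^esub> x) = c \<odot>\<^bsub>B\<^esub> h x"
  using hom by (simp add: alg_hom_def)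

lemma hom_minus: "\<lbrakk>x \<in> carrier A; y \<in> carrier A\<rbrakk> \<Longrightarrow> h (x \<ominus>\<^bsub>A\<^esub> y) = h x \<ominus>\<^bsub>B\<^esub> h y"
  by (simp add: a_minus_def)

lemma inj_onI_zero:
  assumes "\<And>x. \<lbrakk>x \<in> carrier A; h x = \<zero>\<^bsub>B\<^esub>\<rbrakk> \<Longrightarrow> x = \<zero>\<^bsub>A\<^esub>"
  shows "inj_on h (carrier A)"
proof (rule inj_onI)
  fix x y assume xy: "x \<in> carrier A" "y \<in> carrier A" "h x = h y"
  have "h (x \<ominus>\<^bsub>A\<^esub> y) = \<zero>\<^bsub>B\<^esub>"
    unfolding hom_minus[OF xy(1,2)] using xy by (metis B.minus_eq B.r_neg hom_closed)
  with assms[of "x \<ominus>\<^bsub>A\<^esub> y"] xy have "x \<ominus>\<^bsub>A\<^esub> y = \<zero>\<^bsub>A\<^esub>" by simp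
  with xy show "x = y" by (simp add: A.eq_of_minus_zero)
qed

end

lemma field_algebra_homI:
  "\<lbrakk>field_algebra A; field_algebra B; h \<in> alg_hom A B\<rbrakk> \<Longrightarrow> field_algebra_hom A B h"
  by (simp add: field_algebra_hom_def field_algebra_hom_axioms_def)

lemma alg_hom_inv:
  assumes "field_algebra A" "field_algebra B" "h \<in> alg_hom A B" "bij_betw h (carrier A) (carrier B)"
  shows "inv_into (carrier A) h \<in> alg_hom B A"
proof -
  interpret field_algebra_hom A B h by (intro field_algebra_homI assms)
  let ?k = "inv_into (carrier A) h"
  have k: "?k y \<in> carrier A" "h (?k y) = y" if "y \<in> carrier B" for y
    using bij_betw_inv_into_right[OF assms(4) that] bij_betw_inv_into[OF assms(4)] that
    by (auto dest: bij_betwE)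
  have eqI: "?k y = x" if "x \<in> carrier A" "h x = y" for x y
    using that assms(4) by (metis bij_betw_inv_into_left)
  show ?thesis
    by (rule alg_homI; (intro eqI)?) (simp_all add: k)
qed


subsection \<open>Linear combinations\<close>

text \<open>
  Coefficient vectors are finitely supported functions. Noncommutative polynomials and elements of
  twisted monoid algebras are themselves such functions, so evaluation and the comparison of bases
  are instances of this one construction.
\<close>

definition lincomb :: "('k::field, 'a) module \<Rightarrow> ('j \<Rightarrow> 'a) \<Rightarrow> ('j \<Rightarrow>\<^sub>0 'k) \<Rightarrow> 'a" where
  "lincomb A b p = (\<Oplus>\<^bsub>A\<^esub>j\<in>keys p. lookup p j \<odot>\<^bsub>A\<^esub> b j)"

context field_algebra
begin

lemma lincomb_superset:
  assumes "\<And>j. b j \<in> carrier A" "finite S" "keys p \<subseteq> S"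
  shows "lincomb A b p = (\<Oplus>j\<in>S. lookup p j \<odot> b j)"
  unfolding lincomb_def
  by (rule add.finprod_mono_neutral_cong_left) (use assms in \<open>auto simp: in_keys_iff\<close>)

lemma lincomb_closed [simp]: "(\<And>j. b j \<in> carrier A) \<Longrightarrow> lincomb A b p \<in> carrier A"
  unfolding lincomb_def by (rule finsum_closed) auto

lemma lincomb_zero [simp]: "lincomb A b 0 = \<zero>"
  by (simp add: lincomb_def)

lemma lincomb_add:
  assumes "\<And>j. b j \<in> carrier A"
  shows "lincomb A b (p + r) = lincomb A b p \<oplus> lincomb A b r"
proof -
  let ?S = "keys p \<union> keys r"
  have "lincomb A b (p + r) = (\<Oplus>j\<in>?S. lookup p j \<odot> b j \<oplus> lookup r j \<odot> b j)"
    using keys_add[of p r]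
    by (subst lincomb_superset[of _ ?S])
       (auto simp: assms lookup_add smult_l_distr intro!: finsum_cong')
  also have "\<dots> = lincomb A b p \<oplus> lincomb A b r"
    by (subst finsum_addf) (auto simp: assms lincomb_superset[of b ?S])
  finally show ?thesis .
qed

lemma lincomb_single: "b k \<in> carrier A \<Longrightarrow> lincomb A b (single k v) = v \<odot> b k"
  by (cases "v = 0") (simp_all add: lincomb_def)

lemma lincomb_cong:
  assumes "\<And>j. j \<in> keys p \<Longrightarrow> b j = b' j" "\<And>j. b' j \<in> carrier A"
  shows "lincomb A b p = lincomb A b' p"
  unfolding lincomb_def by (rule finsum_cong') (simp_all add: assms)


end

lemma (in field_algebra_hom) hom_lincomb:
  assumes "\<And>j. b j \<in> carrier A"
  shows "h (lincomb A b p) = lincomb B (\<lambda>j. h (b j)) p"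
  by (induction p rule: poly_mapping_linear_induct)
     (simp_all add: assms A.lincomb_add B.lincomb_add A.lincomb_single B.lincomb_single)

definition linear_subspace :: "('k::field, 'a) module \<Rightarrow> 'a set \<Rightarrow> bool" where
  "linear_subspace A L \<longleftrightarrow> L \<subseteq> carrier A \<and> \<zero>\<^bsub>A\<^esub> \<in> L \<and> (\<forall>x\<in>L. \<forall>y\<in>L. x \<oplus>\<^bsub>A\<^esub> y \<in> L) \<and>
     (\<forall>c. \<forall>x\<in>L. c \<odot>\<^bsub>A\<^esub> x \<in> L)"

lemma linear_subspaceD:
  assumes "linear_subspace A L"
  shows "L \<subseteq> carrier A" "\<zero>\<^bsub>A\<^esub> \<in> L" "\<lbrakk>x \<in> L; y \<in> L\<rbrakk> \<Longrightarrow> x \<oplus>\<^bsub>A\<^esub> y \<in> L"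
    "x \<in> L \<Longrightarrow> c \<odot>\<^bsub>A\<^esub> x \<in> L"
  using assms by (simp_all add: linear_subspace_def)

lemma (in field_algebra) linear_subspace_lincombs:
  assumes b: "\<And>j. b j \<in> carrier A"
  shows "linear_subspace A (range (lincomb A b))"
proof -
  have plus: "lincomb A b p \<oplus> lincomb A b r \<in> range (lincomb A b)" for p r
    by (rule range_eqI[of _ _ "p + r"]) (simp add: lincomb_add b)
  have scale: "c \<odot> lincomb A b p \<in> range (lincomb A b)" for c p
  proof (induction p rule: poly_mapping_linear_induct)
    case zero
    show ?case by (rule range_eqI[of _ _ 0]) simp
  next
    case (single k v)
    show ?case
      by (rule range_eqI[of _ _ "single k (c * v)"]) (simp add: lincomb_single b smult_smult)
  next
    case (add p r)
    then obtain p' r' where "c \<odot> lincomb A b p = lincomb A b p'" "c \<odot> lincomb A b r = lincomb A b r'"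
      by auto
    then show ?case using plus[of p' r'] by (simp add: lincomb_add b smult_r_distr)
  qed
  have zero: "\<zero> \<in> range (lincomb A b)" by (rule range_eqI[of _ _ 0]) simp
  have sub: "range (lincomb A b) \<subseteq> carrier A"
    by (intro image_subsetI lincomb_closed b)
  show ?thesis
    unfolding linear_subspace_def
  proof (intro conjI sub zero ballI allI)
    fix x y c assume x: "x \<in> range (lincomb A b)"
    then obtain p where p: "x = lincomb A b p" by (rule rangeE)
    show "c \<odot> x \<in> range (lincomb A b)" unfolding p by (rule scale)
    assume "y \<in> range (lincomb A b)"
    then obtain r where r: "y = lincomb A b r" by (rule rangeE)
    show "x \<oplus> y \<in> range (lincomb A b)" unfolding p r by (rule plus)
  qed
qed

lemma (in field_algebra) lincombs_closed_under_mult: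
  assumes b: "\<And>j. b j \<in> carrier A" and y: "y \<in> carrier A"
    and step: "\<And>j. b j \<otimes> y \<in> range (lincomb A b)"
    and x: "x \<in> range (lincomb A b)"
  shows "x \<otimes> y \<in> range (lincomb A b)"
proof -
  let ?L = "range (lincomb A b)"
  have sub: "linear_subspace A ?L" by (rule linear_subspace_lincombs) (rule b)
  have "lincomb A b p \<otimes> y \<in> ?L" for p
  proof (induction p rule: poly_mapping_linear_induct)
    case zero
    show ?case using linear_subspaceD(2)[OF sub] y by simp
  next
    case (single k v)
    show ?case using linear_subspaceD(4)[OF sub step, of v k] b y
      by (simp add: lincomb_single smult_mult_left)
  next
    case (add p r)
    show ?case using linear_subspaceD(3)[OF sub add] b y by (simp add: lincomb_add l_distr)
  qed
  moreover obtain p where "x = lincomb A b p" using x by (rule rangeE)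
  ultimately show ?thesis by simp
qed


subsection \<open>Free algebras\<close>

lemma free_monoid_simps [simp]: "letters 0 = []" "letters (u + v) = letters u @ letters v"
  by (simp_all add: zero_free_monoid_def plus_free_monoid_def)

lemma free_algebra_simps [simp]:
  "mult (free_algebra G) = (*)" "one (free_algebra G) = 1" "zero (free_algebra G) = 0"
  "add (free_algebra G) = (+)" "smult (free_algebra G) c p = scalar c * p"
  by (simp_all add: free_algebra_def)

lemma carrier_free_algebra:
  "p \<in> carrier (free_algebra G) \<longleftrightarrow> (\<forall>w\<in>keys p. set (letters w) \<subseteq> G)"
  by (simp add: free_algebra_def)

lemma scalar_mult_single: "scalar c * single w v = single w (c * v)"
  by (simp add: scalar_def mult_single)

lemma scalar_commute: "p * scalar c = scalar c * p"
  by (induction p rule: poly_mapping_linear_induct)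
     (simp_all add: scalar_mult_single scalar_def mult_single algebra_simps)

lemma field_algebra_free_algebra: "field_algebra (free_algebra G :: ('k::field, ('g, 'k) ncpoly) module)"
proof -
  have mult: "p * r \<in> carrier (free_algebra G)"
    if "p \<in> carrier (free_algebra G)" "r \<in> carrier (free_algebra G)" for p r :: "('g, 'k) ncpoly"
    using that keys_mult[of p r] by (fastforce simp: carrier_free_algebra)
  have add: "p + r \<in> carrier (free_algebra G)"
    if "p \<in> carrier (free_algebra G)" "r \<in> carrier (free_algebra G)" for p r :: "('g, 'k) ncpoly"
    using that keys_add[of p r] by (fastforce simp: carrier_free_algebra)
  have scal: "scalar c \<in> carrier (free_algebra G)" for c :: 'k
    by (auto simp: carrier_free_algebra scalar_def split: if_splits)
  have neg: "\<exists>r\<in>carrier (free_algebra G). p + r = 0" if "p \<in> carrier (free_algebra G)" for p :: "('g, 'k) ncpoly"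
    using that by (intro bexI[of _ "- p"]) (auto simp: carrier_free_algebra)
  have scal_add: "scalar (c + d) = (scalar c + scalar d :: ('g, 'k) ncpoly)"
    and scal_mult: "scalar (c * d) = (scalar c * scalar d :: ('g, 'k) ncpoly)"
    and scal_one: "scalar 1 = (1 :: ('g, 'k) ncpoly)" for c d
    by (simp_all add: scalar_def single_add mult_single)
  show ?thesis
  proof (rule field_algebra.intro)
    show "ring (free_algebra G :: ('k, ('g, 'k) ncpoly) module)"
      by (intro ringI abelian_groupI monoidI)
         (auto simp: mult add neg algebra_simps, auto simp: carrier_free_algebra)
    show "field_algebra_axioms (free_algebra G :: ('k, ('g, 'k) ncpoly) module)"
      by standard (auto simp: mult scal scal_add scal_mult scal_one algebra_simps,
        metis mult.assoc scalar_commute)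
  qed
qed

lemma free_algebra_gen: "g \<in> G \<Longrightarrow> gen g \<in> carrier (free_algebra G)"
  by (simp add: gen_def carrier_free_algebra)

lemma free_algebra_a_minus:
  assumes "p \<in> carrier (free_algebra G)" "r \<in> carrier (free_algebra G)"
  shows "p \<ominus>\<^bsub>free_algebra G\<^esub> r = p - (r :: ('g, 'k::field) ncpoly)"
proof -
  interpret field_algebra "free_algebra G :: ('k, ('g, 'k) ncpoly) module"
    by (rule field_algebra_free_algebra)
  have "- r \<in> carrier (free_algebra G)" using assms by (simp add: carrier_free_algebra)
  then have "\<ominus>\<^bsub>free_algebra G\<^esub> r = - r"
    using assms by (intro add.inv_equality) (auto simp: )
  then show ?thesis by (simp add: a_minus_def)
qed

definition word_value :: "('k::field, 'a) module \<Rightarrow> ('g \<Rightarrow> 'a) \<Rightarrow> 'g list \<Rightarrow> 'a" where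
  "word_value A x gs = foldr (\<lambda>g y. x g \<otimes>\<^bsub>A\<^esub> y) gs \<one>\<^bsub>A\<^esub>"

text \<open>
  For values \<open>x\<close> that lie in the algebra this is the homomorphism from the free algebra that
  extends \<open>x\<close>. The values are taken on all letters, so that evaluation is total.
\<close>

definition evaluate :: "('k::field, 'a) module \<Rightarrow> ('g \<Rightarrow> 'a) \<Rightarrow> ('g, 'k) ncpoly \<Rightarrow> 'a" where
  "evaluate A x p = lincomb A (\<lambda>w. word_value A x (letters w)) p"

context field_algebra
begin

context
  fixes x :: "'g \<Rightarrow> 'a"
  assumes x [simp]: "\<And>g. x g \<in> carrier A"
begin

lemma word_value_closed [simp]: "word_value A x gs \<in> carrier A"
  by (induction gs) (simp_all add: word_value_def)

lemma word_value_append: "word_value A x (gs @ hs) = word_value A x gs \<otimes> word_value A x hs"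
  by (induction gs) (simp_all add: word_value_def m_assoc
    word_value_closed[unfolded word_value_def])

lemma evaluate_closed [simp]: "evaluate A x p \<in> carrier A"
  by (simp add: evaluate_def)

lemma evaluate_zero [simp]: "evaluate A x 0 = \<zero>"
  by (simp add: evaluate_def)

lemma evaluate_add [simp]: "evaluate A x (p + r) = evaluate A x p \<oplus> evaluate A x r"
  by (simp add: evaluate_def lincomb_add)

lemma evaluate_single: "evaluate A x (single w c) = c \<odot> word_value A x (letters w)"
  by (simp add: evaluate_def lincomb_single)

lemma evaluate_mult [simp]: "evaluate A x (p * r) = evaluate A x p \<otimes> evaluate A x r"
proof (induction p rule: poly_mapping_linear_induct)
  case (single k v)
  show ?case
    by (induction r rule: poly_mapping_linear_induct)
       (simp_all add: mult_single evaluate_single word_value_append smult_simps algebra_simps r_distr)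
qed (simp_all add: algebra_simps l_distr)

lemma evaluate_gen [simp]: "evaluate A x (gen g) = x g"
  by (simp add: gen_def evaluate_single word_value_def smult_one)

lemma evaluate_scalar: "evaluate A x (scalar c) = c \<odot> \<one>"
  by (simp add: scalar_def evaluate_single word_value_def)

lemma evaluate_one [simp]: "evaluate A x 1 = \<one>"
  using evaluate_scalar[of 1] by (simp add: scalar_def smult_one)

lemma evaluate_smult: "evaluate A x (scalar c * p) = c \<odot> evaluate A x p"
  by (simp add: evaluate_scalar smult_mult_left)

lemma evaluate_minus [simp]: "evaluate A x (p - r) = evaluate A x p \<ominus> evaluate A x r"
proof -
  have "\<ominus> evaluate A x r = evaluate A x (- r)"
    by (rule minus_equality) (simp_all flip: evaluate_add)
  then show ?thesis using evaluate_add[of p "- r"] by (simp add: a_minus_def)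
qed

lemma evaluate_hom: "evaluate A x \<in> alg_hom (free_algebra G) A"
  by (rule alg_homI) (simp_all add: evaluate_smult del: evaluate_mult, simp)

end

end

text \<open>
  Words arise from the empty word by appending letters, so closure under right multiplication by
  the images of the generators is all that a spanning set needs.
\<close>

lemma free_algebra_hom_image_subset:
  fixes A :: "('k::field, 'a) module" and G :: "'g set"
  assumes A: "field_algebra A" and hom: "h \<in> alg_hom (free_algebra G) A" and L: "linear_subspace A L"
    and one: "\<one>\<^bsub>A\<^esub> \<in> L" and step: "\<And>x g. \<lbrakk>x \<in> L; g \<in> G\<rbrakk> \<Longrightarrow> x \<otimes>\<^bsub>A\<^esub> h (gen g) \<in> L"
  shows "h ` carrier (free_algebra G) \<subseteq> L"
proof -
  interpret field_algebra_hom "free_algebra G" A h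
    by (intro field_algebra_homI field_algebra_free_algebra A hom)
  have words: "h (single (Word gs) 1) \<in> L \<and>
      single (Word gs) (1::'k) \<in> carrier (free_algebra G)"
    if "set gs \<subseteq> G" for gs
    using that
  proof (induction gs rule: rev_induct)
    case Nil
    have "single (Word []) 1 = (1 :: ('g, 'k) ncpoly)"
      by (simp flip: zero_free_monoid_def)
    then show ?case using hom_one one A.one_closed by (simp only: free_algebra_simps)
  next
    case (snoc g gs)
    have "single (Word (gs @ [g])) 1 = single (Word gs) 1 * (gen g :: ('g, 'k) ncpoly)"
      by (simp add: gen_def mult_single plus_free_monoid_def)
    then show ?case
      using hom_mult[of "single (Word gs) 1" "gen g"] step[of _ g] snoc
        A.m_closed[of "single (Word gs) 1" "gen g"]
      by (simp add: free_algebra_gen)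
  qed
  have single: "h (single w c) \<in> L \<and> single w c \<in> carrier (free_algebra G)"
    if "set (letters w) \<subseteq> G" for w and c :: 'k
    using words[OF that] hom_smult[of "single w 1" c] L
      A.smult_closed[of "single w 1" c]
    by (auto simp: scalar_mult_single linear_subspace_def)
  have "h p \<in> L" if "p \<in> carrier (free_algebra G)" for p
    using that
  proof (induction p rule: poly_mapping_keys_induct)
    case zero
    show ?case using L hom_zero by (simp add: linear_subspace_def)
  next
    case (single_add w c p)
    then have "p \<in> carrier (free_algebra G)" "set (letters w) \<subseteq> G"
      by (auto simp: carrier_free_algebra)
    with single_add single[of w c] hom_add[of "single w c" p] L
    show ?case by (auto simp: linear_subspace_def)
  qed
  then show ?thesis by blast
qed


subsection \<open>Quotients and presentations\<close>

lemma alg_quot_simps: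
  "carrier (alg_quot A I) = a_rcosets\<^bsub>A\<^esub> I"
  "mult (alg_quot A I) = rcoset_mult A I"
  "one (alg_quot A I) = I +>\<^bsub>A\<^esub> \<one>\<^bsub>A\<^esub>"
  "zero (alg_quot A I) = I"
  "add (alg_quot A I) = set_add A"
  "smult (alg_quot A I) c P = (\<Union>x\<in>P. I +>\<^bsub>A\<^esub> (c \<odot>\<^bsub>A\<^esub> x))"
  by (simp_all add: alg_quot_def FactRing_def ring.defs)

lemma ring_alg_quot: "ideal I A \<Longrightarrow> ring (alg_quot A I)"
proof -
  assume "ideal I A"
  then interpret Q: ring "A Quot I" by (rule ideal.quotient_is_ring)
  have eqs: "carrier (alg_quot A I) = carrier (A Quot I)" "mult (alg_quot A I) = mult (A Quot I)"
    "one (alg_quot A I) = one (A Quot I)" "zero (alg_quot A I) = zero (A Quot I)"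
    "add (alg_quot A I) = add (A Quot I)"
    by (simp_all add: alg_quot_def ring.defs)
  show ?thesis
    by (intro ringI abelian_groupI monoidI; simp only: eqs)
       (simp_all add: Q.a_ac Q.m_assoc Q.l_distr Q.r_distr Q.add.l_inv_ex Q.add.r_inv_ex)
qed

context
  fixes A :: "('k::field, 'a) module" and I
  assumes A: "field_algebra A" and I: "ideal I A"
begin

interpretation A: field_algebra A by fact
interpretation I: ideal I A by fact

text \<open>
  Ring ideals are subspaces because \<open>c x = (c 1) x\<close>.
\<close>

lemma ideal_smult: "x \<in> I \<Longrightarrow> c \<odot>\<^bsub>A\<^esub> x \<in> I"
  using I.I_l_closed[of x "c \<odot>\<^bsub>A\<^esub> \<one>\<^bsub>A\<^esub>"] by (simp add: I.a_Hcarr A.smult_mult_left)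

lemma alg_quot_smult:
  assumes x: "x \<in> carrier A"
  shows "c \<odot>\<^bsub>alg_quot A I\<^esub> (I +>\<^bsub>A\<^esub> x) = I +>\<^bsub>A\<^esub> (c \<odot>\<^bsub>A\<^esub> x)"
proof -
  have "I +>\<^bsub>A\<^esub> (c \<odot>\<^bsub>A\<^esub> y) = I +>\<^bsub>A\<^esub> (c \<odot>\<^bsub>A\<^esub> x)" if y: "y \<in> I +>\<^bsub>A\<^esub> x" for y
  proof -
    from y obtain i where i: "i \<in> I" "y = i \<oplus>\<^bsub>A\<^esub> x" by (auto simp: a_r_coset_def r_coset_def)
    then have ic: "i \<in> carrier A" by (simp add: I.a_Hcarr)
    then have "c \<odot>\<^bsub>A\<^esub> y \<in> I +>\<^bsub>A\<^esub> (c \<odot>\<^bsub>A\<^esub> x)"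
      using i x ideal_smult[of i c] by (auto simp: A.smult_r_distr a_r_coset_def r_coset_def)
    then show ?thesis using x by (metis A.smult_closed I.a_repr_independence')
  qed
  moreover have "I +>\<^bsub>A\<^esub> x \<noteq> {}" using I.a_rcos_self[OF x] by blast
  ultimately show ?thesis unfolding alg_quot_simps by (intro SUP_eq_const)
qed

lemma carrier_alg_quot: "carrier (alg_quot A I) = (\<lambda>x. I +>\<^bsub>A\<^esub> x) ` carrier A"
  by (auto simp: alg_quot_simps A_RCOSETS_def RCOSETS_def a_r_coset_def)

lemma field_algebra_alg_quot: "field_algebra (alg_quot A I)"
proof (rule field_algebra.intro[OF ring_alg_quot[OF I]], standard)
  note simps = alg_quot_smult alg_quot_simps(2,5) I.rcoset_mult_add I.a_rcos_sum
    A.smult_l_distr A.smult_r_distr A.smult_simps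
  fix x y c d
  assume "x \<in> carrier (alg_quot A I)"
  then obtain x' where x: "x = I +>\<^bsub>A\<^esub> x'" "x' \<in> carrier A" unfolding carrier_alg_quot by (rule imageE)
  show "c \<odot>\<^bsub>alg_quot A I\<^esub> x \<in> carrier (alg_quot A I)"
    "(c + d) \<odot>\<^bsub>alg_quot A I\<^esub> x = c \<odot>\<^bsub>alg_quot A I\<^esub> x \<oplus>\<^bsub>alg_quot A I\<^esub> d \<odot>\<^bsub>alg_quot A I\<^esub> x"
    "c \<odot>\<^bsub>alg_quot A I\<^esub> (d \<odot>\<^bsub>alg_quot A I\<^esub> x) = (c * d) \<odot>\<^bsub>alg_quot A I\<^esub> x"
    "1 \<odot>\<^bsub>alg_quot A I\<^esub> x = x"
    using x by (simp_all add: carrier_alg_quot simps)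
  assume "y \<in> carrier (alg_quot A I)"
  then obtain y' where y: "y = I +>\<^bsub>A\<^esub> y'" "y' \<in> carrier A" unfolding carrier_alg_quot by (rule imageE)
  show "c \<odot>\<^bsub>alg_quot A I\<^esub> (x \<oplus>\<^bsub>alg_quot A I\<^esub> y) = c \<odot>\<^bsub>alg_quot A I\<^esub> x \<oplus>\<^bsub>alg_quot A I\<^esub> c \<odot>\<^bsub>alg_quot A I\<^esub> y"
    "c \<odot>\<^bsub>alg_quot A I\<^esub> x \<otimes>\<^bsub>alg_quot A I\<^esub> y = c \<odot>\<^bsub>alg_quot A I\<^esub> (x \<otimes>\<^bsub>alg_quot A I\<^esub> y)"
    "x \<otimes>\<^bsub>alg_quot A I\<^esub> (c \<odot>\<^bsub>alg_quot A I\<^esub> y) = c \<odot>\<^bsub>alg_quot A I\<^esub> (x \<otimes>\<^bsub>alg_quot A I\<^esub> y)"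
    using x y by (simp_all add: simps)
qed

lemma alg_quot_mult:
  "\<lbrakk>x \<in> carrier A; y \<in> carrier A\<rbrakk>
    \<Longrightarrow> (I +>\<^bsub>A\<^esub> x) \<otimes>\<^bsub>alg_quot A I\<^esub> (I +>\<^bsub>A\<^esub> y) = I +>\<^bsub>A\<^esub> (x \<otimes>\<^bsub>A\<^esub> y)"
  by (simp add: alg_quot_simps I.rcoset_mult_add)

lemma alg_quot_add:
  "\<lbrakk>x \<in> carrier A; y \<in> carrier A\<rbrakk>
    \<Longrightarrow> (I +>\<^bsub>A\<^esub> x) \<oplus>\<^bsub>alg_quot A I\<^esub> (I +>\<^bsub>A\<^esub> y) = I +>\<^bsub>A\<^esub> (x \<oplus>\<^bsub>A\<^esub> y)"
  by (simp add: alg_quot_simps I.a_rcos_sum)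

lemma coset_self: "x \<in> carrier A \<Longrightarrow> x \<in> I +>\<^bsub>A\<^esub> x"
  by (rule I.a_rcos_self)

lemma alg_quot_proj: "(\<lambda>x. I +>\<^bsub>A\<^esub> x) \<in> alg_hom A (alg_quot A I)"
  by (rule alg_homI)
     (simp_all add: carrier_alg_quot alg_quot_smult alg_quot_mult alg_quot_add alg_quot_simps(3))

lemma alg_quot_eq_zero_iff: "x \<in> carrier A \<Longrightarrow> I +>\<^bsub>A\<^esub> x = \<zero>\<^bsub>alg_quot A I\<^esub> \<longleftrightarrow> x \<in> I"
  by (metis I.a_rcos_const I.a_rcos_self alg_quot_simps(4))

end

text \<open>
  The universal property of the quotient: the kernel of the given homomorphism is an ideal that
  contains \<open>S\<close>, hence the ideal generated by \<open>S\<close>.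
\<close>

lemma alg_quot_hom_exists:
  assumes A: "field_algebra A" and B: "field_algebra B" and h: "h \<in> alg_hom A B"
    and S: "S \<subseteq> carrier A" "\<And>s. s \<in> S \<Longrightarrow> h s = \<zero>\<^bsub>B\<^esub>"
  obtains h' where "h' \<in> alg_hom (alg_quot A (Idl\<^bsub>A\<^esub> S)) B"
    "\<And>x. x \<in> carrier A \<Longrightarrow> h' (Idl\<^bsub>A\<^esub> S +>\<^bsub>A\<^esub> x) = h x"
proof -
  interpret field_algebra_hom A B h by (intro field_algebra_homI assms)
  let ?I = "Idl\<^bsub>A\<^esub> S"
  have I: "ideal ?I A" by (rule A.genideal_ideal[OF S(1)])
  have ker: "?I \<subseteq> a_kernel A B h"
  proof (rule A.genideal_minimal)
    show "ideal (a_kernel A B h) A" by (rule ring_hom_ring.kernel_is_ideal[OF ring_hom_ring])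
    show "S \<subseteq> a_kernel A B h" using S unfolding a_kernel_def' by blast
  qed
  define h' where "h' P = h (SOME x. x \<in> P)" for P
  have h': "h' (?I +>\<^bsub>A\<^esub> x) = h x" if x: "x \<in> carrier A" for x
  proof -
    have "(SOME y. y \<in> ?I +>\<^bsub>A\<^esub> x) \<in> ?I +>\<^bsub>A\<^esub> x"
      using coset_self[OF A I x] by (rule someI)
    then obtain i where i: "i \<in> ?I" "(SOME y. y \<in> ?I +>\<^bsub>A\<^esub> x) = i \<oplus>\<^bsub>A\<^esub> x"
      by (auto simp: a_r_coset_def r_coset_def)
    moreover have "i \<in> carrier A" "h i = \<zero>\<^bsub>B\<^esub>"
      using subsetD[OF ker i(1)] by (simp_all add: a_kernel_def')
    ultimately show ?thesis using x by (simp add: h'_def)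
  qed
  have "h' \<in> alg_hom (alg_quot A ?I) B"
  proof (rule alg_homI)
    note simps = alg_quot_smult[OF A I] alg_quot_mult[OF A I] alg_quot_add[OF A I] h' alg_quot_simps(3)
    fix x y c
    show "h' \<one>\<^bsub>alg_quot A ?I\<^esub> = \<one>\<^bsub>B\<^esub>" by (simp add: simps)
    assume "x \<in> carrier (alg_quot A ?I)"
    then obtain x' where x: "x = ?I +>\<^bsub>A\<^esub> x'" "x' \<in> carrier A"
      unfolding carrier_alg_quot[OF A I] by (rule imageE)
    then show "h' x \<in> carrier B" "h' (c \<odot>\<^bsub>alg_quot A ?I\<^esub> x) = c \<odot>\<^bsub>B\<^esub> h' x" by (simp_all add: simps)
    assume "y \<in> carrier (alg_quot A ?I)"
    then obtain y' where y: "y = ?I +>\<^bsub>A\<^esub> y'" "y' \<in> carrier A"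
      unfolding carrier_alg_quot[OF A I] by (rule imageE)
    show "h' (x \<otimes>\<^bsub>alg_quot A ?I\<^esub> y) = h' x \<otimes>\<^bsub>B\<^esub> h' y" "h' (x \<oplus>\<^bsub>alg_quot A ?I\<^esub> y) = h' x \<oplus>\<^bsub>B\<^esub> h' y"
      using x y by (simp_all add: simps)
  qed
  with h' that show thesis by blast
qed

context
  fixes G :: "'g set" and R :: "('g, 'k::field) ncpoly set"
  assumes R: "R \<subseteq> carrier (free_algebra G)"
begin

interpretation free: field_algebra "free_algebra G :: ('k, ('g, 'k) ncpoly) module"
  by (rule field_algebra_free_algebra)

lemma field_algebra_presented: "field_algebra (presented_algebra G R)"
  unfolding presented_algebra_def
  by (intro field_algebra_alg_quot field_algebra_free_algebra free.genideal_ideal R)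

lemma presented_elem_hom: "presented_elem G R \<in> alg_hom (free_algebra G) (presented_algebra G R)"
  using alg_quot_proj[OF field_algebra_free_algebra free.genideal_ideal[OF R]]
  by (simp add: presented_algebra_def presented_elem_def[abs_def])

lemma carrier_presented: "carrier (presented_algebra G R) = presented_elem G R ` carrier (free_algebra G)"
  using carrier_alg_quot[OF field_algebra_free_algebra free.genideal_ideal[OF R]]
  by (simp add: presented_algebra_def presented_elem_def[abs_def])

lemma presented_elem_relation: "r \<in> R \<Longrightarrow> presented_elem G R r = \<zero>\<^bsub>presented_algebra G R\<^esub>"
  using alg_quot_eq_zero_iff[OF field_algebra_free_algebra free.genideal_ideal[OF R], of r]
    free.genideal_self[OF R] R
  by (auto simp: presented_algebra_def presented_elem_def)

lemma presented_hom_exists: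
  assumes A: "field_algebra A" and x: "\<And>g. x g \<in> carrier A"
    and rel: "\<And>r. r \<in> R \<Longrightarrow> evaluate A x r = \<zero>\<^bsub>A\<^esub>"
  obtains h where "h \<in> alg_hom (presented_algebra G R) A"
    "\<And>p. p \<in> carrier (free_algebra G) \<Longrightarrow> h (presented_elem G R p) = evaluate A x p"
  using alg_quot_hom_exists[OF field_algebra_free_algebra A field_algebra.evaluate_hom[OF A x] R rel]
  unfolding presented_algebra_def presented_elem_def by blast

end

section \<open>Twisted monoid algebras\<close>

text \<open>
  Convolution twisted by a 2-cocycle \<open>\<chi>\<close>. For \<open>\<chi> = 1\<close> it is the product of the monoid algebra;
  quantum tori arise from free abelian groups with a power of \<open>q\<close> as cocycle.
\<close>

definition twisted_mult ::
    "('g::monoid_add \<Rightarrow> 'g \<Rightarrow> 'k::field) \<Rightarrow> ('g \<Rightarrow>\<^sub>0 'k) \<Rightarrow> ('g \<Rightarrow>\<^sub>0 'k) \<Rightarrow> ('g \<Rightarrow>\<^sub>0 'k)" where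
  "twisted_mult \<chi> p r = (\<Sum>\<alpha>\<in>keys p. \<Sum>\<beta>\<in>keys r.
     single (\<alpha> + \<beta>) (\<chi> \<alpha> \<beta> * lookup p \<alpha> * lookup r \<beta>))"

definition twisted_algebra :: "('g::monoid_add \<Rightarrow> 'g \<Rightarrow> 'k::field) \<Rightarrow> ('k, 'g \<Rightarrow>\<^sub>0 'k) module" where
  "twisted_algebra \<chi> = \<lparr>carrier = UNIV, mult = twisted_mult \<chi>, one = 1,
     zero = 0, add = (+), smult = scale\<rparr>"

lemma twisted_algebra_simps [simp]:
  "carrier (twisted_algebra \<chi>) = UNIV" "mult (twisted_algebra \<chi>) = twisted_mult \<chi>"
  "one (twisted_algebra \<chi>) = 1" "zero (twisted_algebra \<chi>) = 0"
  "add (twisted_algebra \<chi>) = (+)" "smult (twisted_algebra \<chi>) c = scale c"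
  by (simp_all add: twisted_algebra_def)

lemma lookup_scale [simp]: "lookup (scale c p) \<alpha> = (c :: 'k::field) * lookup p \<alpha>"
  by (simp add: map.rep_eq when_def)

lemma scale_single [simp]:
  "scale c (single \<alpha> v) = single \<alpha> ((c :: 'k::field) * v)"
  by (rule poly_mapping_eqI) (simp add: lookup_single when_def)

lemma scale_zero [simp]: "scale c (0 :: 'a \<Rightarrow>\<^sub>0 'k::field) = 0"
  by (rule poly_mapping_eqI) simp

lemma scale_add: "scale c (p + r) = scale (c :: 'k::field) p + scale c r"
  by (rule poly_mapping_eqI) (simp add: lookup_add algebra_simps)

lemma twisted_mult_superset:
  assumes "finite S" "keys p \<subseteq> S" "finite T" "keys r \<subseteq> T"
  shows "twisted_mult \<chi> p r = (\<Sum>\<alpha>\<in>S. \<Sum>\<beta>\<in>T.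
     single (\<alpha> + \<beta>) (\<chi> \<alpha> \<beta> * lookup p \<alpha> * lookup r \<beta>))"
proof -
  have "(\<Sum>\<beta>\<in>keys r. single (\<alpha> + \<beta>) (\<chi> \<alpha> \<beta> * lookup p \<alpha> * lookup r \<beta>))
     = (\<Sum>\<beta>\<in>T. single (\<alpha> + \<beta>) (\<chi> \<alpha> \<beta> * lookup p \<alpha> * lookup r \<beta>))" for \<alpha>
    by (rule sum.mono_neutral_left) (use assms in \<open>auto simp: in_keys_iff\<close>)
  then have "twisted_mult \<chi> p r = (\<Sum>\<alpha>\<in>keys p. \<Sum>\<beta>\<in>T.
     single (\<alpha> + \<beta>) (\<chi> \<alpha> \<beta> * lookup p \<alpha> * lookup r \<beta>))"
    by (simp add: twisted_mult_def)
  also have "\<dots> = (\<Sum>\<alpha>\<in>S. \<Sum>\<beta>\<in>T.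
     single (\<alpha> + \<beta>) (\<chi> \<alpha> \<beta> * lookup p \<alpha> * lookup r \<beta>))"
    by (rule sum.mono_neutral_left) (use assms in \<open>auto simp: in_keys_iff\<close>)
  finally show ?thesis .
qed

lemma twisted_mult_zero [simp]: "twisted_mult \<chi> 0 r = 0" "twisted_mult \<chi> p 0 = 0"
  by (simp_all add: twisted_mult_def)

lemma twisted_mult_add_left: "twisted_mult \<chi> (p + p') r = twisted_mult \<chi> p r + twisted_mult \<chi> p' r"
proof -
  let ?S = "keys p \<union> keys p'"
  have "keys (p + p') \<subseteq> ?S" by (rule keys_add)
  then show ?thesis
    by (simp add: twisted_mult_superset[of ?S _ "keys r" r] lookup_add algebra_simps
        single_add sum.distrib)
qed

lemma twisted_mult_add_right: "twisted_mult \<chi> p (r + r') = twisted_mult \<chi> p r + twisted_mult \<chi> p r'"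
proof -
  let ?S = "keys r \<union> keys r'"
  have "keys (r + r') \<subseteq> ?S" by (rule keys_add)
  then show ?thesis
    by (simp add: twisted_mult_superset[of "keys p" p ?S] lookup_add algebra_simps
        single_add sum.distrib)
qed

lemma twisted_mult_diff_right:
  "twisted_mult \<chi> p (r - r') = twisted_mult \<chi> p r - twisted_mult \<chi> p r'"
  using twisted_mult_add_right[of \<chi> p "r - r'" r'] by simp

lemma twisted_mult_single [simp]:
  "twisted_mult \<chi> (single \<alpha> a) (single \<beta> b)
    = single (\<alpha> + \<beta>) (\<chi> \<alpha> \<beta> * a * b)"
  by (subst twisted_mult_superset[of "{\<alpha>}" _ "{\<beta>}"]) auto

lemma twisted_mult_scale:
  "twisted_mult \<chi> (scale c p) r = scale c (twisted_mult \<chi> p r)"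
  "twisted_mult \<chi> p (scale c r) = scale c (twisted_mult \<chi> p r)"
proof -
  have *: "twisted_mult \<chi> (single \<alpha> (c * a)) r = scale c (twisted_mult \<chi> (single \<alpha> a) r)"
    "twisted_mult \<chi> (single \<alpha> a) (scale c r) = scale c (twisted_mult \<chi> (single \<alpha> a) r)"
    for \<alpha> a
    by (induction r rule: poly_mapping_linear_induct)
       (simp_all add: twisted_mult_add_right scale_add algebra_simps)
  show "twisted_mult \<chi> (scale c p) r = scale c (twisted_mult \<chi> p r)"
  "twisted_mult \<chi> p (scale c r) = scale c (twisted_mult \<chi> p r)"
    by (induction p rule: poly_mapping_linear_induct)
       (simp_all add: twisted_mult_add_left scale_add *)
qed

lemma keys_twisted_mult:
  "keys (twisted_mult \<chi> p r) \<subseteq> {\<alpha> + \<beta> | \<alpha> \<beta>. \<alpha> \<in> keys p \<and> \<beta> \<in> keys r}"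
proof
  fix \<gamma> assume "\<gamma> \<in> keys (twisted_mult \<chi> p r)"
  then have "(\<Sum>\<alpha>\<in>keys p. \<Sum>\<beta>\<in>keys r.
     lookup (single (\<alpha> + \<beta>) (\<chi> \<alpha> \<beta> * lookup p \<alpha> * lookup r \<beta>)) \<gamma>) \<noteq> 0"
    by (simp add: in_keys_iff twisted_mult_def lookup_sum)
  then obtain \<alpha> where "\<alpha> \<in> keys p" "(\<Sum>\<beta>\<in>keys r.
     lookup (single (\<alpha> + \<beta>) (\<chi> \<alpha> \<beta> * lookup p \<alpha> * lookup r \<beta>)) \<gamma>) \<noteq> 0"
    by (rule sum.not_neutral_contains_not_neutral)
  moreover from this(2) obtain \<beta> where "\<beta> \<in> keys r"
     "lookup (single (\<alpha> + \<beta>) (\<chi> \<alpha> \<beta> * lookup p \<alpha> * lookup r \<beta>)) \<gamma> \<noteq> 0"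
    by (rule sum.not_neutral_contains_not_neutral)
  ultimately show "\<gamma> \<in> {\<alpha> + \<beta> | \<alpha> \<beta>. \<alpha> \<in> keys p \<and> \<beta> \<in> keys r}"
    by (auto simp: lookup_single when_def split: if_splits)
qed

lemma finsum_twisted_algebra:
  assumes "field_algebra (twisted_algebra \<chi>)"
  shows "finsum (twisted_algebra \<chi>) f S = sum f S"
proof -
  interpret field_algebra "twisted_algebra \<chi>" by fact
  show ?thesis
    by (induction S rule: infinite_finite_induct) (simp_all add: finsum_infinite)
qed

lemma twisted_algebra_a_inv:
  assumes "field_algebra (twisted_algebra \<chi>)"
  shows "a_inv (twisted_algebra \<chi>) p = - p"
proof -
  interpret field_algebra "twisted_algebra \<chi>" by fact
  show ?thesis by (rule minus_equality) simp_all
qed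

locale cocycle =
  fixes \<chi> :: "'g::monoid_add \<Rightarrow> 'g \<Rightarrow> 'k::field"
  assumes cocycle: "\<chi> \<alpha> \<beta> * \<chi> (\<alpha> + \<beta>) \<gamma> = \<chi> \<beta> \<gamma> * \<chi> \<alpha> (\<beta> + \<gamma>)"
    and normalized [simp]: "\<chi> 0 \<alpha> = 1" "\<chi> \<alpha> 0 = 1"
    and nonzero [simp]: "\<chi> \<alpha> \<beta> \<noteq> 0"
begin

lemma twisted_mult_assoc:
  "twisted_mult \<chi> (twisted_mult \<chi> p r) s = twisted_mult \<chi> p (twisted_mult \<chi> r s)"
proof (induction p rule: poly_mapping_linear_induct)
  case (single \<alpha> a)
  show ?case
  proof (induction r rule: poly_mapping_linear_induct)
    case (single \<beta> b)
    show ?case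
    proof (induction s rule: poly_mapping_linear_induct)
      case (single \<gamma> c)
      have "\<chi> (\<alpha> + \<beta>) \<gamma> * (\<chi> \<alpha> \<beta> * a * b) * c = \<chi> \<alpha> (\<beta> + \<gamma>) * a * (\<chi> \<beta> \<gamma> * b * c)"
        using cocycle[of \<alpha> \<beta> \<gamma>] by (simp add: mult_ac)
      then show ?case unfolding twisted_mult_single add.assoc by (rule arg_cong)
    qed (simp_all add: twisted_mult_add_right)
  qed (simp_all add: twisted_mult_add_left twisted_mult_add_right)
qed (simp_all add: twisted_mult_add_left)

lemma twisted_mult_one [simp]:
  "twisted_mult \<chi> 1 p = p" "twisted_mult \<chi> p 1 = p"
  unfolding single_one [symmetric]
  by (induction p rule: poly_mapping_linear_induct)
     (simp_all add: twisted_mult_add_left twisted_mult_add_right del: single_one)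

lemma field_algebra_twisted: "field_algebra (twisted_algebra \<chi>)"
proof (rule field_algebra.intro)
  have "\<exists>y. y + x = 0" for x :: "'g \<Rightarrow>\<^sub>0 'k" by (rule exI[of _ "- x"]) simp
  then show "ring (twisted_algebra \<chi>)"
    by (intro ringI abelian_groupI monoidI)
       (simp_all add: twisted_mult_assoc twisted_mult_add_left twisted_mult_add_right algebra_simps)
  have scale: "scale (c + d) p = scale c p + scale d p"
    "scale c (scale d p) = scale (c * d) p"
    "scale 1 p = p"
    for c d :: 'k and p :: "'g \<Rightarrow>\<^sub>0 'k"
    by (auto intro!: poly_mapping_eqI simp: lookup_add algebra_simps)
  show "field_algebra_axioms (twisted_algebra \<chi>)"
    by standard (simp_all add: scale scale_add twisted_mult_scale)
qed

sublocale field_algebra "twisted_algebra \<chi>"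
  by (rule field_algebra_twisted)

lemma lincomb_twisted: "lincomb (twisted_algebra \<chi>) b p = (\<Sum>j\<in>keys p. scale (lookup p j) (b j))"
  by (simp add: lincomb_def finsum_twisted_algebra[OF field_algebra_twisted])

lemma lincomb_basis: "lincomb (twisted_algebra \<chi>) (\<lambda>\<alpha>. single \<alpha> 1) p = p"
  by (induction p rule: poly_mapping_linear_induct)
     (simp_all add: lincomb_add[simplified] lincomb_single[simplified] lincomb_zero[simplified])

end


subsection \<open>No zero divisors\<close>

locale ordered_cocycle = cocycle \<chi>
  for \<chi> :: "'g::{monoid_add, linorder} \<Rightarrow> 'g \<Rightarrow> 'k::field" +
  assumes add_less_left: "\<alpha> < \<beta> \<Longrightarrow> \<gamma> + \<alpha> < \<gamma> + (\<beta>::'g)"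
    and add_less_right: "\<alpha> < \<beta> \<Longrightarrow> \<alpha> + \<gamma> < \<beta> + (\<gamma>::'g)"
begin

text \<open>
  Only the product of the two leading terms contributes to the exponent that is the sum of the
  leading exponents, and cocycle values are invertible.
\<close>

lemma twisted_mult_nonzero:
  assumes "p \<noteq> 0" "r \<noteq> 0"
  shows "twisted_mult \<chi> p r \<noteq> 0"
proof -
  define \<alpha> where "\<alpha> = Max (keys p)"
  define \<beta> where "\<beta> = Max (keys r)"
  have \<alpha>: "\<alpha> \<in> keys p" and \<beta>: "\<beta> \<in> keys r"
    using assms by (auto simp: \<alpha>_def \<beta>_def intro!: Max_in)
  have unique: "\<alpha>' = \<alpha> \<and> \<beta>' = \<beta>"
    if "\<alpha>' \<in> keys p" "\<beta>' \<in> keys r" "\<alpha>' + \<beta>' = \<alpha> + \<beta>" for \<alpha>' \<beta>'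
  proof -
    have le: "\<alpha>' \<le> \<alpha>" "\<beta>' \<le> \<beta>" using that by (auto simp: \<alpha>_def \<beta>_def)
    have "\<beta>' = \<beta>"
    proof (rule ccontr)
      assume "\<beta>' \<noteq> \<beta>"
      then have "\<alpha>' + \<beta>' < \<alpha>' + \<beta>" using le by (intro add_less_left) simp
      also have "\<dots> \<le> \<alpha> + \<beta>"
        using le(1) add_less_right[of \<alpha>' \<alpha> \<beta>] by (cases "\<alpha>' = \<alpha>") (auto intro: less_imp_le)
      finally show False using that(3) by simp
    qed
    moreover have "\<alpha>' = \<alpha>"
    proof (rule ccontr)
      assume "\<alpha>' \<noteq> \<alpha>"
      then have "\<alpha>' + \<beta> < \<alpha> + \<beta>" using le by (intro add_less_right) simp
      then show False using that(3) \<open>\<beta>' = \<beta>\<close> by simp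
    qed
    ultimately show ?thesis by simp
  qed
  let ?c = "\<chi> \<alpha> \<beta> * lookup p \<alpha> * lookup r \<beta>"
  have "lookup (twisted_mult \<chi> p r) (\<alpha> + \<beta>)
    = (\<Sum>\<alpha>'\<in>keys p. \<Sum>\<beta>'\<in>keys r. if \<alpha>' = \<alpha> then if \<beta>' = \<beta> then ?c else 0 else 0)"
    unfolding twisted_mult_def lookup_sum
    by (intro sum.cong refl) (use unique in \<open>auto simp: lookup_single when_def\<close>)
  also have "\<dots> = (\<Sum>\<alpha>'\<in>keys p. if \<alpha>' = \<alpha> then \<Sum>\<beta>'\<in>keys r. if \<beta>' = \<beta> then ?c else 0 else 0)"
    by (intro sum.cong refl) auto
  also have "\<dots> = ?c" using \<alpha> \<beta> by simp
  also have "\<dots> \<noteq> 0" using \<alpha> \<beta> by (simp add: in_keys_iff)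
  finally show ?thesis by auto
qed

lemma twisted_mult_eq_zero_iff: "twisted_mult \<chi> p r = 0 \<longleftrightarrow> p = 0 \<or> r = 0"
  using twisted_mult_nonzero by auto

end


subsection \<open>Graded independence\<close>

definition homogeneous :: "('g \<Rightarrow> 'd) \<Rightarrow> 'd \<Rightarrow> ('g \<Rightarrow>\<^sub>0 'k::zero) \<Rightarrow> bool" where
  "homogeneous deg d p \<longleftrightarrow> (\<forall>\<alpha>\<in>keys p. deg \<alpha> = d)"

lemma homogeneous_single: "deg \<alpha> = d \<Longrightarrow> homogeneous deg d (single \<alpha> c)"
  by (simp add: homogeneous_def)

lemma homogeneous_add: "\<lbrakk>homogeneous deg d p; homogeneous deg d r\<rbrakk> \<Longrightarrow> homogeneous deg d (p + r)"
  using keys_add[of p r] by (auto simp: homogeneous_def)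

lemma homogeneous_mult:
  assumes "\<And>\<alpha> \<beta>. deg (\<alpha> + \<beta>) = deg \<alpha> + (deg \<beta> :: 'd::plus)"
    and "homogeneous deg d p" "homogeneous deg e r"
  shows "homogeneous deg (d + e) (twisted_mult \<chi> p r)"
  using assms keys_twisted_mult[of \<chi> p r] by (fastforce simp: homogeneous_def)

lemma homogeneous_sum:
  assumes "\<And>j. j \<in> J \<Longrightarrow> homogeneous deg d (t j)"
  shows "homogeneous deg d (\<Sum>j\<in>J. t j)"
  using assms
  by (induction J rule: infinite_finite_induct) (auto intro: homogeneous_add, auto simp: homogeneous_def)

lemma homogeneous_sum_zeroD:
  assumes J: "finite J" "inj_on \<delta> J" and t: "\<And>j. j \<in> J \<Longrightarrow> homogeneous deg (\<delta> j) (t j)"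
    and zero: "(\<Sum>j\<in>J. t j) = 0" and i: "i \<in> J"
  shows "t i = 0"
proof (rule poly_mapping_eqI)
  fix \<alpha>
  have "lookup (t i) \<alpha> = 0" if "deg \<alpha> \<noteq> \<delta> i"
    using that t[OF i] by (auto simp: homogeneous_def in_keys_iff)
  moreover have "lookup (t i) \<alpha> = 0" if d: "deg \<alpha> = \<delta> i"
  proof -
    have "lookup (t j) \<alpha> = 0" if "j \<in> J" "j \<noteq> i" for j
    proof -
      have "\<delta> j \<noteq> \<delta> i" using that i inj_onD[OF J(2), of j i] by blast
      then show ?thesis using t[OF that(1)] d by (metis homogeneous_def in_keys_iff)
    qed
    then have "(\<Sum>j\<in>J. lookup (t j) \<alpha>) = lookup (t i) \<alpha>"
      using J i by (subst sum.remove[of _ i]) auto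
    then show ?thesis using zero by (simp flip: lookup_sum)
  qed
  ultimately show "lookup (t i) \<alpha> = lookup 0 \<alpha>" by auto
qed

text \<open>
  A criterion for linear independence. The family is divided into classes by \<open>cl\<close>; within a class
  the members are \<open>L m R\<close> with common factors \<open>L\<close>, \<open>R\<close> and multiples \<open>m\<close> of distinct monomials.
  Different classes have different degrees, so in a vanishing linear combination each class
  contributes zero. The factors \<open>L\<close> and \<open>R\<close> then cancel, since there are no zero divisors, and a
  combination of distinct monomials remains.
\<close>

lemma (in ordered_cocycle) graded_independent:
  fixes p :: "'j \<Rightarrow>\<^sub>0 'k" and cl :: "'j \<Rightarrow> 'i" and L R :: "'i \<Rightarrow> 'g \<Rightarrow>\<^sub>0 'k"
    and \<nu> :: "'j \<Rightarrow> 'g" and \<kappa> :: "'j \<Rightarrow> 'k" and deg :: "'g \<Rightarrow> 'd"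
  defines "t \<equiv> \<lambda>j. twisted_mult \<chi> (twisted_mult \<chi> (L (cl j)) (single (\<nu> j) (\<kappa> j))) (R (cl j))"
  assumes nz: "\<And>j. j \<in> keys p \<Longrightarrow> L (cl j) \<noteq> 0 \<and> \<kappa> j \<noteq> 0 \<and> R (cl j) \<noteq> 0"
    and homog: "\<And>j. j \<in> keys p \<Longrightarrow> homogeneous deg (\<delta> (cl j)) (t j)"
    and \<delta>: "inj_on \<delta> (cl ` keys p)"
    and \<nu>: "\<And>j j'. \<lbrakk>cl j = cl j'; \<nu> j = \<nu> j'\<rbrakk> \<Longrightarrow> j = j'"
    and zero: "lincomb (twisted_algebra \<chi>) t p = 0"
  shows "p = 0"
proof (rule ccontr)
  let ?J = "keys p"
  let ?S = "\<lambda>i. \<Sum>j\<in>{j\<in>?J. cl j = i}. single (\<nu> j) (lookup p j * \<kappa> j)"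
  let ?T = "\<lambda>i. \<Sum>j\<in>{j\<in>?J. cl j = i}. scale (lookup p j) (t j)"
  assume "p \<noteq> 0"
  then obtain j where j: "j \<in> ?J" by fastforce
  have "(\<Sum>i\<in>cl ` ?J. ?T i) = 0"
    using zero by (simp add: lincomb_twisted sum.image_gen[of ?J _ cl, symmetric])
  moreover have "homogeneous deg (\<delta> i) (?T i)" for i
  proof (rule homogeneous_sum)
    fix j assume "j \<in> {j\<in>?J. cl j = i}"
    then have "homogeneous deg (\<delta> i) (t j)" using homog[of j] by simp
    then show "homogeneous deg (\<delta> i) (scale (lookup p j) (t j))"
      by (auto simp: homogeneous_def in_keys_iff)
  qed
  ultimately have "?T (cl j) = 0"
    using homogeneous_sum_zeroD[of "cl ` ?J" \<delta> deg ?T "cl j"] \<delta> j by auto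
  moreover have "?T i = twisted_mult \<chi> (twisted_mult \<chi> (L i) (?S i)) (R i)" for i
  proof -
    have summand: "scale (lookup p j) (t j) = twisted_mult \<chi> (twisted_mult \<chi> (L i)
        (single (\<nu> j) (lookup p j * \<kappa> j))) (R i)" if "cl j = i" for j
      unfolding t_def that scale_single [symmetric] twisted_mult_scale ..
    have "(\<Sum>j\<in>J. scale (lookup p j) (t j)) =
      twisted_mult \<chi> (twisted_mult \<chi> (L i) (\<Sum>j\<in>J. single (\<nu> j) (lookup p j * \<kappa> j))) (R i)"
      if "finite J" "\<forall>j\<in>J. cl j = i" for J
      using that
    proof (induction J rule: finite_induct)
      case (insert j J)
      then have "cl j = i" and "\<forall>j\<in>J. cl j = i" by auto
      note eqs = insert.IH[OF this(2)] summand[OF this(1)]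
      show ?case
        unfolding sum.insert[OF insert.hyps] eqs twisted_mult_add_right twisted_mult_add_left ..
    qed simp
    note this[of "{j\<in>?J. cl j = i}"]
    moreover have "finite {j\<in>?J. cl j = i}" "\<forall>j\<in>{j\<in>?J. cl j = i}. cl j = i" by simp_all
    ultimately show ?thesis by blast
  qed
  ultimately have "?S (cl j) = 0" using nz[OF j] by (simp add: twisted_mult_eq_zero_iff)
  moreover have "lookup (?S (cl j)) (\<nu> j) = lookup p j * \<kappa> j"
  proof -
    have "lookup (?S (cl j)) (\<nu> j) =
      (\<Sum>j'\<in>{j'\<in>?J. cl j' = cl j}. if j' = j then lookup p j * \<kappa> j else 0)"
      unfolding lookup_sum by (intro sum.cong refl) (use \<nu> in \<open>auto simp: lookup_single when_def\<close>)
    then show ?thesis using j by simp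
  qed
  ultimately show False using nz[OF j] j by (simp add: in_keys_iff)
qed


subsection \<open>The Ore condition\<close>

text \<open>
  More vectors than the dimension of a space that contains them. They are indexed, so that
  repetitions count as dependences.
\<close>

lemma linear_dependence_of_many:
  fixes v :: "'i \<Rightarrow> 'g \<Rightarrow>\<^sub>0 'k::field"
  assumes I: "finite I" and T: "finite T" and card: "card T < card I"
    and v: "\<And>i. i \<in> I \<Longrightarrow> keys (v i) \<subseteq> T"
  obtains c i where "i \<in> I" "c i \<noteq> 0" "(\<Sum>i\<in>I. scale (c i) (v i)) = 0"
proof -
  interpret V: vector_space "\<lambda>c. scale (c :: 'k) :: ('g \<Rightarrow>\<^sub>0 'k) \<Rightarrow> _"
    by standard (auto intro!: poly_mapping_eqI simp: lookup_add algebra_simps)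
  show thesis
  proof (cases "inj_on v I")
    case False
    then obtain i j where ij: "i \<in> I" "j \<in> I" "i \<noteq> j" "v i = v j" by (auto simp: inj_on_def)
    let ?c = "\<lambda>k. if k = i then 1 else if k = j then - 1 else 0 :: 'k"
    have "(\<Sum>k\<in>I. scale (?c k) (v k)) = (\<Sum>k\<in>{i, j}. scale (?c k) (v k))"
      using I ij by (intro sum.mono_neutral_right) auto
    also have "\<dots> = 0" using ij by (auto intro!: poly_mapping_eqI simp: lookup_add)
    finally show thesis using ij that[of i ?c] by auto
  next
    case True
    let ?B = "(\<lambda>\<alpha>. single \<alpha> (1::'k)) ` T"
    have span: "w \<in> V.span ?B" if "keys w \<subseteq> T" for w
      using that
    proof (induction w rule: poly_mapping_keys_induct)
      case (single_add \<alpha> a w)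
      then have "scale a (single \<alpha> 1) \<in> V.span ?B"
        by (intro V.span_scale V.span_base) auto
      then show ?case using single_add by (intro V.span_add) auto
    qed (rule V.span_zero)
    have "V.dependent (v ` I)"
    proof (rule ccontr)
      assume "V.independent (v ` I)"
      then have "card (v ` I) \<le> card ?B"
        using V.independent_span_bound[of ?B "v ` I"] T span v by (auto simp: image_subset_iff)
      also have "\<dots> \<le> card T" by (rule card_image_le[OF T])
      finally show False using card card_image[OF True] by simp
    qed
    then obtain u where u: "\<exists>x\<in>v ` I. u x \<noteq> 0" "(\<Sum>x\<in>v ` I. scale (u x) x) = 0"
      using V.dependent_finite[of "v ` I"] I by auto
    then show thesis using that[of _ "u \<circ> v"] True by (auto simp: sum.reindex)
  qed
qed

text \<open>
  Let \<open>u\<close> and \<open>w\<close> range over the elements supported in a finite set \<open>T\<close>. The maps \<open>u \<mapsto> p u\<close> and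
  \<open>w \<mapsto> r w\<close> have images supported in a set \<open>U\<close> with fewer than \<open>2 |T|\<close> elements, so the images
  intersect nontrivially. The hypothesis is a weak form of amenability of the group of exponents.
\<close>

lemma (in ordered_cocycle) right_ore:
  assumes folner: "\<And>S :: 'g set. finite S \<Longrightarrow>
      \<exists>T U. finite T \<and> finite U \<and> card U < 2 * card T \<and> (\<forall>\<alpha>\<in>S. \<forall>\<beta>\<in>T. \<alpha> + \<beta> \<in> U)"
    and pr: "p \<noteq> 0" "r \<noteq> 0"
  obtains u w where "twisted_mult \<chi> p u = twisted_mult \<chi> r w" "twisted_mult \<chi> p u \<noteq> 0"
proof -
  obtain T U where TU: "finite T" "finite U" "card U < 2 * card T"
    "\<And>\<alpha> \<beta>. \<lbrakk>\<alpha> \<in> keys p \<union> keys r; \<beta> \<in> T\<rbrakk> \<Longrightarrow> \<alpha> + \<beta> \<in> U"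
    using folner[of "keys p \<union> keys r"] by auto
  \<comment> \<open>The index \<open>(True, \<beta>)\<close> stands for a multiple of \<open>p\<close> and \<open>(False, \<beta>)\<close> for one of \<open>r\<close>.\<close>
  define v where "v = (\<lambda>(b, \<beta>). twisted_mult \<chi> (if b then p else r) (single \<beta> 1))"
  have card: "card U < card ((UNIV :: bool set) \<times> T)" using TU(3) by (simp add: card_cartesian_product)
  have fin: "finite ((UNIV :: bool set) \<times> T)" using TU(1) by simp
  have keys: "keys (v i) \<subseteq> U" if "i \<in> UNIV \<times> T" for i
  proof
    fix \<gamma> assume "\<gamma> \<in> keys (v i)"
    then obtain \<alpha> where "\<alpha> \<in> keys (if fst i then p else r)" "\<gamma> = \<alpha> + snd i"
      using keys_twisted_mult[of \<chi> "if fst i then p else r" "single (snd i) 1"]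
      by (auto simp: v_def case_prod_beta)
    then show "\<gamma> \<in> U" using TU(4)[of \<alpha> "snd i"] that by (auto split: if_splits)
  qed
  obtain c i where c: "i \<in> UNIV \<times> T" "c i \<noteq> 0"
    "(\<Sum>i\<in>UNIV \<times> T. scale (c i) (v i)) = 0"
    by (rule linear_dependence_of_many[OF fin TU(2) card keys])
  define u where "u b = (\<Sum>\<beta>\<in>T. single \<beta> (c (b, \<beta>)))" for b
  have mult_u: "twisted_mult \<chi> x (u b) = (\<Sum>\<beta>\<in>T. scale (c (b, \<beta>)) (twisted_mult \<chi> x (single \<beta> 1)))" for x b
    unfolding u_def using TU(1)
    by (induction T rule: finite_induct)
       (simp_all add: twisted_mult_add_right flip: twisted_mult_scale(2))
  have "twisted_mult \<chi> p (u True) + twisted_mult \<chi> r (u False) = 0"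
  proof -
    have "(\<Sum>b\<in>UNIV. \<Sum>\<beta>\<in>T. scale (c (b, \<beta>)) (v (b, \<beta>))) = 0"
      using c(3) by (simp add: sum.cartesian_product)
    then show ?thesis by (simp add: mult_u UNIV_bool v_def add.commute)
  qed
  then have eq: "twisted_mult \<chi> p (u True) = twisted_mult \<chi> r (- u False)"
    using twisted_mult_add_right[of \<chi> r "u False" "- u False"]
    by (metis add.commute add_left_cancel right_minus twisted_mult_zero(2))
  obtain b \<beta> where b: "i = (b, \<beta>)" "\<beta> \<in> T" using c(1) by auto
  have "lookup (u b) \<beta> = (\<Sum>\<beta>'\<in>T. if \<beta>' = \<beta> then c (b, \<beta>) else 0)"
    unfolding u_def lookup_sum by (intro sum.cong refl) (auto simp: lookup_single when_def)
  then have "u b \<noteq> 0" using b c(2) TU(1) by auto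
  then have "twisted_mult \<chi> p (u True) \<noteq> 0"
    using eq pr by (cases b) (auto simp: twisted_mult_eq_zero_iff)
  with eq that show thesis by blast
qed

definition box :: "nat \<Rightarrow> (int \<times> int \<times> int) set" where
  "box n = {- int n..int n} \<times> {- int n..int n} \<times> {- int n..int n}"

lemma card_box: "finite (box n)" "card (box n) = (2 * n + 1) ^ 3"
proof -
  have "card {- int n..int n} = 2 * n + 1" by simp
  then show "card (box n) = (2 * n + 1) ^ 3"
    unfolding box_def card_cartesian_product by (simp only: power3_eq_cube mult.assoc)
qed (simp add: box_def)

text \<open>
  If \<open>S\<close> lies in the box of radius \<open>m\<close>, then the boxes of radius \<open>4 m\<close> and \<open>5 m\<close> suffice: their
  sizes are \<open>(8 m + 1)\<^sup>3\<close> and \<open>(10 m + 1)\<^sup>3\<close>, and \<open>(10 / 8)\<^sup>3 < 2\<close>.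
\<close>

lemma folner_boxes:
  fixes S :: "(int \<times> int \<times> int) set"
  assumes "finite S"
  shows "\<exists>T U. finite T \<and> finite U \<and> card U < 2 * card T \<and> (\<forall>\<alpha>\<in>S. \<forall>\<beta>\<in>T. \<alpha> + \<beta> \<in> U)"
proof -
  define m where "m = (\<Sum>(a, b, c)\<in>S. nat \<bar>a\<bar> + nat \<bar>b\<bar> + nat \<bar>c\<bar>)"
  have bound: "\<bar>a\<bar> \<le> int m \<and> \<bar>b\<bar> \<le> int m \<and> \<bar>c\<bar> \<le> int m" if "(a, b, c) \<in> S" for a b c
  proof -
    have "(case (a, b, c) of (a, b, c) \<Rightarrow> nat \<bar>a\<bar> + nat \<bar>b\<bar> + nat \<bar>c\<bar>) \<le> m"
      unfolding m_def using assms that by (intro member_le_sum) auto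
    then show ?thesis by auto
  qed
  have "\<alpha> + \<beta> \<in> box (5 * m)" if \<alpha>: "\<alpha> \<in> S" and \<beta>: "\<beta> \<in> box (4 * m)" for \<alpha> \<beta>
  proof -
    obtain a b c a' b' c' where eq: "\<alpha> = (a, b, c)" "\<beta> = (a', b', c')" by (metis surj_pair)
    show ?thesis using bound[of a b c] \<alpha> \<beta> by (auto simp: eq box_def)
  qed
  moreover have "(2 * (5 * m) + 1) ^ 3 < 2 * (2 * (4 * m) + 1) ^ 3"
    by (simp add: power3_eq_cube algebra_simps)
  ultimately show ?thesis
    by (intro exI[of _ "box (4 * m)"] exI[of _ "box (5 * m)"]) (auto simp: card_box)
qed

section \<open>The skew field of fractions of an Ore domain\<close>

lemma (in monoid) right_cancel_unit:
  "\<lbrakk>x \<otimes> a = y \<otimes> a; a \<in> Units G; x \<in> carrier G; y \<in> carrier G\<rbrakk> \<Longrightarrow> x = y"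
  by (metis m_assoc Units_closed Units_inv_closed Units_r_inv r_one)

lemma Union_eq_memberI: "\<lbrakk>\<And>x. x \<in> S \<Longrightarrow> x = z; z \<in> S\<rbrakk> \<Longrightarrow> \<Union>S = z"
  by blast

locale ore_algebra = field_algebra R for R :: "('k::field, 'a) module" (structure) +
  assumes one_not_zero: "\<one> \<noteq> \<zero>"
    and integral: "\<lbrakk>x \<otimes> y = \<zero>; x \<in> carrier R; y \<in> carrier R\<rbrakk> \<Longrightarrow> x = \<zero> \<or> y = \<zero>"
    and right_ore: "\<lbrakk>a \<in> carrier R; b \<in> carrier R; a \<noteq> \<zero>; b \<noteq> \<zero>\<rbrakk>
        \<Longrightarrow> \<exists>u\<in>carrier R. \<exists>v\<in>carrier R. a \<otimes> u = b \<otimes> v \<and> a \<otimes> u \<noteq> \<zero>"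
begin

lemma mult_eq_zero_iff: "\<lbrakk>x \<in> carrier R; y \<in> carrier R\<rbrakk> \<Longrightarrow> x \<otimes> y = \<zero> \<longleftrightarrow> x = \<zero> \<or> y = \<zero>"
  using integral by auto

lemma right_oreE:
  assumes "a \<in> carrier R" "b \<in> carrier R" "a \<noteq> \<zero>" "b \<noteq> \<zero>"
  obtains u v where "u \<in> carrier R" "v \<in> carrier R" "a \<otimes> u = b \<otimes> v" "a \<otimes> u \<noteq> \<zero>"
  using right_ore[OF assms] by (elim bexE conjE) (rule that)

lemma nonzero_factor: "\<lbrakk>a \<otimes> s \<noteq> \<zero>; a \<in> carrier R\<rbrakk> \<Longrightarrow> s \<noteq> \<zero>"
  by (rule notI) simp

lemma cancel_left:
  assumes "a \<otimes> x = a \<otimes> y" "a \<noteq> \<zero>" "a \<in> carrier R" "x \<in> carrier R" "y \<in> carrier R"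
  shows "x = y"
proof -
  have "a \<otimes> (x \<ominus> y) = \<zero>" using assms by (simp add: minus_eq r_distr r_minus r_neg)
  then show ?thesis using assms integral[of a "x \<ominus> y"] by (auto intro: eq_of_minus_zero)
qed

lemma cancel_right:
  assumes "x \<otimes> a = y \<otimes> a" "a \<noteq> \<zero>" "a \<in> carrier R" "x \<in> carrier R" "y \<in> carrier R"
  shows "x = y"
proof -
  have "(x \<ominus> y) \<otimes> a = \<zero>" using assms by (simp add: minus_eq l_distr l_minus r_neg)
  then show ?thesis using assms integral[of "x \<ominus> y" a] by (auto intro: eq_of_minus_zero)
qed

abbreviation "frac \<equiv> frac_class R"

lemma fractions_iff: "(a, b) \<in> fractions R \<longleftrightarrow> a \<in> carrier R \<and> b \<in> carrier R \<and> b \<noteq> \<zero>"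
  by (auto simp: fractions_def)

lemma frac_relI:
  assumes "a \<in> carrier R" "b \<in> carrier R" "c \<in> carrier R" "d \<in> carrier R" "u \<in> carrier R" "v \<in> carrier R"
    "b \<otimes> u = d \<otimes> v" "b \<otimes> u \<noteq> \<zero>" "a \<otimes> u = c \<otimes> v"
  shows "((a, b), (c, d)) \<in> frac_rel R"
proof -
  have "b \<noteq> \<zero>" using assms(5,8) by auto
  moreover have "d \<noteq> \<zero>" using assms(6-8) by auto
  ultimately show ?thesis unfolding frac_rel_def mem_Collect_eq prod.case fractions_iff
    using assms by blast
qed

lemma equiv_frac_rel: "equiv (fractions R) (frac_rel R)"
proof (rule equivI)
  show "frac_rel R \<subseteq> fractions R \<times> fractions R" by (auto simp: frac_rel_def)
  show "refl_on (fractions R) (frac_rel R)"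
    by (rule refl_onI) (auto intro!: frac_relI[of _ _ _ _ \<one> \<one>] simp: fractions_iff)
  show "sym (frac_rel R)"
  proof (rule symI)
    fix x y assume "(x, y) \<in> frac_rel R"
    then obtain a b c d u v where "x = (a, b)" "y = (c, d)" "(a, b) \<in> fractions R" "(c, d) \<in> fractions R"
      "u \<in> carrier R" "v \<in> carrier R" "b \<otimes> u = d \<otimes> v" "b \<otimes> u \<noteq> \<zero>" "a \<otimes> u = c \<otimes> v"
      by (auto simp: frac_rel_def)
    then show "(y, x) \<in> frac_rel R" by (auto intro!: frac_relI[of _ _ _ _ v u] simp: fractions_iff)
  qed
  show "trans (frac_rel R)"
  proof (rule transI)
    fix x y z assume "(x, y) \<in> frac_rel R" "(y, z) \<in> frac_rel R"
    then obtain a b c d e f u v u' v' where eqs: "x = (a, b)" "y = (c, d)" "z = (e, f)"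
      and fr: "(a, b) \<in> fractions R" "(c, d) \<in> fractions R" "(e, f) \<in> fractions R"
      and uv: "u \<in> carrier R" "v \<in> carrier R" "b \<otimes> u = d \<otimes> v" "b \<otimes> u \<noteq> \<zero>" "a \<otimes> u = c \<otimes> v"
      and uv': "u' \<in> carrier R" "v' \<in> carrier R" "d \<otimes> u' = f \<otimes> v'" "d \<otimes> u' \<noteq> \<zero>" "c \<otimes> u' = e \<otimes> v'"
      by (auto simp: frac_rel_def)
    have nz: "v \<noteq> \<zero>" "u' \<noteq> \<zero>" using uv uv' fr by (auto simp: fractions_iff)
    obtain s t where st: "s \<in> carrier R" "t \<in> carrier R" "v \<otimes> s = u' \<otimes> t" "v \<otimes> s \<noteq> \<zero>"
      by (rule right_oreE[OF uv(2) uv'(1) nz])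
    have "b \<otimes> (u \<otimes> s) = d \<otimes> (v \<otimes> s)" "a \<otimes> (u \<otimes> s) = c \<otimes> (v \<otimes> s)"
      using fr uv st(1) by (simp_all add: fractions_iff flip: m_assoc)
    moreover have "d \<otimes> (u' \<otimes> t) = f \<otimes> (v' \<otimes> t)" "c \<otimes> (u' \<otimes> t) = e \<otimes> (v' \<otimes> t)"
      using fr uv' st(2) by (simp_all add: fractions_iff flip: m_assoc)
    ultimately have "b \<otimes> (u \<otimes> s) = f \<otimes> (v' \<otimes> t)" "a \<otimes> (u \<otimes> s) = e \<otimes> (v' \<otimes> t)" by (simp_all add: st(3))
    moreover have "b \<otimes> (u \<otimes> s) \<noteq> \<zero>"
    proof -
      have "s \<noteq> \<zero>" "u \<noteq> \<zero>" using st uv fr by (auto simp: fractions_iff)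
      then show ?thesis using fr uv st by (simp add: fractions_iff mult_eq_zero_iff)
    qed
    ultimately show "(x, z) \<in> frac_rel R"
      using fr uv uv' st unfolding eqs fractions_iff
      by (intro frac_relI[of _ _ _ _ "u \<otimes> s" "v' \<otimes> t"]) simp_all
  qed
qed

definition fracs :: "('a \<times> 'a) set set" where
  "fracs = fractions R // frac_rel R"

lemma frac_in_fracs: "\<lbrakk>a \<in> carrier R; b \<in> carrier R; b \<noteq> \<zero>\<rbrakk> \<Longrightarrow> frac a b \<in> fracs"
  unfolding fracs_def frac_class_def by (rule quotientI) (simp add: fractions_iff)

lemma mem_frac_iff: "(c, d) \<in> frac a b \<longleftrightarrow> ((a, b), (c, d)) \<in> frac_rel R"
  by (simp add: frac_class_def)

lemma mem_fracD:
  assumes "P \<in> fracs" "(a, b) \<in> P"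
  shows "a \<in> carrier R" "b \<in> carrier R" "b \<noteq> \<zero>" "P = frac a b"
proof -
  have "(a, b) \<in> fractions R"
    using in_quotient_imp_subset[OF equiv_frac_rel] assms by (auto simp: fracs_def)
  then show "a \<in> carrier R" "b \<in> carrier R" "b \<noteq> \<zero>" by (simp_all add: fractions_iff)
  show "P = frac a b"
  proof -
    obtain x where x: "P = frac_rel R `` {x}" using assms(1) unfolding fracs_def by (rule quotientE)
    then have "(x, (a, b)) \<in> frac_rel R" using assms(2) by simp
    then show ?thesis unfolding x frac_class_def by (rule equiv_class_eq[OF equiv_frac_rel])
  qed
qed

lemma frac_self: "\<lbrakk>a \<in> carrier R; b \<in> carrier R; b \<noteq> \<zero>\<rbrakk> \<Longrightarrow> (a, b) \<in> frac a b"
  by (auto simp: mem_frac_iff intro!: frac_relI[of _ _ _ _ \<one> \<one>])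

lemma fracs_cases:
  assumes "P \<in> fracs"
  obtains a b where "(a, b) \<in> P" "a \<in> carrier R" "b \<in> carrier R" "b \<noteq> \<zero>"
proof -
  have "P \<noteq> {}" using in_quotient_imp_non_empty[OF equiv_frac_rel] assms by (simp add: fracs_def)
  then obtain a b where "(a, b) \<in> P" by fast
  then show thesis using mem_fracD[OF assms] that by blast
qed

lemma mem_frac_expand:
  assumes "P \<in> fracs" "(a, b) \<in> P" "t \<in> carrier R" "t \<noteq> \<zero>"
  shows "(a \<otimes> t, b \<otimes> t) \<in> P"
proof -
  note ab = mem_fracD[OF assms(1,2)]
  have "((a, b), (a \<otimes> t, b \<otimes> t)) \<in> frac_rel R"
    using ab assms by (intro frac_relI[of _ _ _ _ t \<one>]) (simp_all add: mult_eq_zero_iff)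
  then show ?thesis unfolding ab(4) mem_frac_iff .
qed

lemma mem_frac_functional:
  assumes "P \<in> fracs" "(a, b) \<in> P" "(a', b) \<in> P"
  shows "a = a'"
proof -
  note ab = mem_fracD[OF assms(1,2)] and ab' = mem_fracD[OF assms(1,3)]
  have "((a, b), (a', b)) \<in> frac_rel R" using assms ab(4) by (simp add: mem_frac_iff)
  then obtain u v where uv: "u \<in> carrier R" "v \<in> carrier R" "b \<otimes> u = b \<otimes> v" "b \<otimes> u \<noteq> \<zero>" "a \<otimes> u = a' \<otimes> v"
    by (auto simp: frac_rel_def)
  have "u = v" using cancel_left[OF uv(3)] uv ab by simp
  moreover have "u \<noteq> \<zero>" using uv ab by auto
  ultimately show ?thesis using cancel_right[of a u a'] uv ab ab' by simp
qed

text \<open>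
  A class of fractions \<open>P\<close>, being saturated, is the graph of a partial map that is linear for right
  multiplication: \<open>acts P y x\<close> says that \<open>P\<close> sends \<open>y\<close> to \<open>x\<close>. The first disjunct adds the value at
  \<open>0\<close>, which the pairs in \<open>P\<close> omit because denominators are nonzero.
\<close>

definition acts :: "('a \<times> 'a) set \<Rightarrow> 'a \<Rightarrow> 'a \<Rightarrow> bool" where
  "acts P y x \<longleftrightarrow> y = \<zero> \<and> x = \<zero> \<or> (x, y) \<in> P"

lemma acts_closed: "\<lbrakk>P \<in> fracs; acts P y x\<rbrakk> \<Longrightarrow> y \<in> carrier R \<and> x \<in> carrier R"
  unfolding acts_def using mem_fracD by blast

lemma acts_functional: "\<lbrakk>P \<in> fracs; acts P y x; acts P y x'\<rbrakk> \<Longrightarrow> x = x'"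
  unfolding acts_def using mem_frac_functional mem_fracD(3) by blast

lemma acts_mult:
  assumes "P \<in> fracs" "acts P y x" "t \<in> carrier R"
  shows "acts P (y \<otimes> t) (x \<otimes> t)"
proof (cases "t = \<zero>")
  case True
  then show ?thesis using assms acts_closed[OF assms(1,2)] by (simp add: acts_def)
next
  case False
  then show ?thesis using assms mem_frac_expand[of P x y t] by (auto simp: acts_def)
qed

lemma acts_cancel:
  assumes "P \<in> fracs" "acts P (y \<otimes> t) (x \<otimes> t)" "t \<in> carrier R" "t \<noteq> \<zero>" "x \<in> carrier R" "y \<in> carrier R"
  shows "acts P y x"
proof (cases "y = \<zero>")
  case True
  then have "x \<otimes> t = \<zero>" using assms mem_fracD(3)[OF assms(1)] by (auto simp: acts_def)
  then show ?thesis using True assms by (auto simp: acts_def mult_eq_zero_iff)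
next
  case False
  then have "(x \<otimes> t, y \<otimes> t) \<in> P" using assms by (simp add: acts_def mult_eq_zero_iff)
  moreover note mem_fracD[OF assms(1) this]
  moreover have "((x \<otimes> t, y \<otimes> t), (x, y)) \<in> frac_rel R"
    using False assms by (intro frac_relI[of _ _ _ _ \<one> t]) (simp_all add: mult_eq_zero_iff)
  ultimately show ?thesis using mem_frac_iff by (metis acts_def)
qed

text \<open>
  The domain of the partial map is large: by the Ore condition, every element of the ring has a
  nonzero right multiple in it.
\<close>

lemma acts_exists:
  assumes P: "P \<in> fracs" and y: "y \<in> carrier R"
  obtains t x where "t \<in> carrier R" "t \<noteq> \<zero>" "acts P (y \<otimes> t) x"
proof (cases "y = \<zero>")
  case True
  then show thesis using that[of \<one> \<zero>] one_not_zero by (simp add: acts_def)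
next
  case False
  obtain a b where ab: "(a, b) \<in> P" "a \<in> carrier R" "b \<in> carrier R" "b \<noteq> \<zero>" by (rule fracs_cases[OF P])
  obtain u t where ut: "u \<in> carrier R" "t \<in> carrier R" "b \<otimes> u = y \<otimes> t" "b \<otimes> u \<noteq> \<zero>"
    by (rule right_oreE[OF ab(3) y ab(4) False])
  have "acts P (b \<otimes> u) (a \<otimes> u)" using ab ut P by (intro acts_mult) (simp_all add: acts_def)
  moreover have "t \<noteq> \<zero>" using ut y by auto
  ultimately show thesis using that[of t "a \<otimes> u"] ut by simp
qed

text \<open>
  For a given \<open>(a, b) \<in> P\<close>, the Ore condition yields one factor \<open>t t'\<close> that moves both arguments
  into \<open>b R\<close>, where the map is \<open>b u \<mapsto> a u\<close> and visibly additive.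
\<close>

lemma acts_add:
  assumes P: "P \<in> fracs" and "acts P y x" "acts P y' x'"
  shows "acts P (y \<oplus> y') (x \<oplus> x')"
proof -
  note xy = acts_closed[OF P assms(2)] acts_closed[OF P assms(3)]
  obtain a b where ab: "(a, b) \<in> P" "a \<in> carrier R" "b \<in> carrier R" "b \<noteq> \<zero>" by (rule fracs_cases[OF P])
  have common: "\<exists>t u. t \<in> carrier R \<and> t \<noteq> \<zero> \<and> u \<in> carrier R \<and> y \<otimes> t = b \<otimes> u \<and> x \<otimes> t = a \<otimes> u"
    if yx: "acts P y x" and c: "x \<in> carrier R" "y \<in> carrier R" for x y
  proof (cases "y = \<zero>")
    case True
    then have "x = \<zero>" using yx mem_fracD(3)[OF P] by (auto simp: acts_def)
    then show ?thesis using True ab one_not_zero by (intro exI[of _ \<one>] exI[of _ \<zero>]) auto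
  next
    case False
    obtain t u where tu: "t \<in> carrier R" "u \<in> carrier R" "y \<otimes> t = b \<otimes> u" "y \<otimes> t \<noteq> \<zero>"
      by (rule right_oreE[OF c(2) ab(3) False ab(4)])
    have "acts P (y \<otimes> t) (x \<otimes> t)" using yx tu P by (intro acts_mult)
    moreover have "acts P (b \<otimes> u) (a \<otimes> u)" using ab tu P by (intro acts_mult) (simp_all add: acts_def)
    ultimately have "x \<otimes> t = a \<otimes> u" using acts_functional[OF P] tu(3) by simp
    moreover have "t \<noteq> \<zero>" using tu c by auto
    ultimately show ?thesis using tu by blast
  qed
  obtain t u where tu: "t \<in> carrier R" "t \<noteq> \<zero>" "u \<in> carrier R" "y \<otimes> t = b \<otimes> u" "x \<otimes> t = a \<otimes> u"
    using common[OF assms(2) xy(1)[THEN conjunct2] xy(1)[THEN conjunct1]] by (elim exE conjE) (rule that)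
  have "acts P (y' \<otimes> t) (x' \<otimes> t)" using assms tu by (intro acts_mult)
  moreover have "x' \<otimes> t \<in> carrier R" "y' \<otimes> t \<in> carrier R" using xy tu by simp_all
  ultimately have "\<exists>t' u'. t' \<in> carrier R \<and> t' \<noteq> \<zero> \<and> u' \<in> carrier R \<and>
      y' \<otimes> t \<otimes> t' = b \<otimes> u' \<and> x' \<otimes> t \<otimes> t' = a \<otimes> u'" by (rule common)
  then obtain t' u' where tu': "t' \<in> carrier R" "t' \<noteq> \<zero>" "u' \<in> carrier R"
    "y' \<otimes> t \<otimes> t' = b \<otimes> u'" "x' \<otimes> t \<otimes> t' = a \<otimes> u'"
    by (elim exE conjE) (rule that)
  have "b \<otimes> (u \<otimes> t' \<oplus> u') = (y \<oplus> y') \<otimes> (t \<otimes> t')"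
    using ab tu tu' xy by (simp add: r_distr l_distr flip: m_assoc)
  moreover have "a \<otimes> (u \<otimes> t' \<oplus> u') = (x \<oplus> x') \<otimes> (t \<otimes> t')"
    using ab tu tu' xy by (simp add: r_distr l_distr flip: m_assoc)
  moreover have "acts P (b \<otimes> (u \<otimes> t' \<oplus> u')) (a \<otimes> (u \<otimes> t' \<oplus> u'))"
    using ab tu tu' P by (intro acts_mult) (simp_all add: acts_def)
  ultimately have "acts P ((y \<oplus> y') \<otimes> (t \<otimes> t')) ((x \<oplus> x') \<otimes> (t \<otimes> t'))" by simp
  from acts_cancel[OF P this] show ?thesis using tu tu' xy by (simp add: mult_eq_zero_iff)
qed

lemma common_denominator:
  assumes P: "P \<in> fracs" and Q: "Q \<in> fracs"
  obtains x y r where "(x, r) \<in> P" "(y, r) \<in> Q"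
proof -
  obtain a b where ab: "(a, b) \<in> P" "a \<in> carrier R" "b \<in> carrier R" "b \<noteq> \<zero>" by (rule fracs_cases[OF P])
  obtain t x where "t \<in> carrier R" "t \<noteq> \<zero>" "acts Q (b \<otimes> t) x" by (rule acts_exists[OF Q ab(3)])
  then show thesis
    using that[of "a \<otimes> t" "b \<otimes> t" x] ab mem_frac_expand[OF P ab(1)] by (simp add: acts_def mult_eq_zero_iff)
qed

lemma composable:
  assumes P: "P \<in> fracs" and Q: "Q \<in> fracs"
  obtains x y z where "(y, z) \<in> Q" "acts P y x"
proof -
  obtain c d where cd: "(c, d) \<in> Q" "c \<in> carrier R" "d \<in> carrier R" "d \<noteq> \<zero>" by (rule fracs_cases[OF Q])
  obtain t x where "t \<in> carrier R" "t \<noteq> \<zero>" "acts P (c \<otimes> t) x" by (rule acts_exists[OF P cd(2)])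
  then show thesis using that mem_frac_expand[OF Q cd(1)] by blast
qed

lemma frac_eqI:
  assumes "P \<in> fracs" "(a, b) \<in> P" "Q \<in> fracs" "(a, b) \<in> Q"
  shows "P = Q"
  using mem_fracD(4)[OF assms(1,2)] mem_fracD(4)[OF assms(3,4)] by simp

text \<open>
  Every admissible choice in the definition of the sum produces numerators of \<open>P\<close> and \<open>Q\<close> over a
  common denominator. Two such choices can be expanded to the same denominator, and then their
  numerators agree because fractions act as functions.
\<close>

lemma frac_add_eq:
  assumes P: "P \<in> fracs" and Q: "Q \<in> fracs" and x: "(x, r) \<in> P" and y: "(y, r) \<in> Q"
  shows "frac_add R P Q = frac (x \<oplus> y) r"
proof -
  note xr = mem_fracD[OF P x] and yr = mem_fracD[OF Q y]
  have all_equal: "frac (a \<otimes> u \<oplus> c \<otimes> v) (b \<otimes> u) = frac (x \<oplus> y) r"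
    if ab: "(a, b) \<in> P" and cd: "(c, d) \<in> Q" and uv: "u \<in> carrier R" "v \<in> carrier R"
      and eq: "b \<otimes> u = d \<otimes> v" and nz: "b \<otimes> u \<noteq> \<zero>" for a b c d u v
  proof -
    note ab' = mem_fracD[OF P ab] and cd' = mem_fracD[OF Q cd]
    have uv_nz: "u \<noteq> \<zero>" "v \<noteq> \<zero>" using nz eq uv ab' cd' by auto
    have au: "(a \<otimes> u, b \<otimes> u) \<in> P" using mem_frac_expand[OF P ab] uv uv_nz by simp
    have cv: "(c \<otimes> v, b \<otimes> u) \<in> Q" using mem_frac_expand[OF Q cd] uv uv_nz eq by simp
    obtain s t where st: "s \<in> carrier R" "t \<in> carrier R" "r \<otimes> s = b \<otimes> u \<otimes> t" "r \<otimes> s \<noteq> \<zero>"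
      by (rule right_oreE[OF xr(2) m_closed[OF ab'(2) uv(1)] xr(3) nz])
    have "s \<noteq> \<zero>" using st(4) xr(2) by (rule nonzero_factor)
    have "t \<noteq> \<zero>" using st(4)[unfolded st(3)] m_closed[OF ab'(2) uv(1)] by (rule nonzero_factor)
    have "x \<otimes> s = a \<otimes> u \<otimes> t"
      using mem_frac_functional[OF P] mem_frac_expand[OF P x st(1) \<open>s \<noteq> \<zero>\<close>]
        mem_frac_expand[OF P au st(2) \<open>t \<noteq> \<zero>\<close>] st by metis
    moreover have "y \<otimes> s = c \<otimes> v \<otimes> t"
      using mem_frac_functional[OF Q] mem_frac_expand[OF Q y st(1) \<open>s \<noteq> \<zero>\<close>]
        mem_frac_expand[OF Q cv st(2) \<open>t \<noteq> \<zero>\<close>] st by metis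
    ultimately have "(x \<oplus> y) \<otimes> s = (a \<otimes> u \<oplus> c \<otimes> v) \<otimes> t"
      using st xr yr ab' cd' uv by (simp add: l_distr)
    then have "((x \<oplus> y, r), (a \<otimes> u \<oplus> c \<otimes> v, b \<otimes> u)) \<in> frac_rel R"
      using st xr yr ab' cd' uv by (intro frac_relI[of _ _ _ _ s t]) simp_all
    then show ?thesis
      unfolding frac_class_def by (rule equiv_class_eq[OF equiv_frac_rel, symmetric])
  qed
  let ?S = "{frac (a \<otimes> u \<oplus> c \<otimes> v) (b \<otimes> u) | a b c d u v.
         (a, b) \<in> P \<and> (c, d) \<in> Q \<and> u \<in> carrier R \<and> v \<in> carrier R \<and>
         b \<otimes> u = d \<otimes> v \<and> b \<otimes> u \<noteq> \<zero>}"
  have "P' = frac (x \<oplus> y) r" if "P' \<in> ?S" for P'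
    using that by (elim CollectE exE conjE) (hypsubst, rule all_equal)
  moreover have "frac (x \<oplus> y) r \<in> ?S"
    by (rule CollectI, intro exI[of _ x] exI[of _ r] exI[of _ y] exI[of _ r] exI[of _ \<one>])
       (use x y xr yr in simp)
  ultimately show ?thesis unfolding frac_add_def by (rule Union_eq_memberI)
qed

text \<open>
  The product is the composition of partial maps: if \<open>Q\<close> sends \<open>z\<close> to \<open>y\<close> and \<open>P\<close> sends \<open>y\<close> to \<open>x\<close>,
  then the product sends \<open>z\<close> to \<open>x\<close>.
\<close>

lemma frac_mult_eq:
  assumes P: "P \<in> fracs" and Q: "Q \<in> fracs" and y: "(y, z) \<in> Q" and x: "acts P y x"
  shows "frac_mult R P Q = frac x z"
proof -
  note yz = mem_fracD[OF Q y] and xy = acts_closed[OF P x]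
  have all_equal: "frac (a \<otimes> u) (d \<otimes> v) = frac x z"
    if ab: "(a, b) \<in> P" and cd: "(c, d) \<in> Q" and uv: "u \<in> carrier R" "v \<in> carrier R"
      and eq: "b \<otimes> u = c \<otimes> v" and nz: "v \<noteq> \<zero>" for a b c d u v
  proof -
    note ab' = mem_fracD[OF P ab] and cd' = mem_fracD[OF Q cd]
    have cv: "(c \<otimes> v, d \<otimes> v) \<in> Q" using mem_frac_expand[OF Q cd] uv nz by simp
    have au: "acts P (c \<otimes> v) (a \<otimes> u)"
      using acts_mult[OF P, of b a u] ab uv eq by (simp add: acts_def)
    have dv: "d \<otimes> v \<noteq> \<zero>" using cd' uv nz by (simp add: mult_eq_zero_iff)
    obtain s t where st: "s \<in> carrier R" "t \<in> carrier R" "z \<otimes> s = d \<otimes> v \<otimes> t" "z \<otimes> s \<noteq> \<zero>"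
      by (rule right_oreE[OF yz(2) m_closed[OF cd'(2) uv(2)] yz(3) dv])
    have "s \<noteq> \<zero>" using st(4) yz(2) by (rule nonzero_factor)
    have "t \<noteq> \<zero>" using st(4)[unfolded st(3)] m_closed[OF cd'(2) uv(2)] by (rule nonzero_factor)
    have "y \<otimes> s = c \<otimes> v \<otimes> t"
      using mem_frac_functional[OF Q] mem_frac_expand[OF Q y st(1) \<open>s \<noteq> \<zero>\<close>]
        mem_frac_expand[OF Q cv st(2) \<open>t \<noteq> \<zero>\<close>] st by metis
    then have "x \<otimes> s = a \<otimes> u \<otimes> t"
      using acts_functional[OF P] acts_mult[OF P x st(1)] acts_mult[OF P au st(2)] by metis
    then have "((x, z), (a \<otimes> u, d \<otimes> v)) \<in> frac_rel R"
      using st xy yz ab' cd' uv by (intro frac_relI[of _ _ _ _ s t]) simp_all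
    then show ?thesis
      unfolding frac_class_def by (rule equiv_class_eq[OF equiv_frac_rel, symmetric])
  qed
  let ?S = "{frac (a \<otimes> u) (d \<otimes> v) | a b c d u v.
         (a, b) \<in> P \<and> (c, d) \<in> Q \<and> u \<in> carrier R \<and> v \<in> carrier R \<and>
         b \<otimes> u = c \<otimes> v \<and> v \<noteq> \<zero>}"
  have "P' = frac x z" if "P' \<in> ?S" for P'
    using that by (elim CollectE exE conjE) (hypsubst, rule all_equal)
  moreover have "frac x z \<in> ?S"
  proof (cases "y = \<zero>")
    case True
    obtain a b where ab: "(a, b) \<in> P" "a \<in> carrier R" "b \<in> carrier R" "b \<noteq> \<zero>" by (rule fracs_cases[OF P])
    have "x = \<zero>" using acts_functional[OF P x, of \<zero>] True by (simp add: acts_def)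
    then show ?thesis
      by (intro CollectI exI[of _ a] exI[of _ b] exI[of _ y] exI[of _ z] exI[of _ \<zero>] exI[of _ \<one>])
         (use y yz ab True one_not_zero in simp)
  next
    case False
    then have "(x, y) \<in> P" using x by (simp add: acts_def)
    then show ?thesis
      by (intro CollectI exI[of _ x] exI[of _ y] exI[of _ z] exI[of _ \<one>])
         (use y xy yz one_not_zero in simp)
  qed
  ultimately show ?thesis unfolding frac_mult_def by (rule Union_eq_memberI)
qed

lemma frac_smult_eq:
  assumes P: "P \<in> fracs" and x: "(x, r) \<in> P"
  shows "frac_smult R c P = frac (c \<odot> x) r"
proof -
  note xr = mem_fracD[OF P x]
  have "frac (c \<odot> a) b = frac (c \<odot> x) r" if ab: "(a, b) \<in> P" for a b
  proof -
    note ab' = mem_fracD[OF P ab]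
    have "((a, b), (x, r)) \<in> frac_rel R" using x ab' by (simp add: mem_frac_iff)
    then obtain u v where uv: "u \<in> carrier R" "v \<in> carrier R" "b \<otimes> u = r \<otimes> v" "b \<otimes> u \<noteq> \<zero>" "a \<otimes> u = x \<otimes> v"
      by (auto simp: frac_rel_def)
    then have "((c \<odot> a, b), (c \<odot> x, r)) \<in> frac_rel R"
      using ab' xr by (intro frac_relI[of _ _ _ _ u v]) (simp_all add: smult_mult_left)
    then show ?thesis
      unfolding frac_class_def by (rule equiv_class_eq[OF equiv_frac_rel])
  qed
  then have "(\<lambda>(a, b). frac (c \<odot> a) b) p = frac (c \<odot> x) r" if "p \<in> P" for p
    using that by (cases p) auto
  moreover have "P \<noteq> {}" using x by auto
  ultimately show ?thesis unfolding frac_smult_def by (intro SUP_eq_const) auto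
qed

abbreviation "Q \<equiv> frac_field R"

lemma frac_field_simps:
  "carrier Q = fracs" "mult Q = frac_mult R" "one Q = frac \<one> \<one>" "zero Q = frac \<zero> \<one>"
  "add Q = frac_add R" "smult Q = frac_smult R"
  by (simp_all add: frac_field_def fracs_def)

lemma add_mem:
  assumes "P \<in> fracs" "P' \<in> fracs" "(x, r) \<in> P" "(y, r) \<in> P'"
  shows "frac_add R P P' \<in> fracs" "(x \<oplus> y, r) \<in> frac_add R P P'"
  using mem_fracD(1-3)[OF assms(1,3)] mem_fracD(1-3)[OF assms(2,4)]
  by (simp_all add: frac_add_eq[OF assms] frac_in_fracs frac_self)

lemma mult_mem:
  assumes "P \<in> fracs" "P' \<in> fracs" "(y, z) \<in> P'" "acts P y x"
  shows "frac_mult R P P' \<in> fracs" "(x, z) \<in> frac_mult R P P'"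
  using acts_closed[OF assms(1,4)] mem_fracD(1-3)[OF assms(2,3)]
  by (simp_all add: frac_mult_eq[OF assms] frac_in_fracs frac_self)

lemma smult_mem:
  assumes "P \<in> fracs" "(x, r) \<in> P"
  shows "frac_smult R c P \<in> fracs" "(c \<odot> x, r) \<in> frac_smult R c P"
  using mem_fracD(1-3)[OF assms] by (simp_all add: frac_smult_eq[OF assms] frac_in_fracs frac_self)

lemma fracs_add_closed: "\<lbrakk>P \<in> fracs; P' \<in> fracs\<rbrakk> \<Longrightarrow> frac_add R P P' \<in> fracs"
  by (metis common_denominator add_mem(1))

lemma fracs_mult_closed: "\<lbrakk>P \<in> fracs; P' \<in> fracs\<rbrakk> \<Longrightarrow> frac_mult R P P' \<in> fracs"
  by (metis composable mult_mem(1))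

lemma fracs_smult_closed: "P \<in> fracs \<Longrightarrow> frac_smult R c P \<in> fracs"
  by (metis fracs_cases smult_mem(1))

lemma zero_mem: "\<lbrakk>r \<in> carrier R; r \<noteq> \<zero>\<rbrakk> \<Longrightarrow> (\<zero>, r) \<in> frac \<zero> \<one>"
  by (auto simp: mem_frac_iff one_not_zero intro!: frac_relI[of _ _ _ _ r \<one>])

lemma acts_one: "r \<in> carrier R \<Longrightarrow> acts (frac \<one> \<one>) r r"
  by (auto simp: acts_def mem_frac_iff one_not_zero intro!: frac_relI[of _ _ _ _ r \<one>])

lemma const_fracs [simp]: "frac \<zero> \<one> \<in> fracs" "frac \<one> \<one> \<in> fracs"
  by (simp_all add: frac_in_fracs one_not_zero)

lemma triple_common_denominator:
  assumes "P \<in> fracs" "P' \<in> fracs" "P'' \<in> fracs"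
  obtains x y z r where "(x, r) \<in> P" "(y, r) \<in> P'" "(z, r) \<in> P''"
proof -
  obtain x y r where xy: "(x, r) \<in> P" "(y, r) \<in> P'" by (rule common_denominator[OF assms(1,2)])
  note r = mem_fracD[OF assms(1) xy(1)]
  obtain t z where "t \<in> carrier R" "t \<noteq> \<zero>" "acts P'' (r \<otimes> t) z" by (rule acts_exists[OF assms(3) r(2)])
  then show thesis
    using that[of "x \<otimes> t" "r \<otimes> t" "y \<otimes> t" z] r mem_frac_expand[OF assms(1) xy(1)]
      mem_frac_expand[OF assms(2) xy(2)] by (simp add: acts_def mult_eq_zero_iff)
qed

text \<open>
  Each axiom is checked on one element on which all the partial maps involved are defined, and a
  class of fractions is determined by its value at a single nonzero element.
\<close>

lemma ring_frac_field: "ring Q"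
proof (intro ringI abelian_groupI monoidI, unfold frac_field_simps)
  fix P P' P'' assume P: "P \<in> fracs" "P' \<in> fracs"
  show "frac_add R P P' \<in> fracs" "frac_mult R P P' \<in> fracs"
    using P by (simp_all add: fracs_add_closed fracs_mult_closed)
  show "frac_add R P P' = frac_add R P' P"
  proof -
    obtain x y r where xy: "(x, r) \<in> P" "(y, r) \<in> P'" by (rule common_denominator[OF P])
    show ?thesis
      using mem_fracD(1-3)[OF P(1) xy(1)] mem_fracD(1-3)[OF P(2) xy(2)]
      by (simp add: frac_add_eq[OF P xy] frac_add_eq[OF P(2,1) xy(2,1)] a_comm)
  qed
  assume P'': "P'' \<in> fracs"
  show "frac_add R (frac_add R P P') P'' = frac_add R P (frac_add R P' P'')"
  proof -
    obtain x y z r where xyz: "(x, r) \<in> P" "(y, r) \<in> P'" "(z, r) \<in> P''"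
      by (rule triple_common_denominator[OF P P''])
    show ?thesis
      using mem_fracD(1-3)[OF P(1) xyz(1)] mem_fracD(1-3)[OF P(2) xyz(2)] mem_fracD(1-3)[OF P'' xyz(3)]
      by (simp add: frac_add_eq[OF _ P'' _ xyz(3), of _ "x \<oplus> y"] add_mem[OF P xyz(1,2)]
          frac_add_eq[OF P(1) _ xyz(1), of _ "y \<oplus> z"] add_mem[OF P(2) P'' xyz(2,3)] a_assoc)
  qed
  show "frac_mult R (frac_mult R P P') P'' = frac_mult R P (frac_mult R P' P'')"
  proof -
    obtain y z w where yz: "(z, w) \<in> P''" "acts P' z y" by (rule composable[OF P(2) P''])
    note y = acts_closed[OF P(2) yz(2)]
    obtain t x where t: "t \<in> carrier R" "t \<noteq> \<zero>" "acts P (y \<otimes> t) x" using acts_exists[OF P(1), of y] y by blast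
    have zt: "(z \<otimes> t, w \<otimes> t) \<in> P''" using mem_frac_expand[OF P'' yz(1)] t by simp
    have yt: "acts P' (z \<otimes> t) (y \<otimes> t)" using acts_mult[OF P(2) yz(2)] t by simp
    have "acts (frac_mult R P P') (z \<otimes> t) x"
    proof (cases "z \<otimes> t = \<zero>")
      case True
      then have "y \<otimes> t = \<zero>" using acts_functional[OF P(2) yt, of \<zero>] by (simp add: acts_def)
      then have "x = \<zero>" using acts_functional[OF P(1) t(3), of \<zero>] by (simp add: acts_def)
      then show ?thesis using True by (simp add: acts_def)
    next
      case False
      then have "(y \<otimes> t, z \<otimes> t) \<in> P'" using yt by (simp add: acts_def)
      from mult_mem(2)[OF P this t(3)] show ?thesis by (simp add: acts_def)
    qed
    from frac_mult_eq[OF _ P'' zt this] show ?thesis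
      using frac_mult_eq[OF P(1) _ mult_mem(2)[OF P(2) P'' zt yt] t(3)] P P''
      by (simp add: fracs_mult_closed)
  qed
  show "frac_mult R (frac_add R P P') P'' = frac_add R (frac_mult R P P'') (frac_mult R P' P'')"
  proof -
    obtain s r where s: "(s, r) \<in> P''" by (rule fracs_cases[OF P''])
    note sr = mem_fracD[OF P'' s]
    obtain t x where t: "t \<in> carrier R" "t \<noteq> \<zero>" "acts P (s \<otimes> t) x" by (rule acts_exists[OF P(1) sr(1)])
    obtain t' y where t': "t' \<in> carrier R" "t' \<noteq> \<zero>" "acts P' (s \<otimes> t \<otimes> t') y"
      using acts_exists[OF P(2), of "s \<otimes> t"] sr t by blast
    let ?s = "s \<otimes> t \<otimes> t'" and ?r = "r \<otimes> t \<otimes> t'"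
    have sr': "(?s, ?r) \<in> P''" using mem_frac_expand[OF P''] s t t' by blast
    have xt: "acts P ?s (x \<otimes> t')" using acts_mult[OF P(1) t(3)] t' by simp
    have "acts (frac_add R P P') ?s (x \<otimes> t' \<oplus> y)"
    proof (cases "?s = \<zero>")
      case True
      then have "x \<otimes> t' = \<zero>" "y = \<zero>"
        using acts_functional[OF P(1) xt, of \<zero>] acts_functional[OF P(2) t'(3), of \<zero>] by (simp_all add: acts_def)
      then show ?thesis using True by (simp add: acts_def)
    next
      case False
      then have "(x \<otimes> t', ?s) \<in> P" "(y, ?s) \<in> P'" using xt t' by (simp_all add: acts_def)
      from add_mem(2)[OF P this] show ?thesis by (simp add: acts_def)
    qed
    from frac_mult_eq[OF _ P'' sr' this] show ?thesis
      using frac_add_eq[OF _ _ mult_mem(2)[OF P(1) P'' sr' xt] mult_mem(2)[OF P(2) P'' sr' t'(3)]] P P''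
      by (simp add: fracs_mult_closed fracs_add_closed)
  qed
  show "frac_mult R P'' (frac_add R P P') = frac_add R (frac_mult R P'' P) (frac_mult R P'' P')"
  proof -
    obtain x y r where xy: "(x, r) \<in> P" "(y, r) \<in> P'" by (rule common_denominator[OF P])
    note xr = mem_fracD[OF P(1) xy(1)] and yr = mem_fracD[OF P(2) xy(2)]
    obtain t a where t: "t \<in> carrier R" "t \<noteq> \<zero>" "acts P'' (x \<otimes> t) a" by (rule acts_exists[OF P'' xr(1)])
    obtain t' b where t': "t' \<in> carrier R" "t' \<noteq> \<zero>" "acts P'' (y \<otimes> t \<otimes> t') b"
      using acts_exists[OF P'', of "y \<otimes> t"] yr t by blast
    let ?x = "x \<otimes> t \<otimes> t'" and ?y = "y \<otimes> t \<otimes> t'" and ?r = "r \<otimes> t \<otimes> t'"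
    have x: "(?x, ?r) \<in> P" using mem_frac_expand[OF P(1)] xy t t' by blast
    have y: "(?y, ?r) \<in> P'" using mem_frac_expand[OF P(2)] xy t t' by blast
    have a: "acts P'' ?x (a \<otimes> t')" using acts_mult[OF P'' t(3)] t' by simp
    have "acts P'' (?x \<oplus> ?y) (a \<otimes> t' \<oplus> b)" by (rule acts_add[OF P'' a t'(3)])
    from frac_mult_eq[OF P'' _ add_mem(2)[OF P x y] this] show ?thesis
      using frac_add_eq[OF _ _ mult_mem(2)[OF P'' P(1) x a] mult_mem(2)[OF P'' P(2) y t'(3)]] P P''
      by (simp add: fracs_mult_closed fracs_add_closed)
  qed
next
  fix P assume P: "P \<in> fracs"
  obtain x r where x: "(x, r) \<in> P" "x \<in> carrier R" "r \<in> carrier R" "r \<noteq> \<zero>" by (rule fracs_cases[OF P])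
  note xr = mem_fracD[OF P x(1)]
  show "frac_add R (frac \<zero> \<one>) P = P"
    using frac_add_eq[OF _ P zero_mem x(1)] x xr(4) by simp
  have "(\<ominus> x, r) \<in> frac (\<ominus> x) r" using x by (simp add: frac_self)
  from frac_add_eq[OF _ P this x(1)] have "frac_add R (frac (\<ominus> x) r) P = frac \<zero> r"
    using x by (simp add: frac_in_fracs l_neg)
  also have "\<dots> = frac \<zero> \<one>" using mem_fracD(4)[OF const_fracs(1) zero_mem] x by simp
  finally have "frac_add R (frac (\<ominus> x) r) P = frac \<zero> \<one>" .
  moreover have "frac (\<ominus> x) r \<in> fracs" by (rule frac_in_fracs[OF a_inv_closed[OF x(2)] x(3,4)])
  ultimately show "\<exists>P'\<in>fracs. frac_add R P' P = frac \<zero> \<one>" by (rule bexI)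
  show "frac_mult R (frac \<one> \<one>) P = P"
    using frac_mult_eq[OF _ P x(1) acts_one] x xr(4) by simp
  have "acts P r x" using x by (simp add: acts_def)
  moreover have "(r, r) \<in> frac \<one> \<one>" using acts_one[OF x(3)] x by (simp add: acts_def)
  ultimately show "frac_mult R P (frac \<one> \<one>) = P"
    using frac_mult_eq[OF P, of "frac \<one> \<one>"] xr(4) by simp
qed simp_all

lemma field_algebra_frac_field: "field_algebra Q"
proof (rule field_algebra.intro[OF ring_frac_field], standard, unfold frac_field_simps)
  fix P P' c d assume P: "P \<in> fracs"
  obtain x r where x: "(x, r) \<in> P" "x \<in> carrier R" "r \<in> carrier R" "r \<noteq> \<zero>" by (rule fracs_cases[OF P])
  note xr = mem_fracD[OF P x(1)] and cx = smult_mem[OF P x(1)]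
  show "frac_smult R c P \<in> fracs" by (rule fracs_smult_closed[OF P])
  show "frac_smult R (c + d) P = frac_add R (frac_smult R c P) (frac_smult R d P)"
    using frac_add_eq[OF cx(1) cx(1) cx(2) cx(2)] x by (simp add: frac_smult_eq[OF P x(1)] smult_l_distr)
  show "frac_smult R c (frac_smult R d P) = frac_smult R (c * d) P"
    using frac_smult_eq[OF cx(1) cx(2)] x by (simp add: frac_smult_eq[OF P x(1)] smult_smult)
  show "frac_smult R 1 P = P"
    unfolding frac_smult_eq[OF P x(1)] smult_one[OF x(2)] by (rule xr(4)[symmetric])
  assume P': "P' \<in> fracs"
  show "frac_smult R c (frac_add R P P') = frac_add R (frac_smult R c P) (frac_smult R c P')"
  proof -
    obtain x y r where xy: "(x, r) \<in> P" "(y, r) \<in> P'" by (rule common_denominator[OF P P'])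
    show ?thesis
      using mem_fracD(1-3)[OF P xy(1)] mem_fracD(1-3)[OF P' xy(2)]
      by (simp add: frac_smult_eq[OF add_mem[OF P P' xy]] smult_r_distr
         frac_add_eq[OF smult_mem(1)[OF P xy(1)] smult_mem(1)[OF P' xy(2)] smult_mem(2)[OF P xy(1)] smult_mem(2)[OF P' xy(2)]])
  qed
  obtain x y z where yz: "(y, z) \<in> P'" "acts P y x" by (rule composable[OF P P'])
  note xc = acts_closed[OF P yz(2)]
  have cx: "acts (frac_smult R c P) y (c \<odot> x)"
    using yz(2) smult_mem(2)[OF P] by (auto simp: acts_def)
  show "frac_mult R (frac_smult R c P) P' = frac_smult R c (frac_mult R P P')"
    using frac_mult_eq[OF fracs_smult_closed[OF P] P' yz(1) cx] frac_smult_eq[OF mult_mem[OF P P' yz]] by simp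
  have "acts P (c \<odot> y) (c \<odot> x)"
    using acts_mult[OF P yz(2), of "c \<odot> \<one>"] xc by (simp add: smult_mult_right)
  from frac_mult_eq[OF P fracs_smult_closed[OF P'] smult_mem(2)[OF P' yz(1)] this]
  show "frac_mult R P (frac_smult R c P') = frac_smult R c (frac_mult R P P')"
    using frac_smult_eq[OF mult_mem[OF P P' yz]] by simp
qed

lemma frac_nonzero_unit:
  assumes P: "P \<in> carrier Q" and nz: "P \<noteq> \<zero>\<^bsub>Q\<^esub>"
  shows "P \<in> Units Q"
proof -
  interpret Q: field_algebra Q by (rule field_algebra_frac_field)
  have P: "P \<in> fracs" using assms by (simp add: frac_field_simps)
  obtain a b where ab: "(a, b) \<in> P" "a \<in> carrier R" "b \<in> carrier R" "b \<noteq> \<zero>" by (rule fracs_cases[OF P])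
  have "a \<noteq> \<zero>"
  proof
    assume "a = \<zero>"
    then have "P = frac \<zero> \<one>" using frac_eqI[OF P ab(1) const_fracs(1)] zero_mem ab by simp
    then show False using nz by (simp add: frac_field_simps)
  qed
  then have ba: "(b, a) \<in> frac b a" "frac b a \<in> fracs" using ab by (simp_all add: frac_self frac_in_fracs)
  have one: "frac r r = frac \<one> \<one>" if "r \<in> carrier R" "r \<noteq> \<zero>" for r
    using mem_fracD(4)[OF const_fracs(2), of r r] acts_one[of r] that by (simp add: acts_def)
  have "frac_mult R P (frac b a) = frac a a"
    using frac_mult_eq[OF P ba(2) ba(1)] ab by (simp add: acts_def)
  moreover have "frac_mult R (frac b a) P = frac b b"
    using frac_mult_eq[OF ba(2) P ab(1)] ba by (simp add: acts_def)
  ultimately show ?thesis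
    unfolding Units_def frac_field_simps using P ba ab one \<open>a \<noteq> \<zero>\<close> by auto
qed

lemma frac_embed_hom: "frac_embed R \<in> alg_hom R Q"
proof -
  have emb: "(x, \<one>) \<in> frac x \<one>" "frac x \<one> \<in> fracs" if "x \<in> carrier R" for x
    using that one_not_zero by (simp_all add: frac_self frac_in_fracs)
  have mult: "frac_mult R (frac x \<one>) (frac y \<one>) = frac (x \<otimes> y) \<one>"
    if x: "x \<in> carrier R" and y: "y \<in> carrier R" for x y
  proof (rule frac_mult_eq[OF emb(2)[OF x] emb(2)[OF y] emb(1)[OF y]])
    show "acts (frac x \<one>) y (x \<otimes> y)"
      using acts_mult[OF emb(2)[OF x], of \<one> x y] emb(1)[OF x] x y by (simp add: acts_def)
  qed
  show ?thesis
    unfolding frac_embed_def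
    by (intro alg_homI, unfold frac_field_simps)
       (simp_all add: emb mult frac_add_eq[OF _ _ emb(1) emb(1)] frac_smult_eq[OF _ emb(1)])
qed

lemma frac_embed_inj: "inj_on (frac_embed R) (carrier R)"
proof (rule inj_onI)
  fix x y assume x: "x \<in> carrier R" and y: "y \<in> carrier R" and eq: "frac_embed R x = frac_embed R y"
  have "(x, \<one>) \<in> frac y \<one>"
    using frac_self[OF x one_closed one_not_zero] eq unfolding frac_embed_def by (rule back_subst)
  moreover have "(y, \<one>) \<in> frac y \<one>" using frac_self[OF y] one_not_zero by simp
  ultimately show "x = y" using mem_frac_functional frac_in_fracs[OF y] one_not_zero by blast
qed

end


subsection \<open>Extension of homomorphisms to fractions\<close>

text \<open>
  The extension sends \<open>a b\<^sup>-\<^sup>1\<close> to \<open>h a (h b)\<^sup>-\<^sup>1\<close>; injectivity of \<open>h\<close> makes \<open>h b\<close> a unit. It is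
  characterized by \<open>\<mu> P (h y) = h x\<close> whenever \<open>P\<close> sends \<open>y\<close> to \<open>x\<close>, which reduces all claims to
  statements about partial maps.
\<close>

lemma (in ore_algebra) extend_to_fractions:
  assumes D: "field_algebra D" and units: "\<And>x. \<lbrakk>x \<in> carrier D; x \<noteq> \<zero>\<^bsub>D\<^esub>\<rbrakk> \<Longrightarrow> x \<in> Units D"
    and h: "h \<in> alg_hom R D" and inj: "inj_on h (carrier R)"
  obtains \<mu> where "\<mu> \<in> alg_hom (frac_field R) D" "\<And>x. x \<in> carrier R \<Longrightarrow> \<mu> (frac_embed R x) = h x"
proof -
  interpret D: field_algebra D by fact
  interpret h: field_algebra_hom R D h by (intro field_algebra_homI field_algebra_axioms D h)
  have unit: "h b \<in> Units D" if "b \<in> carrier R" "b \<noteq> \<zero>" for b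
    using units[of "h b"] inj_onD[OF inj, of b \<zero>] that h.hom_zero by auto
  define \<mu> where "\<mu> P = (case (SOME p. p \<in> P) of (a, b) \<Rightarrow> h a \<otimes>\<^bsub>D\<^esub> inv\<^bsub>D\<^esub> h b)" for P
  have \<mu>: "\<mu> P \<in> carrier D \<and> \<mu> P \<otimes>\<^bsub>D\<^esub> h y = h x" if P: "P \<in> fracs" and yx: "acts P y x" for P x y
  proof -
    obtain p where "p \<in> P" using fracs_cases[OF P] by blast
    then have "(SOME p. p \<in> P) \<in> P" by (rule someI)
    then obtain a b where ab: "(a, b) \<in> P" "\<mu> P = h a \<otimes>\<^bsub>D\<^esub> inv\<^bsub>D\<^esub> h b"
      by (cases "SOME p. p \<in> P") (auto simp: \<mu>_def)
    note ab' = mem_fracD[OF P ab(1)] and xy = acts_closed[OF P yx] acts_closed[OF P yx]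
    have hb: "h b \<in> Units D" using unit ab' by simp
    have "\<mu> P \<otimes>\<^bsub>D\<^esub> h y = h x"
    proof (cases "y = \<zero>")
      case True
      then have "x = \<zero>" using acts_functional[OF P yx, of \<zero>] by (simp add: acts_def)
      then show ?thesis using True ab ab' hb by simp
    next
      case False
      obtain t u where tu: "t \<in> carrier R" "u \<in> carrier R" "y \<otimes> t = b \<otimes> u" "y \<otimes> t \<noteq> \<zero>"
        by (rule right_oreE[OF xy(1)[THEN conjunct1] ab'(2) False ab'(3)])
      have t: "t \<noteq> \<zero>" using tu(4) xy by (intro nonzero_factor[of y t]) simp_all
      have "acts P b a" using ab(1) by (simp add: acts_def)
      from acts_functional[OF P acts_mult[OF P yx tu(1)]] acts_mult[OF P this tu(2)]
      have "x \<otimes> t = a \<otimes> u" by (simp add: tu(3))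
      then have eq: "h x \<otimes>\<^bsub>D\<^esub> h t = h a \<otimes>\<^bsub>D\<^esub> h u" "h y \<otimes>\<^bsub>D\<^esub> h t = h b \<otimes>\<^bsub>D\<^esub> h u"
        using tu xy ab' by (simp_all flip: h.hom_mult)
      have inv: "inv\<^bsub>D\<^esub> h b \<otimes>\<^bsub>D\<^esub> (h b \<otimes>\<^bsub>D\<^esub> h u) = h u"
        using hb tu(2) ab'(2) by (simp add: D.m_assoc [symmetric])
      have "\<mu> P \<otimes>\<^bsub>D\<^esub> h y \<otimes>\<^bsub>D\<^esub> h t = h a \<otimes>\<^bsub>D\<^esub> (inv\<^bsub>D\<^esub> h b \<otimes>\<^bsub>D\<^esub> (h y \<otimes>\<^bsub>D\<^esub> h t))"
        using ab(2) ab'(1) hb xy tu(1) by (simp add: D.m_assoc)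
      also have "\<dots> = h x \<otimes>\<^bsub>D\<^esub> h t" by (simp only: eq inv)
      finally have "\<mu> P \<otimes>\<^bsub>D\<^esub> h y \<otimes>\<^bsub>D\<^esub> h t = h x \<otimes>\<^bsub>D\<^esub> h t" .
      moreover have "\<mu> P \<otimes>\<^bsub>D\<^esub> h y \<in> carrier D" using ab(2) ab'(1) hb xy by simp
      ultimately show ?thesis
        using D.right_cancel_unit[OF _ unit[OF tu(1) t]] xy by simp
    qed
    then show ?thesis using ab(2) ab'(1) hb by simp
  qed
  have eqI: "\<mu> P = z" if P: "P \<in> fracs" and "acts P y x" "y \<noteq> \<zero>" "z \<in> carrier D" "z \<otimes>\<^bsub>D\<^esub> h y = h x" for P x y z
    using \<mu>[OF P that(2)] that(3-5) acts_closed[OF P that(2)] D.right_cancel_unit[OF _ unit[of y], of "\<mu> P" z]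
    by simp
  have "\<mu> \<in> alg_hom Q D"
  proof (rule alg_homI, unfold frac_field_simps)
    show "\<mu> (frac \<one> \<one>) = \<one>\<^bsub>D\<^esub>"
      by (rule eqI[OF const_fracs(2) acts_one[OF one_closed]]) (simp_all add: one_not_zero)
    fix P P' c assume P: "P \<in> fracs"
    obtain a b where ab: "(a, b) \<in> P" "a \<in> carrier R" "b \<in> carrier R" "b \<noteq> \<zero>" by (rule fracs_cases[OF P])
    then have ab': "acts P b a" by (simp add: acts_def)
    show \<mu>P: "\<mu> P \<in> carrier D" using \<mu>[OF P ab'] by simp
    have "acts (frac_smult R c P) b (c \<odot> a)" using smult_mem(2)[OF P ab(1)] by (simp add: acts_def)
    then show "\<mu> (frac_smult R c P) = c \<odot>\<^bsub>D\<^esub> \<mu> P"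
      by (rule eqI[OF fracs_smult_closed[OF P]]) (use \<mu>[OF P ab'] ab in \<open>simp_all add: D.smult_mult_left\<close>)
    assume P': "P' \<in> fracs"
    have \<mu>P': "\<mu> P' \<in> carrier D"
      using \<mu>[OF P'] fracs_cases[OF P'] by (metis acts_def)
    show "\<mu> (frac_add R P P') = \<mu> P \<oplus>\<^bsub>D\<^esub> \<mu> P'"
    proof -
      obtain x y r where xy: "(x, r) \<in> P" "(y, r) \<in> P'" by (rule common_denominator[OF P P'])
      note xr = mem_fracD(1-3)[OF P xy(1)] and yr = mem_fracD(1-3)[OF P' xy(2)]
      have "acts (frac_add R P P') r (x \<oplus> y)" "acts P r x" "acts P' r y"
        using add_mem(2)[OF P P' xy] xy by (simp_all add: acts_def)
      moreover from this have "(\<mu> P \<oplus>\<^bsub>D\<^esub> \<mu> P') \<otimes>\<^bsub>D\<^esub> h r = h (x \<oplus> y)"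
        using \<mu>P \<mu>P' xr yr \<mu>[OF P, of r x] \<mu>[OF P', of r y] by (simp add: D.l_distr)
      ultimately show ?thesis
        using \<mu>P \<mu>P' xr by (intro eqI[OF fracs_add_closed[OF P P'], of r "x \<oplus> y"]) simp_all
    qed
    show "\<mu> (frac_mult R P P') = \<mu> P \<otimes>\<^bsub>D\<^esub> \<mu> P'"
    proof -
      obtain x y z where yz: "(y, z) \<in> P'" "acts P y x" by (rule composable[OF P P'])
      note zc = mem_fracD(1-3)[OF P' yz(1)]
      have "acts (frac_mult R P P') z x" "acts P' z y"
        using mult_mem(2)[OF P P' yz] yz by (simp_all add: acts_def)
      moreover from this have "(\<mu> P \<otimes>\<^bsub>D\<^esub> \<mu> P') \<otimes>\<^bsub>D\<^esub> h z = h x"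
        using \<mu>P \<mu>P' zc \<mu>[OF P yz(2)] \<mu>[OF P', of z y] by (simp add: D.m_assoc)
      ultimately show ?thesis
        using \<mu>P \<mu>P' zc by (intro eqI[OF fracs_mult_closed[OF P P'], of z x]) simp_all
    qed
  qed
  moreover have "\<mu> (frac_embed R x) = h x" if x: "x \<in> carrier R" for x
    unfolding frac_embed_def
    by (rule eqI[of _ \<one> x]) (use x one_not_zero in \<open>simp_all add: frac_in_fracs frac_self acts_def\<close>)
  ultimately show thesis by (rule that)
qed

section \<open>Monomials in elements that commute up to scalars\<close>

definition inverse_pair :: "('a, 'm) monoid_scheme \<Rightarrow> 'a \<Rightarrow> 'a \<Rightarrow> bool" where
  "inverse_pair A x y \<longleftrightarrow> x \<in> carrier A \<and> y \<in> carrier A \<and> x \<otimes>\<^bsub>A\<^esub> y = \<one>\<^bsub>A\<^esub> \<and> y \<otimes>\<^bsub>A\<^esub> x = \<one>\<^bsub>A\<^esub>"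

text \<open>
  The inverse is an explicit argument. In the quotient of the double, \<open>x\<close> and \<open>y\<close> are instead the
  two generators \<open>e\<close> and \<open>f\<close>, which are not inverse to each other.
  
  The simplification rule \<open>pow_nat\<close> turns \<open>x [^] nat n\<close> into an integer power, so it is removed where
  this definition is unfolded.
\<close>

definition zpow :: "('a, 'm) monoid_scheme \<Rightarrow> 'a \<Rightarrow> 'a \<Rightarrow> int \<Rightarrow> 'a" where
  "zpow A x y n = (if 0 \<le> n then x [^]\<^bsub>A\<^esub> nat n else y [^]\<^bsub>A\<^esub> nat (- n))"

lemma inverse_pair_sym: "inverse_pair A x y \<Longrightarrow> inverse_pair A y x"
  by (simp add: inverse_pair_def)

context monoid
begin

lemma inverse_pair_unit: "inverse_pair G x y \<Longrightarrow> x \<in> Units G"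
  unfolding inverse_pair_def Units_def by auto

lemma inverse_pair_inv: "inverse_pair G x y \<Longrightarrow> inv x = y"
  by (metis inverse_pair_def inverse_pair_unit Units_inv_closed Units_l_inv inv_unique)

lemma unit_inverse_pair: "x \<in> Units G \<Longrightarrow> inverse_pair G x (inv x)"
  by (simp add: inverse_pair_def Units_closed)

lemma inverse_pair_unique:
  "\<lbrakk>inverse_pair G x y; inverse_pair G x y'\<rbrakk> \<Longrightarrow> y = y'"
  by (metis inverse_pair_inv)

lemma inverse_pair_mult:
  assumes "inverse_pair G x x'" "inverse_pair G y y'"
  shows "inverse_pair G (x \<otimes> y) (y' \<otimes> x')"
proof -
  have xy: "x \<in> carrier G" "x' \<in> carrier G" "y \<in> carrier G" "y' \<in> carrier G"
    using assms by (simp_all add: inverse_pair_def)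
  have "x \<otimes> y \<otimes> (y' \<otimes> x') = x \<otimes> (y \<otimes> y') \<otimes> x'" "y' \<otimes> x' \<otimes> (x \<otimes> y) = y' \<otimes> (x' \<otimes> x) \<otimes> y"
    using xy by (simp_all only: m_assoc m_closed)
  then show ?thesis using assms by (simp add: inverse_pair_def)
qed

lemma zpow_closed [simp]: "\<lbrakk>x \<in> carrier G; y \<in> carrier G\<rbrakk> \<Longrightarrow> zpow G x y n \<in> carrier G"
  by (simp add: zpow_def del: pow_nat)

lemma zpow_0 [simp]: "zpow G x y 0 = \<one>"
  by (simp add: zpow_def)

lemma zpow_add_one:
  assumes "inverse_pair G x y"
  shows "zpow G x y n \<otimes> x = zpow G x y (n + 1)"
proof (cases "0 \<le> n")
  case True
  then have "nat (n + 1) = Suc (nat n)" by simp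
  then show ?thesis using True by (simp add: zpow_def del: pow_nat)
next
  case False
  then obtain m where "n = - int (Suc m)" by (metis int_cases of_nat_0_le_iff)
  then have n: "nat (- n) = Suc m" "nat (- (n + 1)) = m" "0 \<le> n + 1 \<longleftrightarrow> m = 0" by simp_all
  have "zpow G x y n = y [^] Suc m" using False by (simp only: zpow_def n if_False)
  moreover have "zpow G x y (n + 1) = y [^] m"
  proof (cases "m = 0")
    case True
    then have "nat (n + 1) = 0" using \<open>n = - int (Suc m)\<close> by simp
    then show ?thesis using True by (simp only: zpow_def n if_True nat_pow_0 simp_thms)
  next
    case False
    then show ?thesis by (simp only: zpow_def n if_False)
  qed
  ultimately show ?thesis using assms by (simp add: inverse_pair_def m_assoc)
qed

lemma zpow_diff_one:
  assumes "inverse_pair G x y"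
  shows "zpow G x y n \<otimes> y = zpow G x y (n - 1)"
proof -
  have "zpow G x y n = zpow G x y (n - 1) \<otimes> x" using zpow_add_one[OF assms, of "n - 1"] by simp
  then show ?thesis using assms by (simp add: inverse_pair_def m_assoc)
qed

end

lemma (in field_algebra_hom) hom_nat_pow: "x \<in> carrier A \<Longrightarrow> h (x [^]\<^bsub>A\<^esub> (n::nat)) = h x [^]\<^bsub>B\<^esub> n"
  by (induction n) simp_all

lemma (in field_algebra_hom) hom_zpow:
  "\<lbrakk>x \<in> carrier A; y \<in> carrier A\<rbrakk> \<Longrightarrow> h (zpow A x y n) = zpow B (h x) (h y) n"
  by (simp add: zpow_def hom_nat_pow del: pow_nat)

lemma (in field_algebra_hom) hom_inverse_pair: "inverse_pair A x y \<Longrightarrow> inverse_pair B (h x) (h y)"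
  unfolding inverse_pair_def by (simp flip: hom_mult)

definition qcomm :: "('k, 'a) module \<Rightarrow> 'k \<Rightarrow> 'a \<Rightarrow> 'a \<Rightarrow> bool" where
  "qcomm A c x y \<longleftrightarrow> x \<otimes>\<^bsub>A\<^esub> y = c \<odot>\<^bsub>A\<^esub> (y \<otimes>\<^bsub>A\<^esub> x)"

context field_algebra
begin

lemma qcomm_refl: "x \<in> carrier A \<Longrightarrow> qcomm A 1 x x"
  by (simp add: qcomm_def smult_one)

lemma qcomm_swap:
  assumes "qcomm A c x y" "c \<noteq> 0" "x \<in> carrier A" "y \<in> carrier A"
  shows "qcomm A (inverse c) y x"
  using smult_smult_inverse[OF _ _ assms(2), of "x \<otimes> y" "y \<otimes> x"] assms by (simp add: qcomm_def)

lemma qcomm_mult_left: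
  assumes "qcomm A c x z" "qcomm A d y z" "x \<in> carrier A" "y \<in> carrier A" "z \<in> carrier A"
  shows "qcomm A (c * d) (x \<otimes> y) z"
proof -
  have "x \<otimes> y \<otimes> z = x \<otimes> (d \<odot> (z \<otimes> y))"
    using assms(2-5) by (simp add: qcomm_def m_assoc)
  also have "\<dots> = d \<odot> (x \<otimes> z \<otimes> y)"
    using assms(3-5) by (simp add: m_assoc smult_mult_right)
  also have "\<dots> = d \<odot> ((c \<odot> (z \<otimes> x)) \<otimes> y)"
    using assms(1) by (simp only: qcomm_def)
  also have "\<dots> = (c * d) \<odot> (z \<otimes> (x \<otimes> y))"
    using assms(3-5) by (simp add: m_assoc smult_simps mult.commute)
  finally show ?thesis by (simp add: qcomm_def)
qed

lemma qcomm_nat_pow: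
  assumes "qcomm A c x z" "x \<in> carrier A" "z \<in> carrier A"
  shows "qcomm A (c ^ n) (x [^] (n::nat)) z"
proof (induction n)
  case 0
  show ?case using assms by (simp add: qcomm_def smult_one)
next
  case (Suc n)
  have "qcomm A (c ^ n * c) (x [^] n \<otimes> x) z" using Suc assms by (intro qcomm_mult_left) simp_all
  then show ?case by (simp add: mult.commute)
qed

lemma qcomm_inverse:
  assumes c: "qcomm A c x z" "c \<noteq> 0" and x: "inverse_pair A x y" and z: "z \<in> carrier A"
  shows "qcomm A (inverse c) y z"
proof -
  have xy: "x \<in> carrier A" "y \<in> carrier A" "x \<otimes> y = \<one>" "y \<otimes> x = \<one>"
    using x by (simp_all add: inverse_pair_def)
  have zx: "z \<otimes> x = inverse c \<odot> (x \<otimes> z)"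
    using qcomm_swap[OF c] xy z by (simp add: qcomm_def)
  have "y \<otimes> z = y \<otimes> (z \<otimes> x) \<otimes> y" using xy z by (simp add: m_assoc)
  also have "\<dots> = inverse c \<odot> ((y \<otimes> x) \<otimes> z \<otimes> y)"
    unfolding zx using xy(1,2) z by (simp add: m_assoc smult_simps)
  also have "\<dots> = inverse c \<odot> (z \<otimes> y)" using xy z by simp
  finally show ?thesis by (simp add: qcomm_def)
qed

lemma qcomm_zpow:
  assumes "qcomm A c x z" "c \<noteq> 0" "inverse_pair A x y" "z \<in> carrier A"
  shows "qcomm A (c powi n) (zpow A x y n) z"
proof -
  have xy: "x \<in> carrier A" "y \<in> carrier A" using assms(3) by (simp_all add: inverse_pair_def)
  show ?thesis
    using qcomm_nat_pow[OF assms(1) xy(1) assms(4), of "nat n"]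
      qcomm_nat_pow[OF qcomm_inverse[OF assms] xy(2) assms(4), of "nat (- n)"]
    by (simp add: zpow_def power_int_def del: pow_nat)
qed

lemma zpow_add_one_left:
  assumes "inverse_pair A x y"
  shows "x \<otimes> zpow A x y n = zpow A x y (n + 1)"
proof -
  have xy: "x \<in> carrier A" "y \<in> carrier A" using assms by (simp_all add: inverse_pair_def)
  have "qcomm A (1 powi n) (zpow A x y n) x"
    using assms xy by (intro qcomm_zpow) (simp_all add: qcomm_refl)
  then show ?thesis using zpow_add_one[OF assms, of n] xy by (simp add: qcomm_def smult_one)
qed

end

lemma (in field_algebra_hom) hom_qcomm:
  "\<lbrakk>qcomm A c x y; x \<in> carrier A; y \<in> carrier A\<rbrakk> \<Longrightarrow> qcomm B c (h x) (h y)"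
  unfolding qcomm_def by (metis hom_mult hom_smult A.m_closed)

context field_algebra
begin

text \<open>
  The monomials of a quantum torus in normal order. Each argument is an element together with its
  inverse, except that the first pair is arbitrary.
\<close>

definition monomial :: "'a \<times> 'a \<Rightarrow> 'a \<times> 'a \<Rightarrow> 'a \<times> 'a \<Rightarrow> int \<times> int \<times> int \<Rightarrow> 'a" where
  "monomial xx yy zz = (\<lambda>(a, b, c).
     zpow A (fst xx) (snd xx) a \<otimes> zpow A (fst yy) (snd yy) b \<otimes> zpow A (fst zz) (snd zz) c)"

lemma lincombs_smult_basis:
  "(\<And>j. b j \<in> carrier A) \<Longrightarrow> c \<odot> b k \<in> range (lincomb A b)"
  by (rule range_eqI[of _ _ "single k c"]) (simp add: lincomb_single)

lemma lincombs_basis: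
  assumes "\<And>j. b j \<in> carrier A" shows "b k \<in> range (lincomb A b)"
  using lincombs_smult_basis[of b 1 k] assms by (simp add: smult_one)

lemma monomial_span_right:
  assumes x: "x \<in> carrier A" "x' \<in> carrier A" and y: "inverse_pair A y y'" and z: "inverse_pair A z z'"
    and w: "w \<in> {z, z'}"
    and u: "u \<in> range (lincomb A (monomial (x, x') (y, y') (z, z')))"
  shows "u \<otimes> w \<in> range (lincomb A (monomial (x, x') (y, y') (z, z')))"
proof -
  let ?b = "monomial (x, x') (y, y') (z, z')"
  have yz: "y \<in> carrier A" "y' \<in> carrier A" "z \<in> carrier A" "z' \<in> carrier A"
    using y z by (simp_all add: inverse_pair_def)
  have b: "?b j \<in> carrier A" for j
    using x yz by (cases j) (simp add: monomial_def)
  have "?b j \<otimes> z \<in> range (lincomb A ?b)" for j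
  proof (cases j)
    case (fields a b c)
    have "?b j \<otimes> z = ?b (a, b, c + 1)"
      using x yz by (simp add: fields monomial_def m_assoc zpow_add_one[OF z])
    then show ?thesis using lincombs_basis[of ?b, OF b] by simp
  qed
  moreover have "?b j \<otimes> z' \<in> range (lincomb A ?b)" for j
  proof (cases j)
    case (fields a b c)
    have "?b j \<otimes> z' = ?b (a, b, c - 1)"
      using x yz by (simp add: fields monomial_def m_assoc zpow_diff_one[OF z])
    then show ?thesis using lincombs_basis[of ?b, OF b] by simp
  qed
  ultimately show ?thesis
    using w yz by (intro lincombs_closed_under_mult[OF b _ _ u]) auto
qed

lemma monomial_span_middle:
  assumes x: "x \<in> carrier A" "x' \<in> carrier A" and y: "inverse_pair A y y'" and z: "inverse_pair A z z'"
    and zy: "qcomm A c z y" "c \<noteq> 0" and w: "w \<in> {y, y'}"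
    and u: "u \<in> range (lincomb A (monomial (x, x') (y, y') (z, z')))"
  shows "u \<otimes> w \<in> range (lincomb A (monomial (x, x') (y, y') (z, z')))"
proof -
  let ?b = "monomial (x, x') (y, y') (z, z')"
  have yz: "y \<in> carrier A" "y' \<in> carrier A" "z \<in> carrier A" "z' \<in> carrier A"
    using y z by (simp_all add: inverse_pair_def)
  have b: "?b j \<in> carrier A" for j
    using x yz by (cases j) (simp add: monomial_def)
  have yz_comm: "qcomm A (inverse (inverse (inverse c))) z y'"
    using qcomm_inverse[OF qcomm_swap[OF zy yz(3,1)] _ y yz(3)] zy(2) yz
    by (intro qcomm_swap) simp_all
  have "?b j \<otimes> y \<in> range (lincomb A ?b)" for j
  proof (cases j)
    case (fields a b n)
    have "?b j \<otimes> y = (c powi n) \<odot> ?b (a, b + 1, n)"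
      using x yz qcomm_zpow[OF zy z yz(1), of n]
      by (simp add: fields monomial_def m_assoc qcomm_def smult_mult_right)
         (simp add: m_assoc [symmetric] zpow_add_one[OF y])
    then show ?thesis using lincombs_smult_basis[of ?b, OF b] by simp
  qed
  moreover have "?b j \<otimes> y' \<in> range (lincomb A ?b)" for j
  proof (cases j)
    case (fields a b n)
    have "?b j \<otimes> y' = (inverse c powi n) \<odot> ?b (a, b - 1, n)"
      using x yz qcomm_zpow[OF yz_comm _ z yz(2), of n] zy(2)
      by (simp add: fields monomial_def m_assoc qcomm_def smult_mult_right)
         (simp add: m_assoc [symmetric] zpow_diff_one[OF y])
    then show ?thesis using lincombs_smult_basis[of ?b, OF b] by simp
  qed
  ultimately show ?thesis
    using w yz by (intro lincombs_closed_under_mult[OF b _ _ u]) auto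
qed

text \<open>
  Moving a factor \<open>w\<close> from the right end of a monomial past the powers of \<open>z\<close> and \<open>y\<close>.
\<close>

lemma monomial_mult_left_factor:
  assumes x: "x \<in> carrier A" "x' \<in> carrier A" and y: "inverse_pair A y y'" and z: "inverse_pair A z z'"
    and w: "w \<in> carrier A" and yw: "qcomm A d y w" "d \<noteq> 0" and zw: "qcomm A e z w" "e \<noteq> 0"
  shows "monomial (x, x') (y, y') (z, z') (a, b, c) \<otimes> w =
    (d powi b * e powi c) \<odot> (zpow A x x' a \<otimes> w \<otimes> zpow A y y' b \<otimes> zpow A z z' c)"
proof -
  have yz: "y \<in> carrier A" "y' \<in> carrier A" "z \<in> carrier A" "z' \<in> carrier A"
    using y z by (simp_all add: inverse_pair_def)
  have "qcomm A (d powi b * e powi c) (zpow A y y' b \<otimes> zpow A z z' c) w"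
    using yz w by (intro qcomm_mult_left qcomm_zpow yw zw y z) simp_all
  then show ?thesis
    using x yz w by (simp add: monomial_def m_assoc qcomm_def smult_mult_right)
qed

lemma monomial_span_left:
  assumes x: "inverse_pair A x x'" and y: "inverse_pair A y y'" and z: "inverse_pair A z z'"
    and yx: "qcomm A d y x" "d \<noteq> 0" and zx: "qcomm A e z x" "e \<noteq> 0" and w: "w \<in> {x, x'}"
    and u: "u \<in> range (lincomb A (monomial (x, x') (y, y') (z, z')))"
  shows "u \<otimes> w \<in> range (lincomb A (monomial (x, x') (y, y') (z, z')))"
proof -
  let ?b = "monomial (x, x') (y, y') (z, z')"
  have xyz: "x \<in> carrier A" "x' \<in> carrier A" "y \<in> carrier A" "y' \<in> carrier A" "z \<in> carrier A" "z' \<in> carrier A"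
    using x y z by (simp_all add: inverse_pair_def)
  have b: "?b j \<in> carrier A" for j
    using xyz by (cases j) (simp add: monomial_def)
  have yx': "qcomm A (inverse (inverse (inverse d))) y x'"
    using qcomm_inverse[OF qcomm_swap[OF yx xyz(3,1)] _ x xyz(3)] yx(2) xyz by (intro qcomm_swap) simp_all
  have zx': "qcomm A (inverse (inverse (inverse e))) z x'"
    using qcomm_inverse[OF qcomm_swap[OF zx xyz(5,1)] _ x xyz(5)] zx(2) xyz by (intro qcomm_swap) simp_all
  have "?b j \<otimes> x \<in> range (lincomb A ?b)" for j
  proof (cases j)
    case (fields a b n)
    have "?b j \<otimes> x = (d powi b * e powi n) \<odot> ?b (a + 1, b, n)"
      unfolding fields monomial_mult_left_factor[OF xyz(1,2) y z xyz(1) yx zx]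
      by (simp add: monomial_def zpow_add_one[OF x])
    then show ?thesis using lincombs_smult_basis[of ?b, OF b] by simp
  qed
  moreover have "?b j \<otimes> x' \<in> range (lincomb A ?b)" for j
  proof (cases j)
    case (fields a b n)
    have "?b j \<otimes> x' = (inverse d powi b * inverse e powi n) \<odot> ?b (a - 1, b, n)"
      using monomial_mult_left_factor[OF xyz(1,2) y z xyz(2) yx' _ zx', of a b n] yx(2) zx(2)
      by (simp add: fields monomial_def zpow_diff_one[OF x])
    then show ?thesis using lincombs_smult_basis[of ?b, OF b] by simp
  qed
  ultimately show ?thesis
    using w xyz by (intro lincombs_closed_under_mult[OF b _ _ u]) auto
qed

end

lemma (in field_algebra_hom) hom_monomial:
  assumes "x \<in> carrier A" "x' \<in> carrier A" "y \<in> carrier A" "y' \<in> carrier A" "z \<in> carrier A" "z' \<in> carrier A"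
  shows "h (A.monomial (x, x') (y, y') (z, z') j) = B.monomial (h x, h x') (h y, h y') (h z, h z') j"
  using assms by (cases j) (simp add: A.monomial_def B.monomial_def hom_zpow)

text \<open>
  A spanning family whose images are linearly independent is a basis, and the homomorphism is
  injective. Independence is needed in the target only, which is a concrete algebra in both
  applications.
\<close>

lemma (in field_algebra_hom) inj_on_if_spanning_independent:
  assumes b: "\<And>j. b j \<in> carrier A" and span: "carrier A \<subseteq> range (lincomb A b)"
    and indep: "\<And>p. lincomb B (\<lambda>j. h (b j)) p = \<zero>\<^bsub>B\<^esub> \<Longrightarrow> p = 0"
  shows "inj_on h (carrier A)"
proof (rule inj_onI_zero)
  fix x assume "x \<in> carrier A" and h: "h x = \<zero>\<^bsub>B\<^esub>"
  then obtain p where p: "x = lincomb A b p" using span by blast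
  then have "p = 0" using h indep[of p] by (simp add: hom_lincomb[OF b])
  then show "x = \<zero>\<^bsub>A\<^esub>" using p by simp
qed


section \<open>Quantum tori\<close>

lemma free_algebra_closed:
  fixes p r :: "('g, 'k::field) ncpoly"
  shows "\<lbrakk>p \<in> carrier (free_algebra G); r \<in> carrier (free_algebra G)\<rbrakk> \<Longrightarrow> p * r \<in> carrier (free_algebra G)"
    and "\<lbrakk>p \<in> carrier (free_algebra G); r \<in> carrier (free_algebra G)\<rbrakk> \<Longrightarrow> p - r \<in> carrier (free_algebra G)"
    and "\<lbrakk>p \<in> carrier (free_algebra G); r \<in> carrier (free_algebra G)\<rbrakk> \<Longrightarrow> p + r \<in> carrier (free_algebra G)"
    and "p \<in> carrier (free_algebra G) \<Longrightarrow> scalar c * p \<in> carrier (free_algebra G)"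
    and "1 \<in> carrier (free_algebra G :: ('k, ('g, 'k) ncpoly) module)"
proof -
  interpret field_algebra "free_algebra G :: ('k, ('g, 'k) ncpoly) module"
    by (rule field_algebra_free_algebra)
  show "1 \<in> carrier (free_algebra G :: ('k, ('g, 'k) ncpoly) module)" using one_closed by simp
  assume p: "p \<in> carrier (free_algebra G)"
  show "scalar c * p \<in> carrier (free_algebra G)" using smult_closed[OF p] by simp
  assume r: "r \<in> carrier (free_algebra G)"
  show "p * r \<in> carrier (free_algebra G)" "p + r \<in> carrier (free_algebra G)"
    using m_closed[OF p r] a_closed[OF p r] by simp_all
  show "p - r \<in> carrier (free_algebra G)"
    using minus_closed[OF p r] by (simp add: free_algebra_a_minus p r)
qed

lemma free_algebra_hom_simps:
  fixes A :: "('k::field, 'a) module" and G :: "'g set"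
  assumes "field_algebra A" "h \<in> alg_hom (free_algebra G) A"
  shows "\<lbrakk>p \<in> carrier (free_algebra G); r \<in> carrier (free_algebra G)\<rbrakk> \<Longrightarrow> h (p * r) = h p \<otimes>\<^bsub>A\<^esub> h r"
    and "\<lbrakk>p \<in> carrier (free_algebra G); r \<in> carrier (free_algebra G)\<rbrakk> \<Longrightarrow> h (p - r) = h p \<ominus>\<^bsub>A\<^esub> h r"
    and "\<lbrakk>p \<in> carrier (free_algebra G); r \<in> carrier (free_algebra G)\<rbrakk> \<Longrightarrow> h (p + r) = h p \<oplus>\<^bsub>A\<^esub> h r"
    and "p \<in> carrier (free_algebra G) \<Longrightarrow> h (scalar c * p) = c \<odot>\<^bsub>A\<^esub> h p"
    and "h 1 = \<one>\<^bsub>A\<^esub>"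
    and "p \<in> carrier (free_algebra G) \<Longrightarrow> h p \<in> carrier A"
proof -
  interpret field_algebra_hom "free_algebra G" A h
    by (intro field_algebra_homI field_algebra_free_algebra assms)
  show "h 1 = \<one>\<^bsub>A\<^esub>" using hom_one by simp
  assume p: "p \<in> carrier (free_algebra G)"
  show "h p \<in> carrier A" using p by simp
  show "h (scalar c * p) = c \<odot>\<^bsub>A\<^esub> h p" using hom_smult[OF p, of c] by simp
  assume r: "r \<in> carrier (free_algebra G)"
  show "h (p * r) = h p \<otimes>\<^bsub>A\<^esub> h r" "h (p + r) = h p \<oplus>\<^bsub>A\<^esub> h r"
    using hom_mult[OF p r] hom_add[OF p r] by simp_all
  show "h (p - r) = h p \<ominus>\<^bsub>A\<^esub> h r"
    using hom_minus[OF p r] by (simp add: free_algebra_a_minus p r)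
qed

definition torus_elem :: "'k::field \<Rightarrow> 'v seed \<Rightarrow> 'v torus_gen \<Rightarrow> ('v torus_gen, 'k) ncpoly set" where
  "torus_elem q s g = presented_elem (torus_gens s) (torus_rels q s) (gen g)"

lemma torus_gen_closed:
  "i \<in> vertices s \<Longrightarrow> gen (X i) \<in> carrier (free_algebra (torus_gens s))"
  "i \<in> vertices s \<Longrightarrow> gen (Xinv i) \<in> carrier (free_algebra (torus_gens s))"
  by (simp_all add: free_algebra_gen torus_gens_def)

lemma torus_rels_carrier: "torus_rels q s \<subseteq> carrier (free_algebra (torus_gens s))"
  unfolding torus_rels_def by (auto intro!: free_algebra_closed torus_gen_closed)

lemma field_algebra_torus: "field_algebra (torus q s)"
  unfolding torus_def by (rule field_algebra_presented[OF torus_rels_carrier])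

lemma torus_proj_hom: "presented_elem (torus_gens s) (torus_rels q s) \<in> alg_hom (free_algebra (torus_gens s)) (torus q s)"
  unfolding torus_def by (rule presented_elem_hom[OF torus_rels_carrier])

lemma torus_elem_closed [simp]:
  "i \<in> vertices s \<Longrightarrow> torus_elem q s (X i) \<in> carrier (torus q s)"
  "i \<in> vertices s \<Longrightarrow> torus_elem q s (Xinv i) \<in> carrier (torus q s)"
  unfolding torus_elem_def
  by (simp_all add: free_algebra_hom_simps[OF field_algebra_torus torus_proj_hom] torus_gen_closed)

lemma torus_inverse_pair:
  assumes "i \<in> vertices s"
  shows "inverse_pair (torus q s) (torus_elem q s (X i)) (torus_elem q s (Xinv i))"
proof -
  interpret field_algebra "torus q s" by (rule field_algebra_torus)
  note simps = free_algebra_hom_simps[OF field_algebra_torus torus_proj_hom] torus_gen_closed[OF assms]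
    free_algebra_closed torus_elem_def [symmetric]
  let ?\<pi> = "presented_elem (torus_gens s) (torus_rels q s)"
  have "?\<pi> (gen (X i) * gen (Xinv i) - 1) = \<zero>\<^bsub>torus q s\<^esub>" "?\<pi> (gen (Xinv i) * gen (X i) - 1) = \<zero>\<^bsub>torus q s\<^esub>"
    unfolding torus_def
    by (intro presented_elem_relation torus_rels_carrier; use assms in \<open>auto simp: torus_rels_def\<close>)+
  then have "torus_elem q s (X i) \<otimes>\<^bsub>torus q s\<^esub> torus_elem q s (Xinv i) \<ominus>\<^bsub>torus q s\<^esub> \<one>\<^bsub>torus q s\<^esub> = \<zero>\<^bsub>torus q s\<^esub>"
    "torus_elem q s (Xinv i) \<otimes>\<^bsub>torus q s\<^esub> torus_elem q s (X i) \<ominus>\<^bsub>torus q s\<^esub> \<one>\<^bsub>torus q s\<^esub> = \<zero>\<^bsub>torus q s\<^esub>"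
    by (simp_all add: simps)
  from this[THEN eq_of_minus_zero] show ?thesis
    using assms by (simp add: inverse_pair_def)
qed

lemma torus_qcomm:
  assumes "i \<in> vertices s" "j \<in> vertices s"
  shows "qcomm (torus q s) (q powi (- 2 * weight s i j)) (torus_elem q s (X i)) (torus_elem q s (X j))"
proof -
  interpret field_algebra "torus q s" by (rule field_algebra_torus)
  note simps = free_algebra_hom_simps[OF field_algebra_torus torus_proj_hom] torus_gen_closed[OF assms(1)]
    torus_gen_closed[OF assms(2)] free_algebra_closed torus_elem_def [symmetric]
  let ?\<pi> = "presented_elem (torus_gens s) (torus_rels q s)"
  have "?\<pi> (gen (X i) * gen (X j) - scalar (q powi (- 2 * weight s i j)) * (gen (X j) * gen (X i))) = \<zero>\<^bsub>torus q s\<^esub>"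
    unfolding torus_def
    by (intro presented_elem_relation torus_rels_carrier) (use assms in \<open>auto simp: torus_rels_def\<close>)
  then have "torus_elem q s (X i) \<otimes>\<^bsub>torus q s\<^esub> torus_elem q s (X j) \<ominus>\<^bsub>torus q s\<^esub>
      (q powi (- 2 * weight s i j)) \<odot>\<^bsub>torus q s\<^esub> (torus_elem q s (X j) \<otimes>\<^bsub>torus q s\<^esub> torus_elem q s (X i)) = \<zero>\<^bsub>torus q s\<^esub>"
    by (simp add: simps)
  from this[THEN eq_of_minus_zero] show ?thesis
    using assms by (simp add: qcomm_def)
qed

lemma torus_hom_exists:
  assumes A: "field_algebra A" and x: "\<And>i. inverse_pair A (x i) (y i)"
    and comm: "\<And>i j. \<lbrakk>i \<in> vertices s; j \<in> vertices s\<rbrakk> \<Longrightarrow> qcomm A (q powi (- 2 * weight s i j)) (x i) (x j)"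
  obtains h where "h \<in> alg_hom (torus q s) A"
    "\<And>i. i \<in> vertices s \<Longrightarrow> h (torus_elem q s (X i)) = x i"
    "\<And>i. i \<in> vertices s \<Longrightarrow> h (torus_elem q s (Xinv i)) = y i"
proof -
  interpret field_algebra A by fact
  let ?x = "\<lambda>g. case g of X i \<Rightarrow> x i | Xinv i \<Rightarrow> y i"
  have xy: "x i \<in> carrier A" "y i \<in> carrier A" "x i \<otimes>\<^bsub>A\<^esub> y i = \<one>\<^bsub>A\<^esub>" "y i \<otimes>\<^bsub>A\<^esub> x i = \<one>\<^bsub>A\<^esub>" for i
    using x[of i] by (simp_all add: inverse_pair_def)
  have closed: "?x g \<in> carrier A" for g by (cases g) (simp_all add: xy)
  have rel: "evaluate A ?x r = \<zero>\<^bsub>A\<^esub>" if "r \<in> torus_rels q s" for r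
    using that unfolding torus_rels_def
  proof (elim UnE CollectE exE conjE)
    fix i assume "r = gen (X i) * gen (Xinv i) - 1"
    then show ?thesis by (simp add: closed xy r_neg minus_eq)
  next
    fix i assume "r = gen (Xinv i) * gen (X i) - 1"
    then show ?thesis by (simp add: closed xy r_neg minus_eq)
  next
    fix i j
    assume r: "r = gen (X i) * gen (X j) - scalar (q powi (- 2 * weight s i j)) * (gen (X j) * gen (X i))"
      and ij: "i \<in> vertices s" "j \<in> vertices s"
    have "x i \<otimes>\<^bsub>A\<^esub> x j = (q powi (- 2 * weight s i j)) \<odot>\<^bsub>A\<^esub> (x j \<otimes>\<^bsub>A\<^esub> x i)"
      using comm[OF ij] by (simp only: qcomm_def)
    then show ?thesis
      by (simp add: r closed xy evaluate_scalar smult_mult_left r_neg minus_eq)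
  qed
  obtain h where "h \<in> alg_hom (presented_algebra (torus_gens s) (torus_rels q s)) A"
    "\<And>p. p \<in> carrier (free_algebra (torus_gens s)) \<Longrightarrow>
        h (presented_elem (torus_gens s) (torus_rels q s) p) = evaluate A ?x p"
    using presented_hom_exists[where x = ?x, OF torus_rels_carrier A closed rel] by metis
  then show thesis
    using that[of h] by (simp add: torus_def torus_elem_def torus_gen_closed closed)
qed

lemma torus_spanned:
  assumes L: "linear_subspace (torus q s) L" and one: "\<one>\<^bsub>torus q s\<^esub> \<in> L"
    and step: "\<And>u i. \<lbrakk>u \<in> L; i \<in> vertices s\<rbrakk> \<Longrightarrow> u \<otimes>\<^bsub>torus q s\<^esub> torus_elem q s (X i) \<in> L"
      "\<And>u i. \<lbrakk>u \<in> L; i \<in> vertices s\<rbrakk> \<Longrightarrow> u \<otimes>\<^bsub>torus q s\<^esub> torus_elem q s (Xinv i) \<in> L"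
  shows "carrier (torus q s) \<subseteq> L"
proof -
  let ?\<pi> = "presented_elem (torus_gens s) (torus_rels q s)"
  have "carrier (torus q s) = ?\<pi> ` carrier (free_algebra (torus_gens s))"
    unfolding torus_def by (rule carrier_presented[OF torus_rels_carrier])
  also have "\<dots> \<subseteq> L"
  proof (rule free_algebra_hom_image_subset[OF field_algebra_torus torus_proj_hom L one])
    fix u g assume "u \<in> L" "g \<in> torus_gens s"
    then show "u \<otimes>\<^bsub>torus q s\<^esub> ?\<pi> (gen g) \<in> L"
      using step unfolding torus_gens_def torus_elem_def by auto
  qed
  finally show ?thesis .
qed

subsection \<open>The tori of the folding and of its mutation\<close>

text \<open>
  The seed of the symmetric folding is the case \<open>i = 1\<close>, \<open>j = 3\<close>. Its mutation at 2 is the case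
  \<open>i = 3\<close>, \<open>j = 1\<close>, so one argument treats both seeds.
\<close>

definition oriented_seed :: "nat \<Rightarrow> nat \<Rightarrow> nat seed" where
  "oriented_seed i j =
     \<lparr>vertices = {1, 2, 3}, frozen = {1, 3},
      exch = (\<lambda>_ _. 0)
        (i := (\<lambda>_. 0)(2 := - 2, j := 1),
         2 := (\<lambda>_. 0)(i := 1, j := - 1),
         j := (\<lambda>_. 0)(i := - 1, 2 := 2)),
      multiplier = (\<lambda>_. 1)(2 := 2)\<rparr>"

lemma folding_seed_oriented: "folding_seed = oriented_seed 1 3"
  by (simp add: folding_seed_def oriented_seed_def)

lemma mutate_oriented_seed:
  assumes "(i, j) \<in> {(1, 3), (3, 1)}"
  shows "mutate 2 (oriented_seed i j) = oriented_seed j i"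
  using assms by (auto simp: mutate_def oriented_seed_def fun_eq_iff)

text \<open>
  The scalar that arises when \<open>X\<^sub>i\<^sup>a X\<^sub>2\<^sup>b X\<^sub>j\<^sup>c\<close> times \<open>X\<^sub>i\<^sup>a\<^sup>' X\<^sub>2\<^sup>b\<^sup>' X\<^sub>j\<^sup>c\<^sup>'\<close> is brought into normal
  order, by \<open>X\<^sub>2 X\<^sub>i = q\<^sup>-\<^sup>4 X\<^sub>i X\<^sub>2\<close>, \<open>X\<^sub>j X\<^sub>i = q\<^sup>2 X\<^sub>i X\<^sub>j\<close> and \<open>X\<^sub>j X\<^sub>2 = q\<^sup>-\<^sup>4 X\<^sub>2 X\<^sub>j\<close>.
\<close>

definition torus_twist :: "'k::field \<Rightarrow> int \<times> int \<times> int \<Rightarrow> int \<times> int \<times> int \<Rightarrow> 'k" where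
  "torus_twist q = (\<lambda>(a, b, c) (a', b', c'). q powi (2 * c * a' - 4 * b * a' - 4 * c * b'))"

lemma torus_twist_simp [simp]:
  "torus_twist q (a, b, c) (a', b', c') = q powi (2 * c * a' - 4 * b * a' - 4 * c * b')"
  by (simp add: torus_twist_def)

lemma ordered_cocycle_torus_twist:
  fixes q :: "'k::field"
  assumes q: "q \<noteq> 0"
  shows "ordered_cocycle (torus_twist q)"
proof
  fix \<alpha> \<beta> \<gamma> :: "int \<times> int \<times> int"
  obtain a b c a' b' c' a'' b'' c'' where eq: "\<alpha> = (a, b, c)" "\<beta> = (a', b', c')" "\<gamma> = (a'', b'', c'')"
    by (metis surj_pair)
  show "torus_twist q \<alpha> \<beta> * torus_twist q (\<alpha> + \<beta>) \<gamma> = torus_twist q \<beta> \<gamma> * torus_twist q \<alpha> (\<beta> + \<gamma>)"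
    using q by (simp add: eq power_int_add [symmetric] algebra_simps)
  show "torus_twist q 0 \<alpha> = 1" "torus_twist q \<alpha> 0 = 1" "torus_twist q \<alpha> \<beta> \<noteq> 0"
    using q by (simp_all add: eq zero_prod_def)
  show "\<alpha> < \<beta> \<Longrightarrow> \<gamma> + \<alpha> < \<gamma> + \<beta>" "\<alpha> < \<beta> \<Longrightarrow> \<alpha> + \<gamma> < \<beta> + \<gamma>"
    by (auto simp: eq)
qed

abbreviation model :: "'k::field \<Rightarrow> ('k, int \<times> int \<times> int \<Rightarrow>\<^sub>0 'k) module" where
  "model q \<equiv> twisted_algebra (torus_twist q)"

lemma ore_algebra_model:
  fixes q :: "'k::field"
  assumes q: "q \<noteq> 0"
  shows "ore_algebra (model q)"
proof -
  interpret ordered_cocycle "torus_twist q" by (rule ordered_cocycle_torus_twist[OF q])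
  show ?thesis
  proof
    show "\<one>\<^bsub>model q\<^esub> \<noteq> \<zero>\<^bsub>model q\<^esub>" by simp
    show "x = \<zero>\<^bsub>model q\<^esub> \<or> y = \<zero>\<^bsub>model q\<^esub>" if "x \<otimes>\<^bsub>model q\<^esub> y = \<zero>\<^bsub>model q\<^esub>" for x y
      using that by (simp add: twisted_mult_eq_zero_iff)
    fix a b assume "a \<noteq> \<zero>\<^bsub>model q\<^esub>" "b \<noteq> \<zero>\<^bsub>model q\<^esub>"
    then have "a \<noteq> 0" "b \<noteq> 0" by simp_all
    from right_ore[OF folner_boxes this]
    show "\<exists>u\<in>carrier (model q). \<exists>v\<in>carrier (model q).
        a \<otimes>\<^bsub>model q\<^esub> u = b \<otimes>\<^bsub>model q\<^esub> v \<and> a \<otimes>\<^bsub>model q\<^esub> u \<noteq> \<zero>\<^bsub>model q\<^esub>"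
      by (metis UNIV_I twisted_algebra_simps(1,2,4))
  qed
qed

lemma ore_algebra_iso:
  assumes R: "field_algebra R" and S: "ore_algebra S" and h: "h \<in> alg_hom R S"
    and bij: "bij_betw h (carrier R) (carrier S)"
  shows "ore_algebra R"
proof -
  interpret S: ore_algebra S by fact
  interpret h: field_algebra_hom R S h by (intro field_algebra_homI R S.field_algebra_axioms h)
  have zero_iff: "h x = \<zero>\<^bsub>S\<^esub> \<longleftrightarrow> x = \<zero>\<^bsub>R\<^esub>" if "x \<in> carrier R" for x
    using that bij inj_onD[of h "carrier R" x "\<zero>\<^bsub>R\<^esub>"] by (auto simp: bij_betw_def)
  note inj = bij_betw_imp_inj_on[OF bij]
  show ?thesis
  proof
    show "\<one>\<^bsub>R\<^esub> \<noteq> \<zero>\<^bsub>R\<^esub>" using S.one_not_zero h.hom_one h.hom_zero by metis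
    show "x = \<zero>\<^bsub>R\<^esub> \<or> y = \<zero>\<^bsub>R\<^esub>"
      if "x \<otimes>\<^bsub>R\<^esub> y = \<zero>\<^bsub>R\<^esub>" "x \<in> carrier R" "y \<in> carrier R" for x y
      using that S.integral[of "h x" "h y"] zero_iff by (simp flip: h.hom_mult)
    fix a b assume ab: "a \<in> carrier R" "b \<in> carrier R" "a \<noteq> \<zero>\<^bsub>R\<^esub>" "b \<noteq> \<zero>\<^bsub>R\<^esub>"
    then have "h a \<noteq> \<zero>\<^bsub>S\<^esub>" "h b \<noteq> \<zero>\<^bsub>S\<^esub>" by (simp_all add: zero_iff)
    then obtain u' v' where uv': "u' \<in> carrier S" "v' \<in> carrier S"
      "h a \<otimes>\<^bsub>S\<^esub> u' = h b \<otimes>\<^bsub>S\<^esub> v'" "h a \<otimes>\<^bsub>S\<^esub> u' \<noteq> \<zero>\<^bsub>S\<^esub>"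
      using S.right_oreE[of "h a" "h b"] ab h.hom_closed by metis
    obtain u v where uv: "u \<in> carrier R" "v \<in> carrier R" "u' = h u" "v' = h v"
      using uv' bij by (metis bij_betw_imp_surj_on imageE)
    have "h (a \<otimes>\<^bsub>R\<^esub> u) = h (b \<otimes>\<^bsub>R\<^esub> v)" "h (a \<otimes>\<^bsub>R\<^esub> u) \<noteq> \<zero>\<^bsub>S\<^esub>"
      using uv' ab uv by simp_all
    then have "a \<otimes>\<^bsub>R\<^esub> u = b \<otimes>\<^bsub>R\<^esub> v"
      using ab uv inj_onD[OF inj, of "a \<otimes>\<^bsub>R\<^esub> u" "b \<otimes>\<^bsub>R\<^esub> v"] by simp
    moreover have "a \<otimes>\<^bsub>R\<^esub> u \<noteq> \<zero>\<^bsub>R\<^esub>"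
      using \<open>h (a \<otimes>\<^bsub>R\<^esub> u) \<noteq> \<zero>\<^bsub>S\<^esub>\<close> h.hom_zero by metis
    ultimately show "\<exists>u\<in>carrier R. \<exists>v\<in>carrier R. a \<otimes>\<^bsub>R\<^esub> u = b \<otimes>\<^bsub>R\<^esub> v \<and> a \<otimes>\<^bsub>R\<^esub> u \<noteq> \<zero>\<^bsub>R\<^esub>"
      using uv by (intro bexI conjI)
  qed
qed

locale folding_torus =
  fixes q :: "'k::field" and i j :: nat
  assumes q: "q \<noteq> 0" and ij: "(i, j) \<in> {(1, 3), (3, 1)}"
begin

abbreviation "s \<equiv> oriented_seed i j"
abbreviation "T \<equiv> torus q s"
abbreviation "M \<equiv> model q"
abbreviation Z :: "int \<times> int \<times> int \<Rightarrow> int \<times> int \<times> int \<Rightarrow>\<^sub>0 'k" where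
  "Z \<alpha> \<equiv> single \<alpha> 1"

lemma ij_distinct [simp]: "i \<noteq> 2" "j \<noteq> 2" "2 \<noteq> i" "2 \<noteq> j" "i \<noteq> j" "j \<noteq> i"
  using ij by auto

lemma vertices_s: "vertices s = {i, 2, j}"
  using ij by (auto simp: oriented_seed_def)

lemma vertices_s_simps [simp]: "i \<in> vertices s" "2 \<in> vertices s" "j \<in> vertices s"
  by (simp_all add: vertices_s)

lemma multiplier_s [simp]: "multiplier s i = 1" "multiplier s 2 = 2" "multiplier s j = 1"
  by (simp_all add: oriented_seed_def)

lemma exch_s [simp]:
  "exch s i 2 = - 2" "exch s i j = 1" "exch s 2 i = 1" "exch s 2 j = - 1" "exch s j i = - 1"
  "exch s j 2 = 2" "exch s i i = 0" "exch s 2 2 = 0" "exch s j j = 0"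
  by (simp_all add: oriented_seed_def)

sublocale M: ordered_cocycle "torus_twist q"
  by (rule ordered_cocycle_torus_twist[OF q])

sublocale T: field_algebra T
  by (rule field_algebra_torus)

abbreviation "x1 \<equiv> torus_elem q s (X i)"
abbreviation "y1 \<equiv> torus_elem q s (Xinv i)"
abbreviation "x2 \<equiv> torus_elem q s (X 2)"
abbreviation "y2 \<equiv> torus_elem q s (Xinv 2)"
abbreviation "x3 \<equiv> torus_elem q s (X j)"
abbreviation "y3 \<equiv> torus_elem q s (Xinv j)"
abbreviation "torus_monomial \<equiv> T.monomial (x1, y1) (x2, y2) (x3, y3)"

lemma inverse_pairs: "inverse_pair T x1 y1" "inverse_pair T x2 y2" "inverse_pair T x3 y3"
  by (simp_all add: torus_inverse_pair)

lemma torus_monomial_closed [simp]: "torus_monomial \<alpha> \<in> carrier T"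
  by (cases \<alpha>) (simp add: T.monomial_def)

lemma torus_monomials_span: "carrier T \<subseteq> range (lincomb T torus_monomial)"
proof (rule torus_spanned)
  show "linear_subspace T (range (lincomb T torus_monomial))"
    by (rule T.linear_subspace_lincombs) simp
  have "torus_monomial (0, 0, 0) = \<one>\<^bsub>T\<^esub>" by (simp add: T.monomial_def)
  then show "\<one>\<^bsub>T\<^esub> \<in> range (lincomb T torus_monomial)"
    using T.lincombs_basis[of torus_monomial "(0, 0, 0)"] by simp
  fix u k assume u: "u \<in> range (lincomb T torus_monomial)" and k: "k \<in> vertices s"
  have comm: "qcomm T (q powi (- 2 * weight s j 2)) x3 x2" "qcomm T (q powi (- 2 * weight s j i)) x3 x1"
    "qcomm T (q powi (- 2 * weight s 2 i)) x2 x1"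
    by (rule torus_qcomm; simp)+
  have nz: "q powi n \<noteq> 0" for n using q by simp
  have closed: "x1 \<in> carrier T" "y1 \<in> carrier T" "x2 \<in> carrier T" "y2 \<in> carrier T" by simp_all
  consider "k = i" | "k = 2" | "k = j" using k by (auto simp: vertices_s)
  then have "u \<otimes>\<^bsub>T\<^esub> w \<in> range (lincomb T torus_monomial)" if "w \<in> {torus_elem q s (X k), torus_elem q s (Xinv k)}" for w
  proof cases
    case 1
    then show ?thesis
      using T.monomial_span_left[OF inverse_pairs comm(3) nz comm(2) nz _ u] that by simp
  next
    case 2
    then show ?thesis
      using T.monomial_span_middle[OF closed(1,2) inverse_pairs(2,3) comm(1) nz _ u] that by simp
  next
    case 3
    then show ?thesis
      using T.monomial_span_right[OF closed(1,2) inverse_pairs(2,3) _ u] that by simp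
  qed
  then show "u \<otimes>\<^bsub>T\<^esub> torus_elem q s (X k) \<in> range (lincomb T torus_monomial)"
    "u \<otimes>\<^bsub>T\<^esub> torus_elem q s (Xinv k) \<in> range (lincomb T torus_monomial)" by simp_all
qed

lemma one_eq: "(1 :: int \<times> int \<times> int \<Rightarrow>\<^sub>0 'k) = Z (0, 0, 0)"
  by (simp flip: single_one add: zero_prod_def)

lemma zpow_single:
  assumes "\<alpha> = (a, 0, 0) \<or> \<alpha> = (0, a, 0) \<or> \<alpha> = (0, 0, a)"
  shows "inverse_pair M (Z \<alpha>) (Z (- \<alpha>))"
    and "zpow M (Z \<alpha>) (Z (- \<alpha>)) n = Z (n * fst \<alpha>, n * fst (snd \<alpha>), n * snd (snd \<alpha>))"
proof -
  show inv: "inverse_pair M (Z \<alpha>) (Z (- \<alpha>))"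
    using assms by (auto simp: inverse_pair_def one_eq)
  show "zpow M (Z \<alpha>) (Z (- \<alpha>)) n = Z (n * fst \<alpha>, n * fst (snd \<alpha>), n * snd (snd \<alpha>))"
  proof (induction n rule: int_induct[where k = 0])
    case base
    show ?case using assms by (auto simp: one_eq)
  next
    case (step1 n)
    then show ?case
      using M.zpow_add_one[OF inv, of n] assms by (auto simp: algebra_simps zero_prod_def)
  next
    case (step2 n)
    then show ?case
      using M.zpow_diff_one[OF inv, of n] assms by (auto simp: algebra_simps zero_prod_def)
  qed
qed

text \<open>
  The presentation gives a homomorphism onto the twisted group algebra. It is injective because the
  normally ordered monomials span the torus and are sent to the basis of single exponents.
\<close>

lemma torus_model_iso:
  obtains \<psi> where "\<psi> \<in> alg_hom T M" "bij_betw \<psi> (carrier T) (carrier M)"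
    "\<psi> x1 = Z (1, 0, 0)" "\<psi> x2 = Z (0, 1, 0)" "\<psi> x3 = Z (0, 0, 1)"
proof -
  define x where "x k = (if k = i then Z (1, 0, 0) else if k = 2 then Z (0, 1, 0) else Z (0, 0, 1))" for k
  define y where "y k = (if k = i then Z (- (1, 0, 0)) else if k = 2 then Z (- (0, 1, 0)) else Z (- (0, 0, 1)))" for k
  have inv: "inverse_pair M (x k) (y k)" for k
    using zpow_single(1)[of "(1, 0, 0)" 1] zpow_single(1)[of "(0, 1, 0)" 1] zpow_single(1)[of "(0, 0, 1)" 1]
    by (simp add: x_def y_def)
  have comm: "qcomm M (q powi (- 2 * weight s k l)) (x k) (x l)"
    if "k \<in> vertices s" "l \<in> vertices s" for k l
    using that q
    by (auto simp: vertices_s x_def qcomm_def weight_def power_int_minus)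
  obtain \<psi> where \<psi>: "\<psi> \<in> alg_hom T M" "\<And>k. k \<in> vertices s \<Longrightarrow> \<psi> (torus_elem q s (X k)) = x k"
    "\<And>k. k \<in> vertices s \<Longrightarrow> \<psi> (torus_elem q s (Xinv k)) = y k"
    using torus_hom_exists[OF M.field_algebra_twisted inv comm] by metis
  interpret \<psi>: field_algebra_hom T M \<psi>
    by (intro field_algebra_homI T.field_algebra_axioms M.field_algebra_twisted \<psi>(1))
  have mono: "\<psi> (torus_monomial \<alpha>) = Z \<alpha>" for \<alpha>
  proof (cases \<alpha>)
    case (fields a b c)
    show ?thesis
      unfolding fields
      by (simp add: \<psi>.hom_monomial M.monomial_def \<psi> x_def y_def zpow_single(2)
          zpow_single(2)[of "(1, 0, 0)" 1, simplified] zpow_single(2)[of "(0, 1, 0)" 1, simplified]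
          zpow_single(2)[of "(0, 0, 1)" 1, simplified])
  qed
  have lincomb: "\<psi> (lincomb T torus_monomial p) = p" for p
    by (simp add: \<psi>.hom_lincomb mono M.lincomb_basis)
  have "bij_betw \<psi> (carrier T) (carrier M)"
    unfolding bij_betw_def
  proof
    show "inj_on \<psi> (carrier T)"
      by (rule \<psi>.inj_on_if_spanning_independent[OF torus_monomial_closed torus_monomials_span])
         (simp add: mono M.lincomb_basis)
    have "p \<in> \<psi> ` carrier T" for p
      by (rule image_eqI[of _ _ "lincomb T torus_monomial p"]) (simp_all add: lincomb)
    then show "\<psi> ` carrier T = carrier M" by auto
  qed
  moreover have "\<psi> x1 = Z (1, 0, 0)" "\<psi> x2 = Z (0, 1, 0)" "\<psi> x3 = Z (0, 0, 1)"
    by (simp_all add: \<psi> x_def)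
  ultimately show thesis using that \<psi>(1) by blast
qed

lemma ore_algebra_T: "ore_algebra T"
  using torus_model_iso ore_algebra_iso[OF T.field_algebra_axioms ore_algebra_model[OF q]] by metis

lemma model_torus_iso:
  obtains \<sigma> where "\<sigma> \<in> alg_hom M T" "bij_betw \<sigma> (carrier M) (carrier T)"
    "\<sigma> (Z (1, 0, 0)) = x1" "\<sigma> (Z (0, 1, 0)) = x2" "\<sigma> (Z (0, 0, 1)) = x3"
proof -
  obtain \<psi> where \<psi>: "\<psi> \<in> alg_hom T M" "bij_betw \<psi> (carrier T) (carrier M)"
    "\<psi> x1 = Z (1, 0, 0)" "\<psi> x2 = Z (0, 1, 0)" "\<psi> x3 = Z (0, 0, 1)"
    by (rule torus_model_iso)
  have "inv_into (carrier T) \<psi> (\<psi> x) = x" if "x \<in> carrier T" for x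
    using \<psi>(2) that by (simp add: bij_betw_inv_into_left)
  from this[of x1] this[of x2] this[of x3] show thesis
    using alg_hom_inv[OF T.field_algebra_axioms M.field_algebra_twisted \<psi>(1,2)]
      bij_betw_inv_into[OF \<psi>(2)] that \<psi>(3-5) by simp
qed

end

section \<open>The mutation of the folding\<close>

context folding_torus
begin

abbreviation "Q \<equiv> torus_field q s"
abbreviation "T' \<equiv> torus q (oriented_seed j i)"

sublocale T: ore_algebra T
  by (rule ore_algebra_T)

lemma Q_eq: "Q = frac_field T"
  by (simp add: torus_field_def)

sublocale Q: field_algebra Q
  unfolding Q_eq by (rule T.field_algebra_frac_field)

sublocale emb: field_algebra_hom T Q "frac_embed T"
  unfolding Q_eq
  by (intro field_algebra_homI T.field_algebra_axioms T.field_algebra_frac_field T.frac_embed_hom)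

lemma Q_unit: "\<lbrakk>P \<in> carrier Q; P \<noteq> \<zero>\<^bsub>Q\<^esub>\<rbrakk> \<Longrightarrow> P \<in> Units Q"
  unfolding Q_eq by (rule T.frac_nonzero_unit)

lemma swapped: "folding_torus q j i"
  using q ij by unfold_locales auto

lemma cluster_var_eq: "cluster_var q s k = frac_embed T (torus_elem q s (X k))"
  by (simp add: cluster_var_def torus_elem_def)

text \<open>
  The torus, in the form of the twisted group algebra, inside its skew field of fractions. Identities
  between Laurent polynomials are verified in the former and used in the latter.
\<close>

definition model_embed :: "(int \<times> int \<times> int \<Rightarrow>\<^sub>0 'k) \<Rightarrow> (nat, 'k) torus_frac" where
  "model_embed = (SOME \<eta>. \<eta> \<in> alg_hom M Q \<and> inj_on \<eta> (carrier M) \<and> \<eta> (Z (1, 0, 0)) = cluster_var q s i \<and>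
     \<eta> (Z (0, 1, 0)) = cluster_var q s 2 \<and> \<eta> (Z (0, 0, 1)) = cluster_var q s j)"

lemma model_embed:
  "model_embed \<in> alg_hom M Q" "inj model_embed" "model_embed (Z (1, 0, 0)) = cluster_var q s i"
  "model_embed (Z (0, 1, 0)) = cluster_var q s 2" "model_embed (Z (0, 0, 1)) = cluster_var q s j"
proof -
  obtain \<sigma> where \<sigma>: "\<sigma> \<in> alg_hom M T" "bij_betw \<sigma> (carrier M) (carrier T)"
    "\<sigma> (Z (1, 0, 0)) = x1" "\<sigma> (Z (0, 1, 0)) = x2" "\<sigma> (Z (0, 0, 1)) = x3"
    by (rule model_torus_iso)
  have "inj_on (frac_embed T \<circ> \<sigma>) (carrier M)"
    using \<sigma>(2) T.frac_embed_inj by (intro comp_inj_on) (auto simp: bij_betw_def)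
  then have "\<exists>\<eta>. \<eta> \<in> alg_hom M Q \<and> inj_on \<eta> (carrier M) \<and> \<eta> (Z (1, 0, 0)) = cluster_var q s i \<and>
     \<eta> (Z (0, 1, 0)) = cluster_var q s 2 \<and> \<eta> (Z (0, 0, 1)) = cluster_var q s j"
    using alg_hom_trans[OF \<sigma>(1) emb.hom] \<sigma>(3-5)
    by (intro exI[of _ "frac_embed T \<circ> \<sigma>"]) (simp add: cluster_var_eq)
  from someI_ex[OF this, folded model_embed_def]
  show "model_embed \<in> alg_hom M Q" "inj model_embed" "model_embed (Z (1, 0, 0)) = cluster_var q s i"
    "model_embed (Z (0, 1, 0)) = cluster_var q s 2" "model_embed (Z (0, 0, 1)) = cluster_var q s j"
    by simp_all
qed

sublocale \<eta>: field_algebra_hom M Q model_embed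
  by (intro field_algebra_homI M.field_algebra_twisted Q.field_algebra_axioms model_embed)

lemma model_embed_zero_iff: "model_embed p = \<zero>\<^bsub>Q\<^esub> \<longleftrightarrow> p = 0"
  using \<eta>.hom_zero model_embed(2) by (auto dest: injD)

text \<open>
  \<open>u\<close> and the denominator of \<open>v\<close> as Laurent polynomials, where \<open>u\<close> and \<open>v\<close> are the values of the
  mutation on the variables \<open>X\<^sub>j\<close> and \<open>X\<^sub>i\<close> of the mutated seed.
\<close>

abbreviation "U \<equiv> Z (0, 0, 1) \<otimes>\<^bsub>M\<^esub> (\<one>\<^bsub>M\<^esub> \<oplus>\<^bsub>M\<^esub> q ^ 2 \<odot>\<^bsub>M\<^esub> Z (0, 1, 0))"
abbreviation "Den \<equiv> \<one>\<^bsub>M\<^esub> \<oplus>\<^bsub>M\<^esub> q ^ 2 \<odot>\<^bsub>M\<^esub> Z (0, - 1, 0)"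

lemma U_eq: "U = Z (0, 0, 1) + single (0, 1, 1) (inverse (q ^ 2))"
proof -
  have "q ^ 2 / q ^ 4 = inverse (q ^ 2)" using q by (simp add: divide_simps flip: power_add)
  moreover have "U = Z (0, 0, 1) + single (0, 1, 1) (q ^ 2 / q ^ 4)"
    by (simp add: twisted_mult_add_right one_eq power_int_minus field_simps)
  ultimately show ?thesis by (simp only:)
qed

lemma U_nonzero: "U \<noteq> 0"
proof -
  have "lookup U (0, 0, 1) = 1" unfolding U_eq by (simp add: lookup_add lookup_single)
  then show ?thesis by auto
qed

lemma Den_nonzero: "Den \<noteq> 0"
proof -
  have "lookup Den (0, 0, 0) = 1" by (simp add: one_eq lookup_add lookup_single)
  then show ?thesis by auto
qed

text \<open>
  All relations between the mutated variables are consequences of these identities between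
  Laurent polynomials: the first three give commutation with \<open>X\<^sub>2\<close>, the last two evaluate the
  products of the mutated \<open>X\<^sub>i\<close> and \<open>X\<^sub>j\<close> in both orders.
\<close>

lemma model_identities:
  "qcomm M (q powi 4) U (Z (0, - 1, 0))"
  "qcomm M (q powi (- 4)) (Z (1, 0, 0)) (Z (0, - 1, 0))"
  "qcomm M 1 Den (Z (0, - 1, 0))"
  "U \<otimes>\<^bsub>M\<^esub> Z (1, 0, 0) = (Z (1, 0, 0) \<otimes>\<^bsub>M\<^esub> (Z (0, 0, 1) \<otimes>\<^bsub>M\<^esub> Z (0, 1, 0))) \<otimes>\<^bsub>M\<^esub> Den"
  "U = q ^ 2 \<odot>\<^bsub>M\<^esub> (Den \<otimes>\<^bsub>M\<^esub> (Z (0, 0, 1) \<otimes>\<^bsub>M\<^esub> Z (0, 1, 0)))"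
  using q
  by (simp_all add: U_eq qcomm_def one_eq twisted_mult_add_left twisted_mult_add_right scale_add
      power_int_minus field_simps flip: power_add)

text \<open>
  The variables of the seed. The mutation sends the variables \<open>X\<^sub>i\<close>, \<open>X\<^sub>2\<close>, \<open>X\<^sub>j\<close> of the mutated seed
  to \<open>v\<close>, \<open>f2\<close>, \<open>u\<close>.
\<close>

abbreviation "e1 \<equiv> cluster_var q s i"
abbreviation "e2 \<equiv> cluster_var q s 2"
abbreviation "e3 \<equiv> cluster_var q s j"
abbreviation "f2 \<equiv> inv\<^bsub>Q\<^esub> e2"
abbreviation "u \<equiv> e3 \<otimes>\<^bsub>Q\<^esub> (\<one>\<^bsub>Q\<^esub> \<oplus>\<^bsub>Q\<^esub> q ^ 2 \<odot>\<^bsub>Q\<^esub> e2)"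
abbreviation "den \<equiv> \<one>\<^bsub>Q\<^esub> \<oplus>\<^bsub>Q\<^esub> q ^ 2 \<odot>\<^bsub>Q\<^esub> f2"
abbreviation "v \<equiv> e1 \<otimes>\<^bsub>Q\<^esub> inv\<^bsub>Q\<^esub> den"

lemma Q_inverse_pairs:
  "inverse_pair Q e1 (model_embed (Z (- 1, 0, 0)))"
  "inverse_pair Q e2 (model_embed (Z (0, - 1, 0)))"
  "inverse_pair Q e3 (model_embed (Z (0, 0, - 1)))"
  using \<eta>.hom_inverse_pair[OF zpow_single(1)[of "(1, 0, 0)" 1]] \<eta>.hom_inverse_pair[OF zpow_single(1)[of "(0, 1, 0)" 1]]
    \<eta>.hom_inverse_pair[OF zpow_single(1)[of "(0, 0, 1)" 1]]
  by (simp_all add: model_embed)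

lemma f2_eq: "f2 = model_embed (Z (0, - 1, 0))"
  by (rule Q.inverse_pair_inv[OF Q_inverse_pairs(2)])

lemma cluster_closed [simp]: "e1 \<in> carrier Q" "e2 \<in> carrier Q" "e3 \<in> carrier Q" "f2 \<in> carrier Q"
  using Q_inverse_pairs by (simp_all add: inverse_pair_def f2_eq)

lemma u_eq: "u = model_embed U" and den_eq: "den = model_embed Den"
  by (simp_all only: \<eta>.hom_mult \<eta>.hom_add \<eta>.hom_one \<eta>.hom_smult model_embed f2_eq twisted_algebra_simps(1) UNIV_I)

lemma u_den_pairs: "inverse_pair Q u (inv\<^bsub>Q\<^esub> u)" "inverse_pair Q den (inv\<^bsub>Q\<^esub> den)"
proof -
  have "u \<noteq> \<zero>\<^bsub>Q\<^esub>" "den \<noteq> \<zero>\<^bsub>Q\<^esub>"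
    using U_nonzero Den_nonzero unfolding u_eq den_eq model_embed_zero_iff by simp_all
  then show "inverse_pair Q u (inv\<^bsub>Q\<^esub> u)" "inverse_pair Q den (inv\<^bsub>Q\<^esub> den)"
    by (simp_all add: Q.unit_inverse_pair Q_unit)
qed

lemma u_den_closed [simp]: "inv\<^bsub>Q\<^esub> u \<in> carrier Q" "inv\<^bsub>Q\<^esub> den \<in> carrier Q"
  using u_den_pairs by (simp_all add: inverse_pair_def)

lemma v_pair: "inverse_pair Q v (den \<otimes>\<^bsub>Q\<^esub> model_embed (Z (- 1, 0, 0)))"
  by (rule Q.inverse_pair_mult[OF Q_inverse_pairs(1) inverse_pair_sym[OF u_den_pairs(2)]])

lemma v_den: "v \<otimes>\<^bsub>Q\<^esub> den = e1"
  using u_den_pairs(2) by (simp add: inverse_pair_def Q.m_assoc)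

text \<open>
  In \<open>u e1\<close> the denominator of \<open>v\<close> splits off on the right, and in \<open>u\<close> it splits off on the left.
  So the products of the two mutated variables, in either order, are
  Laurent monomials up to a scalar.
\<close>

lemma uv: "u \<otimes>\<^bsub>Q\<^esub> v = e1 \<otimes>\<^bsub>Q\<^esub> (e3 \<otimes>\<^bsub>Q\<^esub> e2)"
proof -
  have "u \<otimes>\<^bsub>Q\<^esub> e1 = e1 \<otimes>\<^bsub>Q\<^esub> (e3 \<otimes>\<^bsub>Q\<^esub> e2) \<otimes>\<^bsub>Q\<^esub> den"
    using arg_cong[OF model_identities(4), of model_embed]
    by (simp only: \<eta>.hom_mult u_eq [symmetric] den_eq [symmetric] model_embed twisted_algebra_simps(1) UNIV_I)
  then have "u \<otimes>\<^bsub>Q\<^esub> v = e1 \<otimes>\<^bsub>Q\<^esub> (e3 \<otimes>\<^bsub>Q\<^esub> e2) \<otimes>\<^bsub>Q\<^esub> (den \<otimes>\<^bsub>Q\<^esub> inv\<^bsub>Q\<^esub> den)"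
    by (simp add: Q.m_assoc [symmetric])
  then show ?thesis using u_den_pairs(2) by (simp add: inverse_pair_def)
qed

lemma vu: "v \<otimes>\<^bsub>Q\<^esub> u = q ^ 2 \<odot>\<^bsub>Q\<^esub> (e1 \<otimes>\<^bsub>Q\<^esub> (e3 \<otimes>\<^bsub>Q\<^esub> e2))"
proof -
  have u: "u = q ^ 2 \<odot>\<^bsub>Q\<^esub> (den \<otimes>\<^bsub>Q\<^esub> (e3 \<otimes>\<^bsub>Q\<^esub> e2))"
    using arg_cong[OF model_identities(5), of model_embed]
    by (simp only: \<eta>.hom_mult \<eta>.hom_smult u_eq [symmetric] den_eq [symmetric] model_embed twisted_algebra_simps(1) UNIV_I)
  have "v \<otimes>\<^bsub>Q\<^esub> u = q ^ 2 \<odot>\<^bsub>Q\<^esub> (e1 \<otimes>\<^bsub>Q\<^esub> ((inv\<^bsub>Q\<^esub> den \<otimes>\<^bsub>Q\<^esub> den) \<otimes>\<^bsub>Q\<^esub> (e3 \<otimes>\<^bsub>Q\<^esub> e2)))"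
    by (subst u) (simp add: Q.m_assoc Q.smult_mult_right)
  then show ?thesis using u_den_pairs(2) by (simp add: inverse_pair_def)
qed

text \<open>
  The images of the Chevalley generators if \<open>i = 1\<close>, \<open>j = 3\<close>. For the mutated seed the same formulas
  are used with 1 and 3 exchanged.
\<close>

definition chev_e where "chev_e = x1"
definition chev_f where "chev_f = x3 \<otimes>\<^bsub>T\<^esub> (\<one>\<^bsub>T\<^esub> \<oplus>\<^bsub>T\<^esub> q ^ 2 \<odot>\<^bsub>T\<^esub> x2)"
definition chev_k where "chev_k = q \<odot>\<^bsub>T\<^esub> (x1 \<otimes>\<^bsub>T\<^esub> x3)"
definition chev_k' where "chev_k' = q \<odot>\<^bsub>T\<^esub> (x1 \<otimes>\<^bsub>T\<^esub> (x3 \<otimes>\<^bsub>T\<^esub> x2))"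

lemma chev_closed: "{chev_e, chev_f, chev_k, chev_k'} \<subseteq> carrier T"
  by (simp add: chev_e_def chev_f_def chev_k_def chev_k'_def)

lemma frac_embed_chev:
  "frac_embed T chev_e = e1" "frac_embed T chev_f = u"
  "frac_embed T chev_k = q \<odot>\<^bsub>Q\<^esub> (e1 \<otimes>\<^bsub>Q\<^esub> e3)" "frac_embed T chev_k' = q \<odot>\<^bsub>Q\<^esub> (e1 \<otimes>\<^bsub>Q\<^esub> (e3 \<otimes>\<^bsub>Q\<^esub> e2))"
  by (simp_all add: chev_e_def chev_f_def chev_k_def chev_k'_def cluster_var_eq)

end

context folding_torus
begin

interpretation S: folding_torus q j i
  by (rule swapped)

text \<open>
  The inverse of \<open>v\<close>, a Laurent polynomial.
\<close>

abbreviation "W \<equiv> Den \<otimes>\<^bsub>M\<^esub> Z (- 1, 0, 0)"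

lemma Z_nonzero [simp]: "Z \<alpha> \<noteq> 0"
  using keys_single keys_zero by (metis insert_not_empty one_neq_zero)

lemma model_pow_nonzero: "p \<noteq> 0 \<Longrightarrow> p [^]\<^bsub>M\<^esub> (n::nat) \<noteq> 0"
  by (induction n) (simp_all add: M.twisted_mult_eq_zero_iff)

text \<open>
  The exponents of \<open>X\<^sub>i\<close> and \<open>X\<^sub>j\<close>. The mutation changes a monomial by functions of \<open>X\<^sub>2\<close> only, so
  it respects this degree.
\<close>

definition outer_degree :: "int \<times> int \<times> int \<Rightarrow> int \<times> int" where
  "outer_degree = (\<lambda>(a, b, c). (a, c))"

lemma outer_degree_add: "outer_degree (\<alpha> + \<beta>) = outer_degree \<alpha> + outer_degree \<beta>"
  by (cases \<alpha>, cases \<beta>) (simp add: outer_degree_def)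

lemma outer_degree_powers:
  "homogeneous outer_degree (0, int n) (U [^]\<^bsub>M\<^esub> n)" "homogeneous outer_degree (- int n, 0) (W [^]\<^bsub>M\<^esub> n)"
proof -
  have one: "homogeneous outer_degree (0, 0) (1 :: int \<times> int \<times> int \<Rightarrow>\<^sub>0 'k)"
    unfolding one_eq by (rule homogeneous_single) (simp add: outer_degree_def)
  have U: "homogeneous outer_degree (0, 1) U"
    unfolding U_eq by (intro homogeneous_add homogeneous_single) (simp_all add: outer_degree_def)
  have "homogeneous outer_degree (0, 0) Den"
    unfolding twisted_algebra_simps scale_single
    by (intro homogeneous_add homogeneous_single one) (simp add: outer_degree_def)
  moreover have "homogeneous outer_degree (- 1, 0) (Z (- 1, 0, 0))"
    by (rule homogeneous_single) (simp add: outer_degree_def)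
  ultimately have W: "homogeneous outer_degree (- 1, 0) W"
    using homogeneous_mult[of outer_degree "(0, 0)" Den "(- 1, 0)" "Z (- 1, 0, 0)" "torus_twist q"]
    by (simp add: outer_degree_add)
  show "homogeneous outer_degree (0, int n) (U [^]\<^bsub>M\<^esub> n)"
  proof (induction n)
    case (Suc n)
    from homogeneous_mult[OF outer_degree_add this U, of "torus_twist q"] show ?case
      by (simp add: add.commute)
  qed (simp add: one)
  show "homogeneous outer_degree (- int n, 0) (W [^]\<^bsub>M\<^esub> n)"
  proof (induction n)
    case (Suc n)
    from homogeneous_mult[OF outer_degree_add this W, of "torus_twist q"] show ?case
      by (simp add: algebra_simps)
  qed (simp add: one)
qed

text \<open>
  The image \<open>u\<close> of the first variable and the inverse of the image \<open>v\<close> of the third one are Laurent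
  polynomials. On the span of the monomials with exponents \<open>a \<ge> 0\<close> and \<open>c \<le> 0\<close> the homomorphism
  therefore takes values in the torus, and \<open>graded_independent\<close> applies with \<open>L = U\<^sup>a\<close> and
  \<open>R = W\<^sup>-\<^sup>c\<close>. Multiplication by monomials on both sides moves every element into this span.
\<close>

lemma model_hom_injective:
  assumes g: "g \<in> alg_hom M Q" and gen: "g (Z (1, 0, 0)) = u" "g (Z (0, 1, 0)) = f2" "g (Z (0, 0, 1)) = v"
  shows "inj g"
proof -
  interpret g: field_algebra_hom M Q g
    by (intro field_algebra_homI M.field_algebra_twisted Q.field_algebra_axioms g)
  define t where "t = (\<lambda>(a, b, c). U [^]\<^bsub>M\<^esub> nat a \<otimes>\<^bsub>M\<^esub> Z (0, - b, 0) \<otimes>\<^bsub>M\<^esub> W [^]\<^bsub>M\<^esub> nat (- c))"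
  have W: "g (Z (0, 0, - 1)) = model_embed W"
  proof (rule Q.inverse_pair_unique)
    show "inverse_pair Q v (g (Z (0, 0, - 1)))"
      using g.hom_inverse_pair[OF zpow_single(1)[of "(0, 0, 1)" 1]] by (simp add: gen)
    have "model_embed W = den \<otimes>\<^bsub>Q\<^esub> model_embed (Z (- 1, 0, 0))"
      unfolding den_eq by (rule \<eta>.hom_mult) simp_all
    then show "inverse_pair Q v (model_embed W)" using v_pair by simp
  qed
  have f2_pow: "g (Z (0, b, 0)) = model_embed (Z (0, - b, 0))" for b
  proof -
    have "g (Z (0, - 1, 0)) = e2"
      using g.hom_inverse_pair[OF zpow_single(1)[of "(0, 1, 0)" 1]] inverse_pair_sym[OF Q_inverse_pairs(2)]
      by (intro Q.inverse_pair_unique) (simp_all add: gen f2_eq)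
    then have "g (Z (0, b, 0)) = zpow Q (model_embed (Z (0, - 1, 0))) (model_embed (Z (0, 1, 0))) b"
      using g.hom_zpow[of "Z (0, 1, 0)" "Z (0, - 1, 0)" b] zpow_single(2)[of "(0, 1, 0)" 1 b]
      by (simp add: gen f2_eq model_embed)
    then show ?thesis
      using \<eta>.hom_zpow[of "Z (0, - 1, 0)" "Z (0, 1, 0)" b] zpow_single(2)[of "(0, - 1, 0)" "- 1" b]
      by simp
  qed
  have split: "Z (a, b, c) = Z (1, 0, 0) [^]\<^bsub>M\<^esub> nat a \<otimes>\<^bsub>M\<^esub> Z (0, b, 0) \<otimes>\<^bsub>M\<^esub> Z (0, 0, - 1) [^]\<^bsub>M\<^esub> nat (- c)"
    if "0 \<le> a" "c \<le> 0" for a b c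
  proof -
    have "Z (1, 0, 0) [^]\<^bsub>M\<^esub> n = Z (int n, 0, 0)" "Z (0, 0, - 1) [^]\<^bsub>M\<^esub> n = Z (0, 0, - int n)" for n :: nat
      by (induction n) (simp_all add: one_eq algebra_simps)
    then show ?thesis using that by simp
  qed
  have g_Z: "g (Z \<alpha>) = model_embed (t \<alpha>)" if \<alpha>: "0 \<le> fst \<alpha>" "snd (snd \<alpha>) \<le> 0" for \<alpha>
  proof -
    obtain a b c where eq: "\<alpha> = (a, b, c)" by (metis surj_pair)
    have "g (Z \<alpha>) = u [^]\<^bsub>Q\<^esub> nat a \<otimes>\<^bsub>Q\<^esub> model_embed (Z (0, - b, 0)) \<otimes>\<^bsub>Q\<^esub> model_embed W [^]\<^bsub>Q\<^esub> nat (- c)"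
      using \<alpha> unfolding eq fst_conv snd_conv
      by (subst split) (simp_all only: g.hom_mult g.hom_nat_pow gen W f2_pow twisted_algebra_simps(1) UNIV_I)
    also have "\<dots> = model_embed (t \<alpha>)"
      unfolding eq t_def prod.case u_eq
      by (simp only: \<eta>.hom_mult \<eta>.hom_nat_pow twisted_algebra_simps(1) UNIV_I)
    finally show ?thesis .
  qed
  have zero: "p = 0" if p: "g p = \<zero>\<^bsub>Q\<^esub>" and keys: "\<And>\<alpha>. \<alpha> \<in> keys p \<Longrightarrow> 0 \<le> fst \<alpha> \<and> snd (snd \<alpha>) \<le> 0" for p
  proof -
    have "model_embed (lincomb M t p) = lincomb Q (\<lambda>\<alpha>. model_embed (t \<alpha>)) p"
      by (rule \<eta>.hom_lincomb) simp
    also have "\<dots> = lincomb Q (\<lambda>\<alpha>. g (Z \<alpha>)) p"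
      by (rule Q.lincomb_cong) (simp_all add: g_Z keys)
    also have "\<dots> = g (lincomb M Z p)"
      by (rule g.hom_lincomb [symmetric]) simp
    also have "\<dots> = \<zero>\<^bsub>Q\<^esub>" using p by (simp add: M.lincomb_basis)
    finally have zero: "lincomb M t p = 0" by (simp add: model_embed_zero_iff)
    have "W \<noteq> 0" using Den_nonzero by (simp add: M.twisted_mult_eq_zero_iff del: twisted_algebra_simps(3,5,6))
    show "p = 0"
    proof (rule M.graded_independent[where L = "\<lambda>(a, c). U [^]\<^bsub>M\<^esub> nat a" and R = "\<lambda>(a, c). W [^]\<^bsub>M\<^esub> nat (- c)"
          and cl = outer_degree and \<nu> = "\<lambda>(a, b, c). (0, - b, 0)" and \<kappa> = "\<lambda>_. 1"
          and deg = outer_degree and \<delta> = "\<lambda>(a, c). (c, a)"])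
      let ?t = "\<lambda>\<alpha>. twisted_mult (torus_twist q) (twisted_mult (torus_twist q)
        (case outer_degree \<alpha> of (a, c) \<Rightarrow> U [^]\<^bsub>M\<^esub> nat a) (Z (case \<alpha> of (a, b, c) \<Rightarrow> (0, - b, 0))))
        (case outer_degree \<alpha> of (a, c) \<Rightarrow> W [^]\<^bsub>M\<^esub> nat (- c))"
      have t: "?t \<alpha> = t \<alpha>" for \<alpha>
        by (cases \<alpha>) (simp only: t_def outer_degree_def prod.case twisted_algebra_simps(2))
      show "lincomb M ?t p = 0" using zero by (simp only: t)
      fix \<alpha> assume \<alpha>: "\<alpha> \<in> keys p"
      show "homogeneous outer_degree (case outer_degree \<alpha> of (a, c) \<Rightarrow> (c, a)) (?t \<alpha>)"
      proof -
        obtain a b c where eq: "\<alpha> = (a, b, c)" by (metis surj_pair)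
        have "homogeneous outer_degree (0, 0) (Z (0, - b, 0))"
          by (rule homogeneous_single) (simp add: outer_degree_def)
        from homogeneous_mult[OF outer_degree_add homogeneous_mult[OF outer_degree_add
            outer_degree_powers(1)[of "nat a"] this] outer_degree_powers(2)[of "nat (- c)"], of "torus_twist q" "torus_twist q"]
        show ?thesis using keys[OF \<alpha>]
          unfolding eq outer_degree_def prod.case by simp
      qed
      show "(case outer_degree \<alpha> of (a, c) \<Rightarrow> U [^]\<^bsub>M\<^esub> nat a) \<noteq> 0 \<and> (1 :: 'k) \<noteq> 0 \<and>
        (case outer_degree \<alpha> of (a, c) \<Rightarrow> W [^]\<^bsub>M\<^esub> nat (- c)) \<noteq> 0"
        using model_pow_nonzero[OF U_nonzero] model_pow_nonzero[OF \<open>W \<noteq> 0\<close>]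
        by (simp only: case_prod_beta) simp
    next
      show "inj_on (\<lambda>(a, c). (c, a)) (outer_degree ` keys p)"
        by (auto simp: inj_on_def outer_degree_def)
      show "\<alpha> = \<beta>" if "outer_degree \<alpha> = outer_degree \<beta>"
        "(case \<alpha> of (a, b, c) \<Rightarrow> (0, - b, 0)) = (case \<beta> of (a, b, c) \<Rightarrow> (0 :: int, - b, 0 :: int))" for \<alpha> \<beta>
        using that by (cases \<alpha>, cases \<beta>) (simp add: outer_degree_def)
    qed
  qed
  have "p = 0" if "g p = \<zero>\<^bsub>Q\<^esub>" for p
  proof -
    \<comment> \<open>All exponents of the first and third variable in \<open>p\<close> lie between \<open>- N\<close> and \<open>N\<close>.\<close>
    define N where "N = (\<Sum>(a, b, c)\<in>keys p. \<bar>a\<bar> + \<bar>c\<bar>)"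
    define p' where "p' = Z (N, 0, 0) \<otimes>\<^bsub>M\<^esub> p \<otimes>\<^bsub>M\<^esub> Z (0, 0, - N)"
    have "p' = 0"
    proof (rule zero)
      show "g p' = \<zero>\<^bsub>Q\<^esub>" using that by (simp only: p'_def g.hom_mult twisted_algebra_simps(1) UNIV_I) simp
      fix \<alpha> assume "\<alpha> \<in> keys p'"
      then obtain a b c where abc: "(a, b, c) \<in> keys p" and \<alpha>: "\<alpha> = (a + N, b, c - N)"
        using keys_twisted_mult[of "torus_twist q" "Z (N, 0, 0) \<otimes>\<^bsub>M\<^esub> p" "Z (0, 0, - N)"]
          keys_twisted_mult[of "torus_twist q" "Z (N, 0, 0)" p]
        by (fastforce simp: p'_def)
      have "(case (a, b, c) of (a, b, c) \<Rightarrow> \<bar>a\<bar> + \<bar>c\<bar>) \<le> N"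
        unfolding N_def using abc by (intro member_le_sum) auto
      then show "0 \<le> fst \<alpha> \<and> snd (snd \<alpha>) \<le> 0" by (simp add: \<alpha>) arith
    qed
    then show "p = 0" by (simp add: p'_def M.twisted_mult_eq_zero_iff)
  qed
  then have "inj_on g (carrier M)" by (intro g.inj_onI_zero) simp
  then show ?thesis by simp
qed

lemma swapped_torus_hom:
  obtains h where "h \<in> alg_hom T' Q" "inj_on h (carrier T')"
    "h (torus_elem q S.s (X j)) = u" "h (torus_elem q S.s (X 2)) = f2" "h (torus_elem q S.s (X i)) = v"
proof -
  define x where "x k = (if k = j then u else if k = 2 then f2 else v)" for k
  define y where "y k = (if k = j then inv\<^bsub>Q\<^esub> u else if k = 2 then e2 else den \<otimes>\<^bsub>Q\<^esub> model_embed (Z (- 1, 0, 0)))" for k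
  have inv: "inverse_pair Q (x k) (y k)" for k
    using u_den_pairs(1) v_pair inverse_pair_sym[OF Q_inverse_pairs(2)] by (simp add: x_def y_def f2_eq)
  have closed: "u \<in> carrier Q" "v \<in> carrier Q" "den \<in> carrier Q" by simp_all
  have c1: "qcomm Q (q powi 4) u f2"
    unfolding u_eq f2_eq by (rule \<eta>.hom_qcomm[OF model_identities(1)]) simp_all
  have e1_f2: "qcomm Q (q powi (- 4)) e1 f2"
    unfolding f2_eq model_embed(3) [symmetric] by (rule \<eta>.hom_qcomm[OF model_identities(2)]) simp_all
  have "qcomm Q 1 den f2"
    unfolding den_eq unfolding f2_eq by (rule \<eta>.hom_qcomm[OF model_identities(3)]) simp_all
  from Q.qcomm_inverse[OF this _ u_den_pairs(2)] have "qcomm Q 1 (inv\<^bsub>Q\<^esub> den) f2" by simp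
  from Q.qcomm_mult_left[OF e1_f2 this] have c2: "qcomm Q (q powi (- 4)) v f2" by simp
  have c3: "qcomm Q (q powi 2) v u" using vu by (simp add: qcomm_def uv)
  have swap: "qcomm Q (q powi (- n)) b a" if "qcomm Q (q powi n) a b" "a \<in> carrier Q" "b \<in> carrier Q" for a b n
    using Q.qcomm_swap[OF that(1) _ that(2,3)] q by (simp add: power_int_minus)
  note comms = c1 c2 c3 swap[OF c1] swap[OF c2] swap[OF c3]
  have comm: "qcomm Q (q powi (- 2 * weight S.s k l)) (x k) (x l)"
    if "k \<in> vertices S.s" "l \<in> vertices S.s" for k l
    using that comms closed Q.qcomm_refl[OF closed(1)] Q.qcomm_refl[OF closed(2)] Q.qcomm_refl[of f2]
    unfolding S.vertices_s by (auto simp: x_def weight_def)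
  obtain h where h: "h \<in> alg_hom T' Q" "\<And>k. k \<in> vertices S.s \<Longrightarrow> h (torus_elem q S.s (X k)) = x k"
    using torus_hom_exists[OF Q.field_algebra_axioms inv comm] by metis
  have vals: "h (torus_elem q S.s (X j)) = u" "h (torus_elem q S.s (X 2)) = f2" "h (torus_elem q S.s (X i)) = v"
    by (simp_all add: h(2) x_def)
  obtain \<sigma> where \<sigma>: "\<sigma> \<in> alg_hom M T'" "bij_betw \<sigma> (carrier M) (carrier T')"
    "\<sigma> (Z (1, 0, 0)) = torus_elem q S.s (X j)" "\<sigma> (Z (0, 1, 0)) = torus_elem q S.s (X 2)"
    "\<sigma> (Z (0, 0, 1)) = torus_elem q S.s (X i)"
    by (rule S.model_torus_iso)
  have "inj (h \<circ> \<sigma>)"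
    using \<sigma>(3-5) vals by (intro model_hom_injective alg_hom_trans[OF \<sigma>(1) h(1)]) simp_all
  then have "inj_on h (\<sigma> ` carrier M)" by (intro inj_on_imageI) simp
  then have "inj_on h (carrier T')" using \<sigma>(2) by (simp add: bij_betw_def)
  with h(1) vals that show thesis by blast
qed

lemma mutated_vars:
  "mutated_var q 2 s i = v" "mutated_var q 2 s 2 = f2" "mutated_var q 2 s j = u"
  by (simp_all add: mutated_var_def Let_def)

text \<open>
  The homomorphism from the torus of the mutated seed is injective and takes values in a skew field,
  so it extends to fractions.
\<close>

lemma mutation_exists: "\<exists>\<mu>. is_mutation_map q 2 s \<mu>"
proof -
  obtain h where h: "h \<in> alg_hom T' Q" "inj_on h (carrier T')"
    "h (torus_elem q S.s (X j)) = u" "h (torus_elem q S.s (X 2)) = f2" "h (torus_elem q S.s (X i)) = v"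
    by (rule swapped_torus_hom)
  obtain \<mu> where \<mu>: "\<mu> \<in> alg_hom (frac_field T') Q" "\<And>x. x \<in> carrier T' \<Longrightarrow> \<mu> (frac_embed T' x) = h x"
    using S.T.extend_to_fractions[OF Q.field_algebra_axioms Q_unit h(1,2)] by metis
  have "is_mutation_map q 2 s \<mu>"
    unfolding is_mutation_map_def mutate_oriented_seed[OF ij] S.Q_eq vertices_s
    using \<mu> h(3-5) by (simp add: S.cluster_var_eq mutated_vars)
  then show ?thesis by metis
qed

lemma mutation_map:
  "mutation_map q 2 s \<in> alg_hom S.Q Q"
  "mutation_map q 2 s (cluster_var q S.s i) = v" "mutation_map q 2 s (cluster_var q S.s 2) = f2"
  "mutation_map q 2 s (cluster_var q S.s j) = u"
proof -
  have "is_mutation_map q 2 s (mutation_map q 2 s)"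
    unfolding mutation_map_def using mutation_exists by (rule someI_ex)
  then show "mutation_map q 2 s \<in> alg_hom S.Q Q"
    "mutation_map q 2 s (cluster_var q S.s i) = v" "mutation_map q 2 s (cluster_var q S.s 2) = f2"
    "mutation_map q 2 s (cluster_var q S.s j) = u"
    unfolding is_mutation_map_def mutate_oriented_seed[OF ij] vertices_s by (simp_all add: mutated_vars)
qed

text \<open>
  The mutation exchanges the roles of \<open>e\<close> and \<open>f\<close> and of \<open>K\<close> and \<open>K'\<close>, just as it exchanges the
  vertices 1 and 3.
\<close>

lemma mutation_chev:
  "mutation_map q 2 s (frac_embed T' S.chev_e) = frac_embed T chev_f"
  "mutation_map q 2 s (frac_embed T' S.chev_f) = frac_embed T chev_e"
  "mutation_map q 2 s (frac_embed T' S.chev_k) = frac_embed T chev_k'"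
  "mutation_map q 2 s (frac_embed T' S.chev_k') = frac_embed T chev_k"
proof -
  interpret \<mu>: field_algebra_hom S.Q Q "mutation_map q 2 s"
    by (intro field_algebra_homI S.Q.field_algebra_axioms Q.field_algebra_axioms mutation_map)
  have e2f2: "e2 \<otimes>\<^bsub>Q\<^esub> f2 = \<one>\<^bsub>Q\<^esub>" using Q_inverse_pairs(2) by (simp add: inverse_pair_def f2_eq)
  show "mutation_map q 2 s (frac_embed T' S.chev_e) = frac_embed T chev_f"
    "mutation_map q 2 s (frac_embed T' S.chev_k) = frac_embed T chev_k'"
    by (simp_all add: frac_embed_chev S.frac_embed_chev mutation_map uv)
  show "mutation_map q 2 s (frac_embed T' S.chev_f) = frac_embed T chev_e"
    using v_den by (simp add: frac_embed_chev S.frac_embed_chev mutation_map)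
  have "u \<otimes>\<^bsub>Q\<^esub> (v \<otimes>\<^bsub>Q\<^esub> f2) = (u \<otimes>\<^bsub>Q\<^esub> v) \<otimes>\<^bsub>Q\<^esub> f2" by (rule Q.m_assoc [symmetric]) simp_all
  also have "\<dots> = e1 \<otimes>\<^bsub>Q\<^esub> (e3 \<otimes>\<^bsub>Q\<^esub> (e2 \<otimes>\<^bsub>Q\<^esub> f2))" unfolding uv by (simp add: Q.m_assoc)
  finally have "u \<otimes>\<^bsub>Q\<^esub> (v \<otimes>\<^bsub>Q\<^esub> f2) = e1 \<otimes>\<^bsub>Q\<^esub> e3" by (simp add: e2f2)
  then show "mutation_map q 2 s (frac_embed T' S.chev_k') = frac_embed T chev_k"
    by (simp add: frac_embed_chev S.frac_embed_chev mutation_map)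
qed

end

lemma chev_laurent_after:
  assumes "folding_torus q i j" "set ks \<subseteq> {2}"
    "x \<in> {folding_torus.chev_e q i j, folding_torus.chev_f q i j, folding_torus.chev_k q i j, folding_torus.chev_k' q i j}"
  shows "frac_embed (torus q (oriented_seed i j)) x \<in> laurent_after q ks (oriented_seed i j)"
  using assms
proof (induction ks arbitrary: i j x)
  case Nil
  interpret folding_torus q i j by fact
  show ?case using Nil chev_closed by auto
next
  case (Cons k ks)
  interpret folding_torus q i j by fact
  interpret S: folding_torus q j i by (rule swapped)
  have k: "k = 2" "set ks \<subseteq> {2}" using Cons.prems by auto
  note IH = Cons.IH[OF swapped k(2)]
  have "\<exists>y \<in> {S.chev_e, S.chev_f, S.chev_k, S.chev_k'}. frac_embed T x = mutation_map q 2 s (frac_embed T' y)"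
    using Cons.prems(3) by (auto simp: mutation_chev)
  then show ?case
    using IH by (auto simp: k(1) mutate_oriented_seed[OF ij])
qed

section \<open>The Drinfeld double modulo its Casimir element\<close>

lemma dq_rels_carrier: "dq_rels q \<subseteq> carrier (free_algebra UNIV)"
  by (simp add: free_algebra_def)

lemma field_algebra_Dq: "field_algebra (Dq q)"
  unfolding Dq_def by (rule field_algebra_presented[OF dq_rels_carrier])

lemma Dq_elem_hom: "Dq_elem q \<in> alg_hom (free_algebra UNIV) (Dq q)"
  using presented_elem_hom[OF dq_rels_carrier, of q] by (simp add: Dq_def Dq_elem_def[abs_def])

lemma free_UNIV [simp]: "p \<in> carrier (free_algebra UNIV)"
  by (simp add: free_algebra_def)

lemma Dq_elem_closed [simp]: "Dq_elem q p \<in> carrier (Dq q)"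
  by (rule free_algebra_hom_simps(6)[OF field_algebra_Dq Dq_elem_hom]) simp

lemma casimir_ideal: "ideal (Idl\<^bsub>Dq q\<^esub> {casimir q}) (Dq q)"
proof -
  interpret field_algebra "Dq q" by (rule field_algebra_Dq)
  show ?thesis by (rule genideal_ideal) (simp add: casimir_def)
qed

lemma field_algebra_Dq_mod_casimir: "field_algebra (Dq_mod_casimir q)"
  unfolding Dq_mod_casimir_def by (rule field_algebra_alg_quot[OF field_algebra_Dq casimir_ideal])

text \<open>
  The canonical map from the free algebra onto the quotient of the double, as the composition of two
  quotient maps.
\<close>

definition dq_class :: "'k::field \<Rightarrow> (dq_gen, 'k) ncpoly \<Rightarrow> (dq_gen, 'k) ncpoly set set" where
  "dq_class q p = Idl\<^bsub>Dq q\<^esub> {casimir q} +>\<^bsub>Dq q\<^esub> Dq_elem q p"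

lemma chevalley_eq: "chevalley q g = dq_class q (gen g)"
  by (simp add: chevalley_def dq_class_def)

lemma dq_class_hom: "dq_class q \<in> alg_hom (free_algebra UNIV) (Dq_mod_casimir q)"
  using alg_hom_trans[OF Dq_elem_hom alg_quot_proj[OF field_algebra_Dq casimir_ideal]]
  by (simp add: Dq_mod_casimir_def comp_def dq_class_def[abs_def])

lemma carrier_Dq_mod_casimir: "carrier (Dq_mod_casimir q) = dq_class q ` carrier (free_algebra UNIV)"
proof -
  have "carrier (Dq q) = Dq_elem q ` carrier (free_algebra UNIV)"
    unfolding Dq_def carrier_presented[OF dq_rels_carrier] Dq_elem_def[abs_def] ..
  then show ?thesis
    unfolding Dq_mod_casimir_def carrier_alg_quot[OF field_algebra_Dq casimir_ideal]
    by (simp add: dq_class_def image_image)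
qed

lemma dq_class_relation:
  assumes "r \<in> dq_rels q"
  shows "dq_class q r = \<zero>\<^bsub>Dq_mod_casimir q\<^esub>"
proof -
  interpret field_algebra_hom "Dq q" "Dq_mod_casimir q" "\<lambda>x. Idl\<^bsub>Dq q\<^esub> {casimir q} +>\<^bsub>Dq q\<^esub> x"
    by (intro field_algebra_homI field_algebra_Dq field_algebra_Dq_mod_casimir)
       (simp add: Dq_mod_casimir_def alg_quot_proj[OF field_algebra_Dq casimir_ideal])
  have "Dq_elem q r = \<zero>\<^bsub>Dq q\<^esub>"
    using presented_elem_relation[OF dq_rels_carrier assms] by (simp add: Dq_def Dq_elem_def)
  then show ?thesis using hom_zero by (simp add: dq_class_def)
qed

lemma dq_class_casimir:
  "dq_class q (gen F * gen E - scalar q * gen K - scalar (inverse q) * gen K') = \<zero>\<^bsub>Dq_mod_casimir q\<^esub>"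
proof -
  interpret field_algebra "Dq q" by (rule field_algebra_Dq)
  have "casimir q \<in> Idl\<^bsub>Dq q\<^esub> {casimir q}" by (rule genideal_self') (simp add: casimir_def)
  then show ?thesis
    using alg_quot_eq_zero_iff[OF field_algebra_Dq casimir_ideal, of "casimir q" q]
    by (simp add: dq_class_def Dq_mod_casimir_def casimir_def)
qed

lemma Dq_mod_casimir_hom_exists:
  assumes B: "field_algebra B" and x: "\<And>g. x g \<in> carrier B"
    and rel: "\<And>r. r \<in> dq_rels q \<Longrightarrow> evaluate B x r = \<zero>\<^bsub>B\<^esub>"
    and cas: "evaluate B x (gen F * gen E - scalar q * gen K - scalar (inverse q) * gen K') = \<zero>\<^bsub>B\<^esub>"
  obtains h where "h \<in> alg_hom (Dq_mod_casimir q) B" "\<And>p. h (dq_class q p) = evaluate B x p"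
proof -
  obtain h where h: "h \<in> alg_hom (Dq q) B" "\<And>p. h (Dq_elem q p) = evaluate B x p"
    using presented_hom_exists[OF dq_rels_carrier B x rel] unfolding Dq_def Dq_elem_def by (metis free_UNIV)
  have closed: "{casimir q} \<subseteq> carrier (Dq q)" by (simp add: casimir_def)
  have zero: "h y = \<zero>\<^bsub>B\<^esub>" if "y \<in> {casimir q}" for y
    using that cas by (simp only: singleton_iff casimir_def h(2))
  obtain h' where "h' \<in> alg_hom (Dq_mod_casimir q) B"
    "\<And>y. y \<in> carrier (Dq q) \<Longrightarrow> h' (Idl\<^bsub>Dq q\<^esub> {casimir q} +>\<^bsub>Dq q\<^esub> y) = h y"
    using alg_quot_hom_exists[OF field_algebra_Dq B h(1) closed zero] unfolding Dq_mod_casimir_def by metis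
  then show thesis using that[of h'] by (simp add: dq_class_def h(2))
qed

locale dq_quotient =
  fixes q :: "'k::field"
  assumes q: "q \<noteq> 0"
begin

sublocale folding_torus q 1 3
  using q by unfold_locales simp_all

abbreviation "A \<equiv> Dq_mod_casimir q"
abbreviation "ce \<equiv> dq_class q (gen E)"
abbreviation "cf \<equiv> dq_class q (gen F)"
abbreviation "ck \<equiv> dq_class q (gen K)"
abbreviation "ck_inv \<equiv> dq_class q (gen Kinv)"
abbreviation "ck' \<equiv> dq_class q (gen K')"
abbreviation "ck'_inv \<equiv> dq_class q (gen K'inv)"

sublocale A: field_algebra A
  by (rule field_algebra_Dq_mod_casimir)

lemmas dq_class_simps = free_algebra_hom_simps(1-3)[OF field_algebra_Dq_mod_casimir dq_class_hom, OF free_UNIV free_UNIV]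
  free_algebra_hom_simps(6)[OF field_algebra_Dq_mod_casimir dq_class_hom, OF free_UNIV]
  free_algebra_hom_simps(5)[OF field_algebra_Dq_mod_casimir dq_class_hom]

lemma dq_class_closed [simp]: "dq_class q p \<in> carrier A"
  by (rule dq_class_simps)

lemma dq_class_scalar: "dq_class q (scalar c) = c \<odot>\<^bsub>A\<^esub> \<one>\<^bsub>A\<^esub>"
  using free_algebra_hom_simps(4)[OF field_algebra_Dq_mod_casimir dq_class_hom[of q] free_UNIV, where c = c and p = 1]
  by (simp add: dq_class_simps)

lemma dq_class_eqI:
  assumes "p - r \<in> dq_rels q"
  shows "dq_class q p = dq_class q r"
proof -
  have "dq_class q p \<ominus>\<^bsub>A\<^esub> dq_class q r = \<zero>\<^bsub>A\<^esub>"
    using dq_class_relation[OF assms] by (simp only: dq_class_simps)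
  then show ?thesis by (rule A.eq_of_minus_zero) (rule dq_class_closed)+
qed

lemma pairs: "inverse_pair A ck ck_inv" "inverse_pair A ck' ck'_inv"
proof -
  have "dq_class q (gen K * gen Kinv) = dq_class q 1" "dq_class q (gen Kinv * gen K) = dq_class q 1"
    "dq_class q (gen K' * gen K'inv) = dq_class q 1" "dq_class q (gen K'inv * gen K') = dq_class q 1"
    by (rule dq_class_eqI, unfold dq_rels_def, intro insertI1 insertI2)+
  then show "inverse_pair A ck ck_inv" "inverse_pair A ck' ck'_inv"
    by (simp_all add: inverse_pair_def dq_class_simps)
qed

lemma comms:
  "qcomm A (q powi 2) ck ce" "qcomm A (q powi (- 2)) ck cf"
  "qcomm A (q powi (- 2)) ck' ce" "qcomm A (q powi 2) ck' cf" "qcomm A 1 ck' ck"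
proof -
  have "dq_class q (gen K * gen E) = dq_class q (scalar (q powi 2) * (gen E * gen K))"
    "dq_class q (gen K * gen F) = dq_class q (scalar (q powi (- 2)) * (gen F * gen K))"
    "dq_class q (gen K' * gen E) = dq_class q (scalar (q powi (- 2)) * (gen E * gen K'))"
    "dq_class q (gen K' * gen F) = dq_class q (scalar (q powi 2) * (gen F * gen K'))"
    "dq_class q (gen K * gen K') = dq_class q (gen K' * gen K)"
    by (rule dq_class_eqI, unfold dq_rels_def, intro insertI1 insertI2)+
  then show "qcomm A (q powi 2) ck ce" "qcomm A (q powi (- 2)) ck cf"
    "qcomm A (q powi (- 2)) ck' ce" "qcomm A (q powi 2) ck' cf" "qcomm A 1 ck' ck"
    by (simp_all add: qcomm_def dq_class_simps dq_class_scalar A.smult_mult_left A.smult_one)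
qed

lemma fe: "cf \<otimes>\<^bsub>A\<^esub> ce = q \<odot>\<^bsub>A\<^esub> ck \<oplus>\<^bsub>A\<^esub> inverse q \<odot>\<^bsub>A\<^esub> ck'"
proof -
  have "dq_class q (gen F * gen E - (scalar q * gen K + scalar (inverse q) * gen K')) = \<zero>\<^bsub>A\<^esub>"
    using dq_class_casimir[of q] by (simp only: diff_diff_eq)
  then have "cf \<otimes>\<^bsub>A\<^esub> ce \<ominus>\<^bsub>A\<^esub> (q \<odot>\<^bsub>A\<^esub> ck \<oplus>\<^bsub>A\<^esub> inverse q \<odot>\<^bsub>A\<^esub> ck') = \<zero>\<^bsub>A\<^esub>"
    by (simp add: dq_class_simps dq_class_scalar A.smult_mult_left)
  then show ?thesis by (rule A.eq_of_minus_zero) simp_all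
qed

text \<open>
  The commutator relation turns the Casimir relation for \<open>f e\<close> into one for \<open>e f\<close>. These two products
  are what reduces words in \<open>e\<close> and \<open>f\<close> to powers of one of them.
\<close>

lemma ef: "ce \<otimes>\<^bsub>A\<^esub> cf = inverse q \<odot>\<^bsub>A\<^esub> ck \<oplus>\<^bsub>A\<^esub> q \<odot>\<^bsub>A\<^esub> ck'"
proof -
  have "dq_class q (gen E * gen F - gen F * gen E) = dq_class q (scalar (q - inverse q) * (gen K' - gen K))"
    by (rule dq_class_eqI, unfold dq_rels_def, intro insertI1 insertI2)
  then have "ce \<otimes>\<^bsub>A\<^esub> cf \<ominus>\<^bsub>A\<^esub> cf \<otimes>\<^bsub>A\<^esub> ce = (q - inverse q) \<odot>\<^bsub>A\<^esub> (ck' \<ominus>\<^bsub>A\<^esub> ck)"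
    by (simp add: dq_class_simps dq_class_scalar A.smult_mult_left)
  moreover have "ce \<otimes>\<^bsub>A\<^esub> cf = (ce \<otimes>\<^bsub>A\<^esub> cf \<ominus>\<^bsub>A\<^esub> cf \<otimes>\<^bsub>A\<^esub> ce) \<oplus>\<^bsub>A\<^esub> cf \<otimes>\<^bsub>A\<^esub> ce"
    by (simp add: A.minus_eq A.a_assoc A.l_neg)
  moreover have "\<ominus>\<^bsub>A\<^esub> ((q - inverse q) \<odot>\<^bsub>A\<^esub> ck) = (inverse q - q) \<odot>\<^bsub>A\<^esub> ck"
    using A.smult_uminus[of ck "q - inverse q"] by simp
  ultimately have "ce \<otimes>\<^bsub>A\<^esub> cf = ((inverse q - q) \<odot>\<^bsub>A\<^esub> ck \<oplus>\<^bsub>A\<^esub> (q - inverse q) \<odot>\<^bsub>A\<^esub> ck')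
      \<oplus>\<^bsub>A\<^esub> (q \<odot>\<^bsub>A\<^esub> ck \<oplus>\<^bsub>A\<^esub> inverse q \<odot>\<^bsub>A\<^esub> ck')"
    by (simp add: fe A.minus_eq A.smult_r_distr A.smult_a_inv A.a_comm)
  then show ?thesis by (simp add: A.smult_add_pairs)
qed

abbreviation "dq_monomial \<equiv> A.monomial (ce, cf) (ck, ck_inv) (ck', ck'_inv)"

lemma dq_monomial_closed: "dq_monomial j \<in> carrier A"
  by (cases j) (simp add: A.monomial_def)

text \<open>
  When a factor \<open>e\<close> meets a power of \<open>f\<close>, or conversely, it cancels against one of them and leaves a
  linear combination of \<open>K\<close> and \<open>K'\<close>.
\<close>

lemma dq_monomial_shift:
  "zpow A ce cf n \<otimes>\<^bsub>A\<^esub> (c \<odot>\<^bsub>A\<^esub> ck \<oplus>\<^bsub>A\<^esub> c' \<odot>\<^bsub>A\<^esub> ck') \<otimes>\<^bsub>A\<^esub> zpow A ck ck_inv b \<otimes>\<^bsub>A\<^esub> zpow A ck' ck'_inv m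
    \<in> range (lincomb A dq_monomial)" (is "?x \<in> _")
proof -
  have "ck' \<otimes>\<^bsub>A\<^esub> zpow A ck ck_inv b = zpow A ck ck_inv b \<otimes>\<^bsub>A\<^esub> ck'"
    using A.qcomm_zpow[OF A.qcomm_swap[OF comms(5)] _ pairs(1), of b] by (simp add: qcomm_def A.smult_one)
  then have "?x = c \<odot>\<^bsub>A\<^esub> dq_monomial (n, b + 1, m) \<oplus>\<^bsub>A\<^esub> c' \<odot>\<^bsub>A\<^esub> dq_monomial (n, b, m + 1)"
    by (simp add: A.monomial_def A.r_distr A.l_distr A.smult_simps A.m_assoc
      flip: A.zpow_add_one_left[OF pairs(1)] A.zpow_add_one_left[OF pairs(2)])
  then show ?thesis
    using linear_subspaceD(3)[OF A.linear_subspace_lincombs[of dq_monomial]]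
      A.lincombs_smult_basis[of dq_monomial] dq_monomial_closed by simp
qed

lemma dq_monomials_span: "carrier A \<subseteq> range (lincomb A dq_monomial)"
proof -
  let ?L = "range (lincomb A dq_monomial)"
  have sub: "linear_subspace A ?L" by (rule A.linear_subspace_lincombs) (rule dq_monomial_closed)
  have nz: "q powi n \<noteq> 0" for n using q by simp
  have ce: "dq_monomial j \<otimes>\<^bsub>A\<^esub> ce \<in> ?L" for j
  proof (cases j)
    case (fields n b m)
    have "zpow A ce cf n \<otimes>\<^bsub>A\<^esub> ce \<otimes>\<^bsub>A\<^esub> zpow A ck ck_inv b \<otimes>\<^bsub>A\<^esub> zpow A ck' ck'_inv m \<in> ?L"
    proof (cases "0 \<le> n")
      case True
      then have "nat (n + 1) = Suc (nat n)" by simp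
      then have "zpow A ce cf n \<otimes>\<^bsub>A\<^esub> ce = zpow A ce cf (n + 1)" using True by (simp add: zpow_def del: pow_nat)
      then show ?thesis
        using A.lincombs_basis[of dq_monomial "(n + 1, b, m)", OF dq_monomial_closed] by (simp add: A.monomial_def)
    next
      case False
      then have n: "nat (- n) = Suc (nat (- (n + 1)))" by simp
      have "zpow A ce cf n = zpow A ce cf (n + 1) \<otimes>\<^bsub>A\<^esub> cf"
      proof (cases "n = - 1")
        case False
        then have "\<not> 0 \<le> n + 1" using \<open>\<not> 0 \<le> n\<close> by simp
        then show ?thesis using \<open>\<not> 0 \<le> n\<close> by (simp only: zpow_def n if_False nat_pow_Suc)
      qed (simp add: zpow_def del: pow_nat)
      then have "zpow A ce cf n \<otimes>\<^bsub>A\<^esub> ce = zpow A ce cf (n + 1) \<otimes>\<^bsub>A\<^esub> (q \<odot>\<^bsub>A\<^esub> ck \<oplus>\<^bsub>A\<^esub> inverse q \<odot>\<^bsub>A\<^esub> ck')"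
        by (simp add: A.m_assoc fe)
      then show ?thesis using dq_monomial_shift by simp
    qed
    then show ?thesis
      unfolding fields A.monomial_mult_left_factor[OF dq_class_closed dq_class_closed pairs dq_class_closed comms(1) nz comms(3) nz]
      by (rule linear_subspaceD(4)[OF sub])
  qed
  have cf: "dq_monomial j \<otimes>\<^bsub>A\<^esub> cf \<in> ?L" for j
  proof (cases j)
    case (fields n b m)
    have "zpow A ce cf n \<otimes>\<^bsub>A\<^esub> cf \<otimes>\<^bsub>A\<^esub> zpow A ck ck_inv b \<otimes>\<^bsub>A\<^esub> zpow A ck' ck'_inv m \<in> ?L"
    proof (cases "0 < n")
      case False
      then have n: "nat (- (n - 1)) = Suc (nat (- n))" "\<not> 0 \<le> n - 1" by simp_all
      have "zpow A ce cf n = cf [^]\<^bsub>A\<^esub> nat (- n)" using False by (cases "n = 0") (simp_all add: zpow_def del: pow_nat)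
      then have "zpow A ce cf n \<otimes>\<^bsub>A\<^esub> cf = zpow A ce cf (n - 1)"
        using n by (simp only: zpow_def n if_False nat_pow_Suc)
      then show ?thesis
        using A.lincombs_basis[of dq_monomial "(n - 1, b, m)", OF dq_monomial_closed] by (simp add: A.monomial_def)
    next
      case True
      then have n: "nat n = Suc (nat (n - 1))" "0 \<le> n" "0 \<le> n - 1" by simp_all
      have "zpow A ce cf n = zpow A ce cf (n - 1) \<otimes>\<^bsub>A\<^esub> ce"
        using n(2,3) by (simp only: zpow_def n(1) if_True nat_pow_Suc)
      then have "zpow A ce cf n \<otimes>\<^bsub>A\<^esub> cf = zpow A ce cf (n - 1) \<otimes>\<^bsub>A\<^esub> (inverse q \<odot>\<^bsub>A\<^esub> ck \<oplus>\<^bsub>A\<^esub> q \<odot>\<^bsub>A\<^esub> ck')"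
        by (simp add: A.m_assoc ef)
      then show ?thesis using dq_monomial_shift by simp
    qed
    then show ?thesis
      unfolding fields A.monomial_mult_left_factor[OF dq_class_closed dq_class_closed pairs dq_class_closed comms(2) nz comms(4) nz]
      by (rule linear_subspaceD(4)[OF sub])
  qed
  have "dq_class q ` carrier (free_algebra UNIV) \<subseteq> ?L"
  proof (rule free_algebra_hom_image_subset[OF A.field_algebra_axioms dq_class_hom sub])
    have "dq_monomial (0, 0, 0) = \<one>\<^bsub>A\<^esub>" by (simp add: A.monomial_def)
    then show "\<one>\<^bsub>A\<^esub> \<in> ?L" using A.lincombs_basis[of dq_monomial "(0, 0, 0)", OF dq_monomial_closed] by simp
    fix x g assume x: "x \<in> ?L"
    show "x \<otimes>\<^bsub>A\<^esub> dq_class q (gen g) \<in> ?L"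
    proof (cases g)
      case E
      show ?thesis unfolding E by (rule A.lincombs_closed_under_mult[OF dq_monomial_closed dq_class_closed ce x])
    next
      case F
      show ?thesis unfolding F by (rule A.lincombs_closed_under_mult[OF dq_monomial_closed dq_class_closed cf x])
    next
      case K
      show ?thesis unfolding K
        by (rule A.monomial_span_middle[OF dq_class_closed dq_class_closed pairs comms(5) _ _ x]) simp_all
    next
      case Kinv
      show ?thesis unfolding Kinv
        by (rule A.monomial_span_middle[OF dq_class_closed dq_class_closed pairs comms(5) _ _ x]) simp_all
    next
      case K'
      show ?thesis unfolding K'
        by (rule A.monomial_span_right[OF dq_class_closed dq_class_closed pairs _ x]) simp
    next
      case K'inv
      show ?thesis unfolding K'inv
        by (rule A.monomial_span_right[OF dq_class_closed dq_class_closed pairs _ x]) simp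
    qed
  qed
  then show ?thesis by (simp only: carrier_Dq_mod_casimir)
qed

subsection \<open>The embedding into the torus\<close>

text \<open>
  The images in the twisted group algebra. The coefficient of the image of \<open>K'\<close> comes from normal
  ordering of \<open>q X\<^sub>1 X\<^sub>3 X\<^sub>2\<close>; those of the inverses compensate \<open>\<chi> \<alpha> (- \<alpha>)\<close>.
\<close>

primrec gen_image :: "dq_gen \<Rightarrow> int \<times> int \<times> int \<Rightarrow>\<^sub>0 'k" where
  "gen_image E = Z (1, 0, 0)"
| "gen_image F = U"
| "gen_image K = single (1, 0, 1) q"
| "gen_image Kinv = single (- 1, 0, - 1) q"
| "gen_image K' = single (1, 1, 1) (q powi (- 3))"
| "gen_image K'inv = single (- 1, - 1, - 1) (q powi (- 3))"

lemma model_hom_exists: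
  obtains h where "h \<in> alg_hom A M" "\<And>g. h (dq_class q (gen g)) = gen_image g"
proof -
  have closed: "gen_image g \<in> carrier M" for g by simp
  note simps = M.evaluate_minus[OF closed] M.evaluate_mult[OF closed] M.evaluate_gen[OF closed]
    M.evaluate_one[OF closed] M.evaluate_scalar[OF closed]
  have minus: "p \<ominus>\<^bsub>M\<^esub> r = p - r" for p r
    by (simp add: a_minus_def twisted_algebra_a_inv[OF M.field_algebra_twisted])
  have cancel: "q * q / q ^ 2 = 1" "q ^ 2 / q ^ 5 = 1 / q ^ 3" "q ^ 2 / q ^ 11 = 1 / q ^ 9"
    using q by (simp add: power2_eq_square) (use q in \<open>simp_all add: divide_simps flip: power_add\<close>)
  have powers: "q * q = q ^ 2" "q * q ^ 3 = q ^ 4"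
    by (simp_all add: eval_nat_numeral)
  have collect: "Z (1, 0, 1) + (single (1, 0, 1) (q * q - 1) + single (1, 1, 1) (1 / q ^ 2)) =
    single (1, 0, 1) (q ^ 2) +
      (single (1, 1, 1) (1 / q ^ 4) + single (1, 1, 1) ((q * q - 1) / (q * q ^ 3)))"
    using q by (intro poly_mapping_eqI) (auto simp: lookup_add lookup_single when_def field_simps eval_nat_numeral)
  have rel: "evaluate M gen_image r = \<zero>\<^bsub>M\<^esub>" if "r \<in> dq_rels q" for r
    using that unfolding dq_rels_def
    by (elim insertE emptyE; simp only: simps minus gen_image.simps U_eq;
      simp add: q cancel one_eq twisted_mult_add_left twisted_mult_add_right twisted_mult_diff_right scale_add power_int_minus
        divide_simps flip: power_add)
      (simp_all add: field_simps collect)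
  have cas: "evaluate M gen_image (gen F * gen E - scalar q * gen K - scalar (inverse q) * gen K') = \<zero>\<^bsub>M\<^esub>"
    by (simp only: simps minus gen_image.simps U_eq,
      simp add: one_eq twisted_mult_add_left twisted_mult_add_right scale_add power_int_minus field_simps flip: power_add)
      (simp only: powers)
  obtain h where "h \<in> alg_hom A M" "\<And>p. h (dq_class q p) = evaluate M gen_image p"
    using Dq_mod_casimir_hom_exists[OF M.field_algebra_twisted closed rel cas] by metis
  then show thesis using that[of h] by (simp add: simps)
qed

lemma zpow_single_multiple:
  assumes "inverse_pair M (single (a, b, c) \<kappa>) y" "y = single (- a, - b, - c) \<kappa>'"
    "\<kappa> \<noteq> 0" "\<kappa>' \<noteq> 0"
  shows "\<exists>\<mu>. \<mu> \<noteq> 0 \<and> zpow M (single (a, b, c) \<kappa>) y n = single (n * a, n * b, n * c) \<mu>"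
proof (induction n rule: int_induct[where k = 0])
  case base
  show ?case by (intro exI[of _ 1]) (simp add: one_eq)
next
  case (step1 n)
  then obtain \<mu> where "\<mu> \<noteq> 0" "zpow M (single (a, b, c) \<kappa>) y n = single (n * a, n * b, n * c) \<mu>"
    by metis
  then show ?case
    using M.zpow_add_one[OF assms(1), of n] assms(3) q
    by (intro exI[of _ "torus_twist q (n * a, n * b, n * c) (a, b, c) * \<mu> * \<kappa>"]) (simp add: algebra_simps)
next
  case (step2 n)
  then obtain \<mu> where "\<mu> \<noteq> 0" "zpow M (single (a, b, c) \<kappa>) y n = single (n * a, n * b, n * c) \<mu>"
    by metis
  then show ?case
    using M.zpow_diff_one[OF assms(1), of n] assms(2,4) q
    by (intro exI[of _ "torus_twist q (n * a, n * b, n * c) (- a, - b, - c) * \<mu> * \<kappa>'"]) (simp add: algebra_simps)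
qed

text \<open>
  In this grading \<open>e\<close>, \<open>f\<close>, \<open>K\<close>, \<open>K'\<close> have the degrees \<open>1\<close>, \<open>-1\<close>, \<open>0\<close>, \<open>0\<close>.
\<close>

definition height :: "int \<times> int \<times> int \<Rightarrow> int" where
  "height = (\<lambda>(a, b, c). a - c)"

lemma height_add: "height (\<alpha> + \<beta>) = height \<alpha> + height \<beta>"
  by (cases \<alpha>, cases \<beta>) (simp add: height_def)

lemma height_zpow: "homogeneous height n (zpow M (Z (1, 0, 0)) U n)" "zpow M (Z (1, 0, 0)) U n \<noteq> 0"
proof -
  have one: "homogeneous height 0 (1 :: int \<times> int \<times> int \<Rightarrow>\<^sub>0 'k)"
    unfolding one_eq by (rule homogeneous_single) (simp add: height_def)
  have Z: "homogeneous height 1 (Z (1, 0, 0))" by (rule homogeneous_single) (simp add: height_def)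
  have U: "homogeneous height (- 1) U"
    unfolding U_eq by (intro homogeneous_add homogeneous_single) (simp_all add: height_def)
  have Z_pow: "homogeneous height (int k) (Z (1, 0, 0) [^]\<^bsub>M\<^esub> k)" for k :: nat
  proof (induction k)
    case (Suc k)
    from homogeneous_mult[OF height_add this Z, of "torus_twist q"] show ?case by (simp add: algebra_simps)
  qed (simp add: one)
  have U_pow: "homogeneous height (- int k) (U [^]\<^bsub>M\<^esub> k)" for k :: nat
  proof (induction k)
    case (Suc k)
    from homogeneous_mult[OF height_add this U, of "torus_twist q"] show ?case by (simp add: algebra_simps)
  qed (simp add: one)
  show "homogeneous height n (zpow M (Z (1, 0, 0)) U n)"
    using Z_pow[of "nat n"] U_pow[of "nat (- n)"] unfolding zpow_def by (cases "0 \<le> n") (simp_all del: pow_nat)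
  show "zpow M (Z (1, 0, 0)) U n \<noteq> 0"
    unfolding zpow_def using model_pow_nonzero[OF Z_nonzero] model_pow_nonzero[OF U_nonzero] by (simp del: pow_nat)
qed

text \<open>
  \<open>graded_independent\<close> with one class for each power \<open>n\<close> of \<open>e\<close> or \<open>f\<close>. The class of \<open>n\<close> has degree
  \<open>n\<close>, and \<open>K\<^sup>b K'\<^sup>m\<close> is sent to a nonzero multiple of the monomial with exponents
  \<open>(b + m, m, b + m)\<close>, which determine \<open>b\<close> and \<open>m\<close>.
\<close>

lemma quotient_hom_inj:
  assumes h: "h \<in> alg_hom A M" and gen: "\<And>g. h (dq_class q (gen g)) = gen_image g"
  shows "inj_on h (carrier A)"
proof -
  interpret h: field_algebra_hom A M h
    by (intro field_algebra_homI A.field_algebra_axioms M.field_algebra_twisted h)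
  have pair: "inverse_pair M (gen_image K) (gen_image Kinv)" "inverse_pair M (gen_image K') (gen_image K'inv)"
    using h.hom_inverse_pair[OF pairs(1)] h.hom_inverse_pair[OF pairs(2)] by (simp_all only: gen)
  have "\<forall>n. \<exists>\<mu>. \<mu> \<noteq> 0 \<and> zpow M (gen_image K) (gen_image Kinv) n = single (n, 0, n) \<mu>"
    using zpow_single_multiple[of 1 0 1 q "gen_image Kinv" q] pair(1) q by simp
  then obtain \<kappa> where \<kappa>: "\<And>n. \<kappa> n \<noteq> 0" "\<And>n. zpow M (gen_image K) (gen_image Kinv) n = single (n, 0, n) (\<kappa> n)"
    by metis
  have "\<forall>n. \<exists>\<mu>. \<mu> \<noteq> 0 \<and> zpow M (gen_image K') (gen_image K'inv) n = single (n, n, n) \<mu>"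
    using zpow_single_multiple[of 1 1 1 "q powi (- 3)" "gen_image K'inv" "q powi (- 3)"] pair(2) q by simp
  then obtain \<kappa>' where \<kappa>': "\<And>n. \<kappa>' n \<noteq> 0" "\<And>n. zpow M (gen_image K') (gen_image K'inv) n = single (n, n, n) (\<kappa>' n)"
    by metis
  define \<nu> where "\<nu> = (\<lambda>(n :: int, b, m). (b + m, m, b + m) :: int \<times> int \<times> int)"
  define c where "c = (\<lambda>(n :: int, b, m). torus_twist q (b, 0, b) (m, m, m) * \<kappa> b * \<kappa>' m)"
  let ?t = "\<lambda>j. twisted_mult (torus_twist q) (twisted_mult (torus_twist q)
    (zpow M (Z (1, 0, 0)) U (fst j)) (single (\<nu> j) (c j))) 1"
  have monomial: "h (dq_monomial j) = ?t j" for j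
  proof (cases j)
    case (fields n b m)
    have "h (dq_monomial j) = M.monomial (gen_image E, gen_image F) (gen_image K, gen_image Kinv) (gen_image K', gen_image K'inv) j"
      by (simp only: h.hom_monomial dq_class_closed gen)
    also have "\<dots> = ?t j"
      unfolding fields M.monomial_def prod.case fst_conv snd_conv \<kappa> \<kappa>' gen_image.simps(1,2)
      by (simp add: \<nu>_def c_def M.twisted_mult_assoc)
    finally show ?thesis .
  qed
  show ?thesis
  proof (rule h.inj_on_if_spanning_independent[OF dq_monomial_closed dq_monomials_span])
    fix p assume "lincomb M (\<lambda>j. h (dq_monomial j)) p = \<zero>\<^bsub>M\<^esub>"
    then have zero: "lincomb M ?t p = 0" by (simp only: monomial twisted_algebra_simps)
    show "p = 0"
    proof (rule M.graded_independent[where L = "zpow M (Z (1, 0, 0)) U" and R = "\<lambda>_. 1" and cl = fst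
          and \<nu> = \<nu> and \<kappa> = c and deg = height and \<delta> = "\<lambda>n. n", OF _ _ _ _ zero])
      show "zpow M (Z (1, 0, 0)) U (fst j) \<noteq> 0 \<and> c j \<noteq> 0 \<and> (1 :: int \<times> int \<times> int \<Rightarrow>\<^sub>0 'k) \<noteq> 0" for j
        using height_zpow(2)[of "fst j"] \<kappa>(1) \<kappa>'(1) q by (cases j) (simp add: c_def del: twisted_algebra_simps)
      show "homogeneous height (fst j) (?t j)" for j
      proof -
        have "height (\<nu> j) = 0" by (cases j) (simp add: \<nu>_def height_def)
        from homogeneous_mult[OF height_add height_zpow(1)[of "fst j"] homogeneous_single[where deg = height and c = "c j", OF this], of "torus_twist q"]
        show ?thesis by (simp only: M.twisted_mult_one add_0_right)
      qed
      show "inj_on (\<lambda>n. n) (fst ` keys p)" by simp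
      show "j = j'" if "fst j = fst j'" "\<nu> j = \<nu> j'" for j j'
        using that by (cases j, cases j') (simp add: \<nu>_def)
    qed
  qed
qed

end

theorem theorem3p2:
  fixes q :: "'k::field"
  assumes "q \<noteq> 0"
  shows "\<exists>\<phi> \<in> alg_hom (Dq_mod_casimir q) (torus q folding_seed).
           inj_on \<phi> (carrier (Dq_mod_casimir q)) \<and>
           (\<forall>g \<in> {E, F, K, K'}. \<phi> (chevalley q g) \<in> universally_laurent q folding_seed)"
proof -
  interpret dq_quotient q by unfold_locales fact
  obtain h where h: "h \<in> alg_hom A M" "\<And>g. h (dq_class q (gen g)) = gen_image g"
    using model_hom_exists by metis
  obtain \<sigma> where \<sigma>: "\<sigma> \<in> alg_hom M T" "bij_betw \<sigma> (carrier M) (carrier T)"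
    "\<sigma> (Z (1, 0, 0)) = x1" "\<sigma> (Z (0, 1, 0)) = x2" "\<sigma> (Z (0, 0, 1)) = x3"
    by (rule model_torus_iso)
  interpret \<sigma>: field_algebra_hom M T \<sigma>
    by (intro field_algebra_homI M.field_algebra_twisted T.field_algebra_axioms \<sigma>(1))
  have images: "(\<sigma> \<circ> h) (chevalley q E) = chev_e" "(\<sigma> \<circ> h) (chevalley q F) = chev_f"
    "(\<sigma> \<circ> h) (chevalley q K) = chev_k" "(\<sigma> \<circ> h) (chevalley q K') = chev_k'"
  proof -
    have k: "gen_image K = q \<odot>\<^bsub>M\<^esub> (Z (1, 0, 0) \<otimes>\<^bsub>M\<^esub> Z (0, 0, 1))" by simp
    have k': "gen_image K' = q \<odot>\<^bsub>M\<^esub> (Z (1, 0, 0) \<otimes>\<^bsub>M\<^esub> (Z (0, 0, 1) \<otimes>\<^bsub>M\<^esub> Z (0, 1, 0)))"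
      using q by (simp add: power_int_minus eval_nat_numeral mult.assoc [symmetric])
    show "(\<sigma> \<circ> h) (chevalley q E) = chev_e" "(\<sigma> \<circ> h) (chevalley q F) = chev_f"
      unfolding comp_apply chevalley_eq h(2) gen_image.simps chev_e_def chev_f_def
      by (simp_all only: \<sigma>.hom_mult \<sigma>.hom_add \<sigma>.hom_smult \<sigma>.hom_one \<sigma>(3-5) twisted_algebra_simps(1) UNIV_I)
    show "(\<sigma> \<circ> h) (chevalley q K) = chev_k" "(\<sigma> \<circ> h) (chevalley q K') = chev_k'"
      unfolding comp_apply chevalley_eq h(2) k k' chev_k_def chev_k'_def
      by (simp_all only: \<sigma>.hom_mult \<sigma>.hom_smult \<sigma>(3-5) twisted_algebra_simps(1) UNIV_I)
  qed
  have seed: "folding_seed = s" by (rule folding_seed_oriented)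
  have laurent: "x \<in> universally_laurent q s" if "x \<in> {chev_e, chev_f, chev_k, chev_k'}" for x
    unfolding universally_laurent_def
  proof (intro CollectI conjI allI impI)
    show "x \<in> carrier T" using that chev_closed by blast
    fix ks assume "set ks \<subseteq> vertices s - frozen s"
    then have "set ks \<subseteq> {2}" by (auto simp: oriented_seed_def)
    then show "frac_embed T x \<in> laurent_after q ks s"
      using chev_laurent_after[OF folding_torus_axioms _ that] by simp
  qed
  have "inj_on (\<sigma> \<circ> h) (carrier A)"
  proof (rule comp_inj_on[OF quotient_hom_inj[OF h]])
    show "inj_on \<sigma> (h ` carrier A)"
      by (rule inj_on_subset[OF bij_betw_imp_inj_on[OF \<sigma>(2)]]) simp
  qed
  moreover have "\<forall>g \<in> {E, F, K, K'}. (\<sigma> \<circ> h) (chevalley q g) \<in> universally_laurent q s"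
  proof
    fix g assume "g \<in> {E, F, K, K'}"
    then have "(\<sigma> \<circ> h) (chevalley q g) \<in> {chev_e, chev_f, chev_k, chev_k'}"
      by (elim insertE emptyE) (simp_all only: images insert_iff simp_thms)
    then show "(\<sigma> \<circ> h) (chevalley q g) \<in> universally_laurent q s" by (rule laurent)
  qed
  ultimately show ?thesis
    unfolding seed using alg_hom_trans[OF h(1) \<sigma>(1)] by blast
qed

end
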